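(* Let $d$ denote the maximum vector space dimension in a quiver representation of type $A_{n+1}$ over a field $\mathbb F$ (finite-dimensional spaces $V_0,\dots,V_n$, $n$ edges of arbitrary directions). When the divide and conquer algorithm described in the context is used recursively, it computes the barcode form in $$O\big(d^3 n+(d\log d)(n\log n)\big)$$ time when run sequentially.
   Context: Setting. Type $A_{n+1}$: the underlying graph is a line with vertices $0,\dots,n$. Edge $i$ ($0\le i\le n-1$) joins $V_i$ and $V_{i+1}$ and carries a matrix $A_i$; it has direction $\leftarrow$ if $A_i:V_{i+1}\to V_i$ and $\rightarrow$ if $A_i:V_i\to V_{i+1}$. Representations of the same directed graph are isomorphic if they differ by invertible changes of basis at the vertices. A pivot matrix has at most one non-zero entry in each row and each column, the non-zero entries being $1$. Computing the barcode form means finding an isomorphic representation all of whose edge matrices are pivot matrices (equivalently, whose companion matrix, i.e. the block matrix on $\bigoplus_iV_i$ with the edge matrices as non-zero blocks, is $PTP^T$ with $T$ a direct sum of companion matrices of interval representations and $P$ a permutation respecting the vertex blocks). Shapes. $E_L$: $E=\sum_{(i,j)\in S}e_ie_j^T$ is a pivot matrix such that, writing $(i(j),j)$ for elements of $S$, $j_1<j_2$ implies $i(j_1)<i(j_2)$, and every column to the right of a zero column is zero. With $J$ the anti-diagonal permutation matrix: $E_U=(E_L)^T$; $\hat E_L=JE_UJ$; $\hat E_U=JE_LJ$. $L$, $U$, $P$ denote invertible lower triangular, invertible upper triangular, permutation matrices; $Q$ a pivot matrix. Every matrix can be factored in each of the forms $LE_LUP$, $PLE_UU$, $U\hat E_ULP$,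 $PU\hat E_LL$, $LQU$, $UQL$; every pivot matrix in the forms $E_LP$, $PE_U$, $\hat E_UP$, $P\hat E_L$; and products can be rewritten (commuted) as $E_LL=\tilde LE_L$, $L\hat E_L=\hat E_L\tilde L$, $UE_U=E_U\tilde U$, $\hat E_UU=\tilde U\hat E_U$. "Passing" a factor through a vertex means performing the change of basis at that vertex that removes the factor from one incident edge matrix and multiplies the other incident edge matrix by it or its inverse. Rightward form: edges $\leftarrow$ carry $E_L$ shapes and edges $\rightarrow$ carry $\hat E_L$ shapes, up to leftover triangular/permutation factors at the two end vertices; leftward form: edges $\leftarrow$ carry $E_U$ shapes and edges $\rightarrow$ carry $\hat E_U$ shapes, up to such leftover factors. For one edge, these are obtained by the factorizations $LE_LUP$, $PU\hat E_LL$ (rightward) and $PLE_UU$, $U\hat E_ULP$ (leftward). Divide and conquer algorithm (output in rightward or leftward form, as requested): (1) choose the middle edge $m=\lfloor n/2\rfloor$; (2) recursively put the edges $A_0,\dots,A_{m-1}$ in rightward form and the edges $A_{m+1},\dots,A_{n-1}$ in leftward form; (3) pass the leftover factors at $V_m$ and $V_{m+1}$ to edge $m$, obtaining $\tilde A_m$; (4) factor $\tilde A_m=L_mQ_mU_m$ if edge $m$ is $\leftarrow$, and $\tilde A_m=U_mQ_mL_m$ if it is $\rightarrow$; (5) pass and commute $L_m$ to the left through edges $m-1,\dots,0$ and $U_m$ to the right through edges $m+1,\dots,n-1$, leaving triangular factors only at the end vertices; (6) for rightward form, starting from edge $m$ and moving right, factor the pivot matrix on each edge as $E_LP$ (if $\leftarrow$)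 or $P\hat E_L$ (if $\rightarrow$) and pass $P$ rightward; for leftward form, starting from edge $m$ and moving left, factor as $PE_U$ (if $\leftarrow$) or $\hat E_UP$ (if $\rightarrow$) and pass $P$ leftward. At the top level, the leftover factors at $V_0$ and $V_n$ are removed by changes of basis there. Permutation and pivot matrices are stored in sparse format. Time is counted with unit cost for operations in $\mathbb F$ and elementary index operations, the algorithm being suitably implemented. *)

theory Defs
  imports
    "Jordan_Normal_Form.Matrix"
    "HOL-Library.Monad_Syntax"
    Complex_Main
begin

section \<open>Type A representations and barcode forms\<close>

datatype direction = ToLeft | ToRight

text \<open>
  A representation is given by the dimensions \<open>ds\<close> of \<open>V\<^sub>0, \<dots>, V\<^sub>n\<close>, the directions \<open>es\<close> of the
  \<open>n\<close> edges and their matrices \<open>As\<close>. Edge \<open>i\<close> is a map \<open>V\<^sub>i\<^sub>+\<^sub>1 \<rightarrow> V\<^sub>i\<close> if it is \<open>ToLeft\<close> and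
  \<open>V\<^sub>i \<rightarrow> V\<^sub>i\<^sub>+\<^sub>1\<close> if it is \<open>ToRight\<close>. Spaces of dimension 0 are allowed.
\<close>

definition quiver_rep :: "nat list \<Rightarrow> direction list \<Rightarrow> 'a mat list \<Rightarrow> bool" where
  "quiver_rep ds es As \<longleftrightarrow>
     length ds = Suc (length es) \<and> length As = length es \<and>
     (\<forall>i < length es. As ! i \<in> (case es ! i of
          ToLeft \<Rightarrow> carrier_mat (ds ! i) (ds ! Suc i)
        | ToRight \<Rightarrow> carrier_mat (ds ! Suc i) (ds ! i)))"

definition rep_iso ::
  "nat list \<Rightarrow> direction list \<Rightarrow> 'a::field mat list \<Rightarrow> 'a mat list \<Rightarrow> bool" where
  "rep_iso ds es As Bs \<longleftrightarrow>
     (\<exists>g. (\<forall>i < length ds. g i \<in> carrier_mat (ds ! i) (ds ! i) \<and> invertible_mat (g i)) \<and>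
          (\<forall>i < length es. case es ! i of
              ToLeft \<Rightarrow> As ! i * g (Suc i) = g i * Bs ! i
            | ToRight \<Rightarrow> As ! i * g i = g (Suc i) * Bs ! i))"

definition pivot_mat :: "'a::field mat \<Rightarrow> bool" where
  "pivot_mat A \<longleftrightarrow>
     (\<forall>i < dim_row A. \<forall>j < dim_col A. A $$ (i, j) \<noteq> 0 \<longrightarrow>
        A $$ (i, j) = 1 \<and>
        (\<forall>j' < dim_col A. A $$ (i, j') \<noteq> 0 \<longrightarrow> j' = j) \<and>
        (\<forall>i' < dim_row A. A $$ (i', j) \<noteq> 0 \<longrightarrow> i' = i))"

definition barcode_form ::
  "nat list \<Rightarrow> direction list \<Rightarrow> 'a::field mat list \<Rightarrow> 'a mat list \<Rightarrow> bool" where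
  "barcode_form ds es As Bs \<longleftrightarrow>
     quiver_rep ds es Bs \<and> rep_iso ds es As Bs \<and> (\<forall>B \<in> set Bs. pivot_mat B)"

text \<open>
  Sparse format: the pivot matrix on edge \<open>k\<close> is stored as a list \<open>f\<close> of length \<open>dim V\<^sub>k\<close>, read
  from left to right whatever the direction of the edge: \<open>f ! i = Some j\<close> if the \<open>1\<close> pairs the
  basis vector \<open>i\<close> of \<open>V\<^sub>k\<close> with the basis vector \<open>j\<close> of \<open>V\<^sub>k\<^sub>+\<^sub>1\<close>.
\<close>

type_synonym matching = "nat option list"

definition dense :: "nat list \<Rightarrow> direction list \<Rightarrow> matching list \<Rightarrow> 'a::field mat list" where
  "dense ds es fs = map (\<lambda>k. case es ! k of
       ToLeft \<Rightarrow> mat (ds ! k) (ds ! Suc k) (\<lambda>(i, j). if fs ! k ! i = Some j then 1 else 0)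
     | ToRight \<Rightarrow> mat (ds ! Suc k) (ds ! k) (\<lambda>(j, i). if fs ! k ! i = Some j then 1 else 0))
     [0..<length es]"


section \<open>Sequential computations with unit cost\<close>

text \<open>
  \<open>tick\<close> is applied to at most one elementary operation (an arithmetic operation or test in the
  field, a test on indices, reading or writing one cell of a matrix or array, adding
  a cell to a list, reading an entry of the input) or to a fixed expression in indices. Lists model arrays, so \<open>xs ! i\<close> costs one
  unit; so does \<open>xs[i := x]\<close>, which is only used where the old array is not needed afterwards.
  Matrices and arrays are built cell by cell, with at least one unit per cell. Untimed are only branching,
  tupling, and passing references, a bounded number of which accompany each tick.
\<close>

datatype 'a timed = Timed (result: 'a) (cost: nat)

definition return :: "'a \<Rightarrow> 'a timed" where
  "return x = Timed x 0"

definition tick :: "'a \<Rightarrow> 'a timed" where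
  "tick x = Timed x 1"

definition bind_timed :: "'a timed \<Rightarrow> ('a \<Rightarrow> 'b timed) \<Rightarrow> 'b timed" where
  "bind_timed m f = (case m of Timed x a \<Rightarrow> (case f x of Timed y b \<Rightarrow> Timed y (a + b)))"

adhoc_overloading Monad_Syntax.bind \<rightleftharpoons> bind_timed

fun map_t :: "('a \<Rightarrow> 'b timed) \<Rightarrow> 'a list \<Rightarrow> 'b list timed" where
  "map_t f [] = tick []"
| "map_t f (x # xs) = do {
     y \<leftarrow> f x;
     ys \<leftarrow> map_t f xs;
     tick (y # ys)
   }"

fun filter_t :: "('a \<Rightarrow> bool timed) \<Rightarrow> 'a list \<Rightarrow> 'a list timed" where
  "filter_t p [] = tick []"
| "filter_t p (x # xs) = do {
     b \<leftarrow> p x;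
     ys \<leftarrow> filter_t p xs;
     tick (if b then x # ys else ys)
   }"

fun append_t :: "'a list \<Rightarrow> 'a list \<Rightarrow> 'a list timed" where
  "append_t [] ys = tick ys"
| "append_t (x # xs) ys = do {
     zs \<leftarrow> append_t xs ys;
     tick (x # zs)
   }"

fun fold_t :: "('a \<Rightarrow> 's \<Rightarrow> 's timed) \<Rightarrow> 'a list \<Rightarrow> 's \<Rightarrow> 's timed" where
  "fold_t f [] s = tick s"
| "fold_t f (x # xs) s = do {
     s' \<leftarrow> f x s;
     s'' \<leftarrow> fold_t f xs s';
     tick s''
   }"

fun find_t :: "('a \<Rightarrow> bool timed) \<Rightarrow> 'a list \<Rightarrow> 'a option timed" where
  "find_t p [] = tick None"
| "find_t p (x # xs) = do {
     b \<leftarrow> p x;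
     r \<leftarrow> (if b then return (Some x) else find_t p xs);
     tick r
   }"

definition array_t :: "nat \<Rightarrow> (nat \<Rightarrow> 'a timed) \<Rightarrow> 'a list timed" where
  "array_t n f = map_t f [0..<n]"

definition mat_t :: "nat \<Rightarrow> nat \<Rightarrow> (nat \<Rightarrow> nat \<Rightarrow> 'a timed) \<Rightarrow> 'a mat timed" where
  "mat_t nr nc f = do {
     rows \<leftarrow> array_t nr (\<lambda>i. array_t nc (f i));
     return (mat_of_rows_list nc rows)
   }"


section \<open>Dense matrices\<close>

definition id_t :: "nat \<Rightarrow> 'a::field mat timed" where
  "id_t n = mat_t n n (\<lambda>i j. do {
     b \<leftarrow> tick (i = j);
     return (if b then 1 else 0)
   })"

definition mult_t :: "'a::field mat \<Rightarrow> 'a mat \<Rightarrow> 'a mat timed" where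
  "mult_t A B = mat_t (dim_row A) (dim_col B) (\<lambda>i j.
     fold_t (\<lambda>k s. do {
       x \<leftarrow> tick (A $$ (i, k));
       y \<leftarrow> tick (B $$ (k, j));
       z \<leftarrow> tick (x * y);
       tick (s + z)
     }) [0..<dim_col A] 0)"

text \<open>Conjugation with the anti-diagonal permutation matrices of the appropriate sizes.\<close>

definition flip_t :: "'a mat \<Rightarrow> 'a mat timed" where
  "flip_t A = mat_t (dim_row A) (dim_col A) (\<lambda>i j. do {
     i' \<leftarrow> tick (dim_row A - Suc i);
     j' \<leftarrow> tick (dim_col A - Suc j);
     tick (A $$ (i', j'))
   })"

definition inverse_step :: "nat \<Rightarrow> nat \<Rightarrow> 'a::field mat \<times> 'a mat \<Rightarrow> ('a mat \<times> 'a mat) timed" where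
  "inverse_step n j = (\<lambda>(M, B). do {
     pivot \<leftarrow> find_t (\<lambda>i. do { x \<leftarrow> tick (M $$ (i, j)); tick (x \<noteq> 0) }) [j..<n];
     (case pivot of
       None \<Rightarrow> return (M, B)
     | Some i \<Rightarrow> do {
         v \<leftarrow> tick (M $$ (i, j));
         let reduce = (\<lambda>X. mat_t n n (\<lambda>r c. do {
             x \<leftarrow> tick (X $$ (i, c));
             y \<leftarrow> tick (x / v);
             is_j \<leftarrow> tick (r = j);
             is_i \<leftarrow> tick (r = i);
             (if is_j then return y
              else do {
                let r' = (if is_i then j else r);
                a \<leftarrow> tick (X $$ (r', c));
                b \<leftarrow> tick (M $$ (r', j));
                z \<leftarrow> tick (b * y);
                tick (a - z)
              })
           }));
         M' \<leftarrow> reduce M;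
         B' \<leftarrow> reduce B;
         return (M', B')
       })
   })"

text \<open>Gauss-Jordan elimination; only applied to invertible matrices.\<close>

definition inverse_t :: "'a::field mat \<Rightarrow> 'a mat timed" where
  "inverse_t A = do {
     I \<leftarrow> id_t (dim_row A);
     (M, B) \<leftarrow> fold_t (inverse_step (dim_row A)) [0..<dim_row A] (A, I);
     return B
   }"


section \<open>The factorizations LQU and UQL\<close>

text \<open>
  \<open>L\<close>, \<open>U\<close>, \<open>P\<close> stand for invertible lower triangular, invertible upper triangular and permutation
  matrices, \<open>Q\<close> for a pivot matrix and \<open>J\<close> for the anti-diagonal permutation matrix. A pivot
  matrix has shape \<open>E\<^sub>L\<close> if its nonzero columns come first and the row of the 1 increases
  with the column. Shape \<open>E\<^sub>U\<close> is the transpose of \<open>E\<^sub>L\<close>, hatted \<open>E\<^sub>L\<close> is \<open>J E\<^sub>U J\<close> and hatted \<open>E\<^sub>U\<close>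
  is \<open>J E\<^sub>L J\<close>. In rightward form \<open>ToLeft\<close> edges have shape \<open>E\<^sub>L\<close> and \<open>ToRight\<close> edges hatted
  \<open>E\<^sub>L\<close>; in leftward form \<open>E\<^sub>U\<close> and hatted \<open>E\<^sub>U\<close>.

  \<open>lqu_t\<close> computes \<open>A = L Q U\<close>, where \<open>Q\<close> is returned as the partial map from rows to columns.
  Each step subtracts from \<open>M\<close> the product of its pivot column, scaled to have pivot entry 1, and
  its pivot row, and records these as column \<open>i\<close> of \<open>L\<close> and row \<open>j\<close> of \<open>U\<close>.
  The pivots are searched by rows (leftmost entry) or by columns (topmost entry). Searching by
  rows, the \<open>E\<^sub>L P\<close> factorization of \<open>Q\<close> moreover satisfies \<open>P U = U' P\<close> with \<open>U'\<close> upper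
  triangular, that is, \<open>A = L E\<^sub>L U' P\<close>; searching by columns, \<open>Q = P E\<^sub>U\<close> satisfies
  \<open>L P = P L'\<close> with \<open>L'\<close> lower triangular, that is, \<open>A = P L' E\<^sub>U U\<close>.
\<close>

definition lqu_step :: "bool \<Rightarrow> nat \<Rightarrow> 'a::field mat \<times> 'a mat \<times> 'a mat \<times> matching \<Rightarrow>
    ('a mat \<times> 'a mat \<times> 'a mat \<times> matching) timed" where
  "lqu_step by_row k = (\<lambda>(M, L, U, q). do {
     let nr = dim_row M;
     let nc = dim_col M;
     pivot \<leftarrow> (if by_row
       then do {
         c \<leftarrow> find_t (\<lambda>j. do { x \<leftarrow> tick (M $$ (k, j)); tick (x \<noteq> 0) }) [0..<nc];
         return (case c of None \<Rightarrow> None | Some j \<Rightarrow> Some (k, j))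
       }
       else do {
         c \<leftarrow> find_t (\<lambda>i. do { x \<leftarrow> tick (M $$ (i, k)); tick (x \<noteq> 0) }) [0..<nr];
         return (case c of None \<Rightarrow> None | Some i \<Rightarrow> Some (i, k))
       });
     (case pivot of
       None \<Rightarrow> return (M, L, U, q)
     | Some (i, j) \<Rightarrow> do {
         v \<leftarrow> tick (M $$ (i, j));
         L' \<leftarrow> mat_t nr nr (\<lambda>r c. do {
           b \<leftarrow> tick (c = i);
           (if b then do { x \<leftarrow> tick (M $$ (r, j)); tick (x / v) }
            else tick (L $$ (r, c)))
         });
         U' \<leftarrow> mat_t nc nc (\<lambda>r c. do {
           b \<leftarrow> tick (r = j);
           (if b then tick (M $$ (i, c)) else tick (U $$ (r, c)))
         });
         M' \<leftarrow> mat_t nr nc (\<lambda>r c. do {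
           x \<leftarrow> tick (M $$ (r, j));
           y \<leftarrow> tick (x / v);
           z \<leftarrow> tick (M $$ (i, c));
           w \<leftarrow> tick (y * z);
           m \<leftarrow> tick (M $$ (r, c));
           tick (m - w)
         });
         q' \<leftarrow> tick (q[i := Some j]);
         return (M', L', U', q')
       })
   })"

definition lqu_t :: "bool \<Rightarrow> 'a::field mat \<Rightarrow> ('a mat \<times> matching \<times> 'a mat) timed" where
  "lqu_t by_row A = do {
     L \<leftarrow> id_t (dim_row A);
     U \<leftarrow> id_t (dim_col A);
     q \<leftarrow> array_t (dim_row A) (\<lambda>i. return None);
     (M, L', U', q') \<leftarrow> fold_t (lqu_step by_row)
       (if by_row then [0..<dim_row A] else [0..<dim_col A]) (A, L, U, q);
     return (L', q', U')
   }"

text \<open>The matching read in the opposite direction; \<open>d\<close> is the dimension of the target of \<open>f\<close>.\<close>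

definition converse_t :: "nat \<Rightarrow> matching \<Rightarrow> matching timed" where
  "converse_t d f = do {
     g \<leftarrow> array_t d (\<lambda>j. return None);
     fold_t (\<lambda>i g. do {
       x \<leftarrow> tick (f ! i);
       (case x of None \<Rightarrow> return g | Some j \<Rightarrow> tick (g[j := Some i]))
     }) [0..<length f] g
   }"

datatype form = Rightward | Leftward

text \<open>
  The result \<open>(G, H, f)\<close> consists of the changes of basis \<open>G\<close> at the left and \<open>H\<close> at the
  right vertex and of the pivot matrix \<open>Q\<close> in sparse format. For \<open>A = L Q U\<close> on a \<open>ToLeft\<close> edge,
  \<open>A H = G Q\<close> with \<open>G = L\<close> and \<open>H\<close> the inverse of \<open>U\<close>. For \<open>A = U Q L\<close> on a \<open>ToRight\<close> edge,
  \<open>A G = H Q\<close> with \<open>G\<close> the inverse of \<open>L\<close> and \<open>H = U\<close>; this factorization is obtained from the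
  \<open>LQU\<close> factorization of \<open>J A J\<close>. So \<open>G\<close> is lower and \<open>H\<close> is upper triangular in both cases.
  The pivot search is chosen such that, if there is only one edge, the four combinations of
  direction and form yield the factorizations \<open>L E\<^sub>L U P\<close>, \<open>P L E\<^sub>U U\<close> (\<open>ToLeft\<close>) and, with hats on
  the shapes, \<open>P U E\<^sub>L L\<close>, \<open>U E\<^sub>U L P\<close> (\<open>ToRight\<close>).
\<close>

definition factor_t ::
  "form \<Rightarrow> direction \<Rightarrow> 'a::field mat \<Rightarrow> ('a mat \<times> 'a mat \<times> matching) timed" where
  "factor_t fm e A = (case e of
     ToLeft \<Rightarrow> do {
       (L, q, U) \<leftarrow> lqu_t (fm = Rightward) A;
       H \<leftarrow> inverse_t U;
       return (L, H, q)
     }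
   | ToRight \<Rightarrow> do {
       A' \<leftarrow> flip_t A;
       (L, q, U) \<leftarrow> lqu_t (fm = Leftward) A';
       H \<leftarrow> flip_t L;
       U' \<leftarrow> flip_t U;
       G \<leftarrow> inverse_t U';
       q' \<leftarrow> converse_t (dim_col A) q;
       f \<leftarrow> array_t (dim_col A) (\<lambda>c. do {
         c' \<leftarrow> tick (dim_col A - Suc c);
         x \<leftarrow> tick (q' ! c');
         (case x of None \<Rightarrow> return None
          | Some r \<Rightarrow> do { r' \<leftarrow> tick (dim_row A - Suc r); return (Some r') })
       });
       return (G, H, f)
     })"


section \<open>Passing triangular factors through edges\<close>

text \<open>
  Let \<open>T\<close> be lower triangular and \<open>E\<close> have shape \<open>E\<^sub>L\<close>, or hatted \<open>E\<^sub>L\<close>. If \<open>f\<close> is the matching of \<open>E\<close>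
  read from the vertex that \<open>T\<close> is passed to, then the matrix with entries \<open>T $$ (f r, f c)\<close> where \<open>f r\<close> and
  \<open>f c\<close> are defined, and those of the identity matrix elsewhere, is lower triangular and is what
  \<open>T\<close> commutes to: \<open>E T = T' E\<close> on a \<open>ToLeft\<close> edge and \<open>T E = E T'\<close> on a \<open>ToRight\<close> edge if \<open>T\<close>
  moves left. The same holds for upper triangular matrices, \<open>E\<^sub>U\<close>, and moves to the right.
  The shapes do not change and these reindexings compose, so passing
  through a sequence of edges only requires composing the matchings and reindexing once.
\<close>

fun compose_left :: "matching list \<Rightarrow> matching \<Rightarrow> matching timed" where
  "compose_left [] h = tick h"
| "compose_left (f # fs) h = do {
     h' \<leftarrow> compose_left fs h;
     h'' \<leftarrow> map_t (\<lambda>x. case x of None \<Rightarrow> return None | Some j \<Rightarrow> tick (h' ! j)) f;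
     tick h''
   }"

text \<open>Here \<open>h\<close> maps the basis at vertex \<open>k\<close>, the left end of the first edge in the list.\<close>

fun compose_right :: "nat list \<Rightarrow> nat \<Rightarrow> matching list \<Rightarrow> matching \<Rightarrow> matching timed" where
  "compose_right ds k [] h = tick h"
| "compose_right ds k (f # fs) h = do {
     k' \<leftarrow> tick (Suc k);
     d \<leftarrow> tick (ds ! k');
     g \<leftarrow> converse_t d f;
     h' \<leftarrow> map_t (\<lambda>x. case x of None \<Rightarrow> return None | Some j \<Rightarrow> tick (h ! j)) g;
     compose_right ds k' fs h'
   }"

definition reindex_t :: "nat \<Rightarrow> matching \<Rightarrow> 'a::field mat \<Rightarrow> 'a mat timed" where
  "reindex_t d h T = mat_t d d (\<lambda>r c. do {
     x \<leftarrow> tick (h ! r);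
     y \<leftarrow> tick (h ! c);
     (case (x, y) of
       (Some i, Some j) \<Rightarrow> tick (T $$ (i, j))
     | _ \<Rightarrow> do { b \<leftarrow> tick (r = c); return (if b then 1 else 0) })
   })"


section \<open>Passing permutations through edges\<close>

text \<open>
  A permutation at a vertex is stored as a list \<open>p\<close> with \<open>p ! t\<close> the old index of the new basis
  vector \<open>t\<close>. Let \<open>h\<close> be the matching of a pivot matrix, read in the direction in which
  permutations are passed, and \<open>d\<close> the dimension of its target vertex. \<open>align_t\<close> reorders
  the basis of the target such that the indices that are hit become consecutive and
  increasing; they come first on a \<open>ToLeft\<close> edge and last on a \<open>ToRight\<close> edge. Moving right, these are the
  factorizations \<open>E\<^sub>L P\<close> and (with a hat) \<open>P E\<^sub>L\<close>; moving left, \<open>P E\<^sub>U\<close> and (with a hat) \<open>E\<^sub>U P\<close>.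
  The result is the new matching together with the permutation.
\<close>

definition align_t :: "direction \<Rightarrow> nat \<Rightarrow> matching \<Rightarrow> (matching \<times> nat list) timed" where
  "align_t e d h = do {
     g \<leftarrow> converse_t d h;
     matched \<leftarrow> filter_t (\<lambda>x. tick (x \<noteq> None)) h;
     hits \<leftarrow> map_t (\<lambda>x. tick (the x)) matched;
     rest \<leftarrow> filter_t (\<lambda>j. do { x \<leftarrow> tick (g ! j); tick (x = None) }) [0..<d];
     p \<leftarrow> (case e of ToLeft \<Rightarrow> append_t hits rest | ToRight \<Rightarrow> append_t rest hits);
     pos0 \<leftarrow> array_t d (\<lambda>j. return 0);
     pos \<leftarrow> fold_t (\<lambda>t pos. do { j \<leftarrow> tick (p ! t); tick (pos[j := t]) }) [0..<d] pos0;
     h' \<leftarrow> map_t (\<lambda>x. case x of None \<Rightarrow> return None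
                       | Some j \<Rightarrow> do { t \<leftarrow> tick (pos ! j); return (Some t) }) h;
     return (h', p)
   }"

text \<open>
  \<open>k\<close> is the left end of the first edge in the list. \<open>p\<close> is the permutation at vertex \<open>k\<close>
  for \<open>sweep_right\<close>, and at the right end of the last edge for \<open>sweep_left\<close>.
\<close>

fun sweep_right :: "nat list \<Rightarrow> direction list \<Rightarrow> nat \<Rightarrow> nat list \<Rightarrow> matching list \<Rightarrow>
    (matching list \<times> nat list) timed" where
  "sweep_right ds es k p [] = tick ([], p)"
| "sweep_right ds es k p (f # fs) = do {
     e \<leftarrow> tick (es ! k);
     k' \<leftarrow> tick (Suc k);
     d \<leftarrow> tick (ds ! k');
     h \<leftarrow> map_t (\<lambda>i. tick (f ! i)) p;
     (f', p') \<leftarrow> align_t e d h;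
     (fs', p'') \<leftarrow> sweep_right ds es k' p' fs;
     tick (f' # fs', p'')
   }"

fun sweep_left :: "nat list \<Rightarrow> direction list \<Rightarrow> nat \<Rightarrow> nat list \<Rightarrow> matching list \<Rightarrow>
    (matching list \<times> nat list) timed" where
  "sweep_left ds es k p [] = tick ([], p)"
| "sweep_left ds es k p (f # fs) = do {
     k' \<leftarrow> tick (Suc k);
     (fs', p') \<leftarrow> sweep_left ds es k' p fs;
     e \<leftarrow> tick (es ! k);
     d \<leftarrow> tick (ds ! k);
     d' \<leftarrow> tick (ds ! k');
     g \<leftarrow> converse_t d' f;
     h \<leftarrow> map_t (\<lambda>i. tick (g ! i)) p';
     (h', p'') \<leftarrow> align_t e d h;
     f' \<leftarrow> converse_t d h';
     tick (f' # fs', p'')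
   }"

definition permute_columns_t :: "'a mat \<Rightarrow> nat list \<Rightarrow> 'a mat timed" where
  "permute_columns_t A p = mat_t (dim_row A) (dim_col A) (\<lambda>r c. do {
     c' \<leftarrow> tick (p ! c);
     tick (A $$ (r, c'))
   })"


section \<open>The divide and conquer algorithm\<close>

text \<open>
  \<open>solve ds es As fm a n\<close> treats the edges \<open>a, \<dots>, a + n - 1\<close>. In its result \<open>(fs, X, Y)\<close>, \<open>fs\<close> are the
  pivot matrices of the edges and the invertible matrices \<open>X\<close> and \<open>Y\<close> are the leftover factors at the
  vertices \<open>a\<close> and \<open>a + n\<close>, stored as changes of basis: there are invertible \<open>g\<^sub>a, \<dots>, g\<^sub>a\<^sub>+\<^sub>n\<close> with
  \<open>g\<^sub>a = X\<close> and \<open>g\<^sub>a\<^sub>+\<^sub>n = Y\<close> such that \<open>A\<^sub>i g\<^sub>i\<^sub>+\<^sub>1 = g\<^sub>i B\<^sub>i\<close> if edge \<open>i\<close> is \<open>ToLeft\<close> and \<open>A\<^sub>i g\<^sub>i = g\<^sub>i\<^sub>+\<^sub>1 B\<^sub>i\<close> if it is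
  \<open>ToRight\<close>, where \<open>B\<^sub>i\<close> is the pivot matrix of edge \<open>i\<close>. For \<open>n = 0\<close> the two end vertices coincide
  and there is nothing to pass.
\<close>

function solve :: "nat list \<Rightarrow> direction list \<Rightarrow> 'a::field mat list \<Rightarrow> form \<Rightarrow> nat \<Rightarrow> nat \<Rightarrow>
    (matching list \<times> 'a mat \<times> 'a mat) timed" where
  "solve ds es As fm a n =
     (if n = 0 then do {
        d \<leftarrow> tick (ds ! a);
        I \<leftarrow> id_t d;
        return ([], I, I)
      }
      else do {
        m \<leftarrow> tick (a + n div 2);
        m' \<leftarrow> tick (Suc m);
        (fs1, X1, Y1) \<leftarrow> solve ds es As Rightward a (n div 2);
        (fs2, X2, Y2) \<leftarrow> solve ds es As Leftward m' (n - Suc (n div 2));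
        e \<leftarrow> tick (es ! m);
        A \<leftarrow> tick (As ! m);
        A' \<leftarrow> (case e of
          ToLeft \<Rightarrow> do { Z \<leftarrow> inverse_t Y1; B \<leftarrow> mult_t Z A; mult_t B X2 }
        | ToRight \<Rightarrow> do { Z \<leftarrow> inverse_t X2; B \<leftarrow> mult_t Z A; mult_t B Y1 });
        (G, H, f) \<leftarrow> factor_t fm e A';
        dm \<leftarrow> tick (ds ! m);
        i1 \<leftarrow> array_t dm (\<lambda>i. return (Some i));
        h1 \<leftarrow> compose_left fs1 i1;
        G' \<leftarrow> reindex_t (dim_col X1) h1 G;
        X \<leftarrow> mult_t X1 G';
        dm' \<leftarrow> tick (ds ! m');
        i2 \<leftarrow> array_t dm' (\<lambda>i. return (Some i));
        h2 \<leftarrow> compose_right ds m' fs2 i2;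
        H' \<leftarrow> reindex_t (dim_col Y2) h2 H;
        Y \<leftarrow> mult_t Y2 H';
        (case fm of
          Rightward \<Rightarrow> do {
            p \<leftarrow> array_t dm return;
            (fs3, p') \<leftarrow> sweep_right ds es m p (f # fs2);
            fs \<leftarrow> append_t fs1 fs3;
            Y' \<leftarrow> permute_columns_t Y p';
            return (fs, X, Y')
          }
        | Leftward \<Rightarrow> do {
            p \<leftarrow> array_t dm' return;
            fs3 \<leftarrow> append_t fs1 [f];
            (fs4, p') \<leftarrow> sweep_left ds es a p fs3;
            fs \<leftarrow> append_t fs4 fs2;
            X' \<leftarrow> permute_columns_t X p';
            return (fs, X', Y)
          })
      })"
  by pat_completeness auto
termination by (relation "measure (\<lambda>(ds, es, As, fm, a, n). n)") auto

declare solve.simps [simp del]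

text \<open>
  Removing the leftover factors at the two end vertices by changes of basis there amounts to
  discarding them.
\<close>

definition divide_and_conquer ::
  "form \<Rightarrow> nat list \<Rightarrow> direction list \<Rightarrow> 'a::field mat list \<Rightarrow> matching list timed" where
  "divide_and_conquer fm ds es As = do {
     (fs, X, Y) \<leftarrow> solve ds es As fm 0 (length es);
     return fs
   }"

end

theory Submission
  imports Defs "Jordan_Normal_Form.Determinant"
begin

text \<open>
  Correctness. An edge matrix \<open>A\<close> turns into \<open>B\<close> under the changes of basis \<open>G\<close> and \<open>H\<close> at its left and
  right vertex if \<open>A H = G B\<close> or \<open>A G = H B\<close>, depending on its direction (\<open>intertwines\<close>). The relation
  \<open>chain\<close> links such squares along consecutive edges, remembering only the changes of basis at the two
  end vertices. Chains over the same edges can be multiplied and adjacent chains can be concatenated, so every stage of the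
  algorithm is a chain, and the recursion composes them: the two halves by induction hypothesis;
  the middle edge by its \<open>LQU\<close> or \<open>UQL\<close> factorization; the passage of the triangular factors through
  the halves (\<open>move_left\<close>, \<open>move_right\<close>); and the final passage of a permutation
  (\<open>sweep_right_correct\<close>, \<open>sweep_left_correct\<close>).

  The triangular factors can be passed because of the shapes. Read every pivot matrix as a partial
  injection \<open>h\<close> into the vertex that a factor \<open>T\<close> comes from. Both shapes of rightward form say that
  \<open>h\<close>, read from left to right, is increasing and that its image is an initial segment (\<open>ToLeft\<close>) or a final segment (\<open>ToRight\<close>);
  leftward form says the same about the converse injections. Pulling \<open>T\<close> back along \<open>h\<close> gives a
  triangular matrix because \<open>h\<close> is increasing, and this matrix does the job of \<open>T\<close> on the other side of the edge because the entries
  of \<open>T\<close> that could spoil this are indexed by one matched and one unmatched index and lie on the zero side of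
  the diagonal (\<open>pass_lower\<close>, \<open>pass_upper\<close>). Pulling back is functorial (\<open>reindex_reindex\<close>), so
  a factor is passed through many edges at the price of composing the injections and of reindexing it once.

  Running time. Dense linear algebra happens a bounded number of times per call, in time \<open>O(d\<^sup>3)\<close>; the
  remaining work per call, composing and sweeping injections of \<open>n\<close> edges, takes \<open>O(d n)\<close> time. The
  cost thus obeys \<open>T n \<le> T (n div 2) + T (n - 1 - n div 2) + O(d\<^sup>3 + d n)\<close>. There is one call of cost
  \<open>O(d\<^sup>3)\<close> per edge and one per leaf, and the terms \<open>d n\<close> add up to \<open>O(d n log n)\<close>
  (\<open>time_bound_divide\<close>). For \<open>d \<ge> 2\<close> the factor \<open>log d\<close> is at least 1, which gives the
  bound in the theorem. The numerical constants in the cost estimates are explicit but generous.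
\<close>

section \<open>Cost and result of elementary programs\<close>

lemma result_return [simp]: "result (return x) = x"
  and cost_return [simp]: "cost (return x) = 0"
  by (simp_all add: return_def)

lemma result_tick [simp]: "result (tick x) = x"
  and cost_tick [simp]: "cost (tick x) = 1"
  by (simp_all add: tick_def)

lemma result_bind [simp]: "result (bind_timed m f) = result (f (result m))"
  and cost_bind [simp]: "cost (bind_timed m f) = cost m + cost (f (result m))"
  by (simp_all add: bind_timed_def split: timed.split)

lemma result_if [simp]: "result (if b then x else y) = (if b then result x else result y)"
  and cost_if [simp]: "cost (if b then x else y) = (if b then cost x else cost y)"
  by simp_all

lemma result_map_t [simp]: "result (map_t f xs) = map (\<lambda>x. result (f x)) xs"
  by (induction xs) simp_all

lemma cost_map_t_le:
  "(\<And>x. x \<in> set xs \<Longrightarrow> cost (f x) \<le> c) \<Longrightarrow> cost (map_t f xs) \<le> (c + 1) * length xs + 1"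
proof (induction xs)
  case (Cons x xs)
  have "cost (f x) \<le> c" "cost (map_t f xs) \<le> (c + 1) * length xs + 1"
    using Cons by auto
  then show ?case by simp
qed simp

lemma result_filter_t [simp]: "result (filter_t p xs) = filter (\<lambda>x. result (p x)) xs"
  by (induction xs) simp_all

lemma cost_filter_t_le:
  "(\<And>x. x \<in> set xs \<Longrightarrow> cost (p x) \<le> c) \<Longrightarrow> cost (filter_t p xs) \<le> (c + 1) * length xs + 1"
proof (induction xs)
  case (Cons x xs)
  have "cost (p x) \<le> c" "cost (filter_t p xs) \<le> (c + 1) * length xs + 1"
    using Cons by auto
  then show ?case by simp
qed simp

lemma result_append_t [simp]: "result (append_t xs ys) = xs @ ys"
  and cost_append_t [simp]: "cost (append_t xs ys) = length xs + 1"
  by (induction xs) simp_all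

lemma result_find_t [simp]: "result (find_t p xs) = find (\<lambda>x. result (p x)) xs"
  by (induction xs) simp_all

lemma cost_find_t_le:
  "(\<And>x. x \<in> set xs \<Longrightarrow> cost (p x) \<le> c) \<Longrightarrow> cost (find_t p xs) \<le> (c + 1) * length xs + 1"
proof (induction xs)
  case (Cons x xs)
  have "cost (p x) \<le> c" "cost (find_t p xs) \<le> (c + 1) * length xs + 1"
    using Cons by auto
  then show ?case by simp
qed simp

lemma result_fold_t [simp]: "result (fold_t f xs s) = fold (\<lambda>x s. result (f x s)) xs s"
  by (induction xs arbitrary: s) simp_all

text \<open>
  Loops over an index range are analysed with an invariant \<open>P k\<close> that holds before round \<open>k\<close>; it may also be
  used to bound the cost of a round, for instance by controlling the dimensions in the state.
\<close>
lemma fold_t_upt: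
  assumes "P 0 s"
    and "\<And>k s. k < n \<Longrightarrow> P k s \<Longrightarrow> P (Suc k) (result (f k s))"
    and "\<And>k s. k < n \<Longrightarrow> P k s \<Longrightarrow> cost (f k s) \<le> c"
  shows "P n (result (fold_t f [0..<n] s))" "cost (fold_t f [0..<n] s) \<le> (c + 1) * n + 1"
proof -
  have snoc: "cost (fold_t f (xs @ [x]) s) = cost (fold_t f xs s) + cost (f x (result (fold_t f xs s))) + 1"
    for xs x s by (induction xs arbitrary: s) simp_all
  have "P n (result (fold_t f [0..<n] s)) \<and> cost (fold_t f [0..<n] s) \<le> (c + 1) * n + 1"
    using assms
  proof (induction n)
    case (Suc n)
    then have IH: "P n (result (fold_t f [0..<n] s))" "cost (fold_t f [0..<n] s) \<le> (c + 1) * n + 1"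
      by auto
    have "cost (f n (result (fold_t f [0..<n] s))) \<le> c"
      using Suc.prems(3) IH by simp
    with IH Suc.prems(2)[of n, OF _ IH(1)] show ?case
      by (simp add: snoc del: upt_Suc result_fold_t) (simp add: snoc)
  qed simp
  then show "P n (result (fold_t f [0..<n] s))" "cost (fold_t f [0..<n] s) \<le> (c + 1) * n + 1"
    by auto
qed

lemma fold_t_upt_cost:
  "(\<And>k s. k < n \<Longrightarrow> cost (f k s) \<le> c) \<Longrightarrow> cost (fold_t f [0..<n] s) \<le> (c + 1) * n + 1"
  by (rule fold_t_upt(2)[where P = "\<lambda>_ _. True"]) auto

lemma result_array_t [simp]: "result (array_t n f) = map (\<lambda>i. result (f i)) [0..<n]"
  by (simp add: array_t_def)

lemma cost_array_t_le:
  "(\<And>i. i < n \<Longrightarrow> cost (f i) \<le> c) \<Longrightarrow> cost (array_t n f) \<le> (c + 1) * n + 1"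
  using cost_map_t_le[of "[0..<n]" f c] by (simp add: array_t_def)

lemma result_mat_t [simp]: "result (mat_t nr nc f) = mat nr nc (\<lambda>(i, j). result (f i j))"
  by (auto simp: mat_t_def mat_of_rows_list_def)

lemma cost_mat_t_le:
  assumes "\<And>i j. i < nr \<Longrightarrow> j < nc \<Longrightarrow> cost (f i j) \<le> c"
    and "nr \<le> D" "nc \<le> D" "1 \<le> D"
  shows "cost (mat_t nr nc f) \<le> (c + 4) * D ^ 2"
proof -
  have "cost (array_t nc (f i)) \<le> (c + 1) * nc + 1" if "i < nr" for i
    using assms that by (intro cost_array_t_le) auto
  then have "cost (mat_t nr nc f) \<le> ((c + 1) * nc + 1 + 1) * nr + 1"
    unfolding mat_t_def by (simp only: cost_bind cost_return add_0_right) (rule cost_array_t_le)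
  also have "\<dots> \<le> ((c + 1) * D + 1 + 1) * D + 1"
    using assms by (intro add_mono mult_mono) auto
  also have "\<dots> = (c + 1) * D ^ 2 + 2 * D + 1"
    by (simp add: power2_eq_square algebra_simps)
  also have "\<dots> \<le> (c + 1) * D ^ 2 + 2 * D ^ 2 + D ^ 2"
    using assms by (intro add_mono) (auto simp: power2_eq_square)
  finally show ?thesis by (simp add: algebra_simps)
qed

lemma result_id_t [simp]: "result (id_t n) = 1\<^sub>m n"
  by (auto simp: id_t_def)

lemma cost_id_t_le: "n \<le> D \<Longrightarrow> 1 \<le> D \<Longrightarrow> cost (id_t n) \<le> 5 * D ^ 2"
  unfolding id_t_def by (rule order.trans[OF cost_mat_t_le[where c = 1 and D = D]]) auto

lemma result_mult_t:
  assumes "dim_col A = dim_row B"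
  shows "result (mult_t A B) = A * B"
proof -
  have "fold (\<lambda>k s. s + g k) [0..<n] 0 = (\<Sum>k<n. g k)" for g :: "nat \<Rightarrow> 'a" and n
    by (induction n) (simp_all add: lessThan_Suc add.commute)
  then show ?thesis
    using assms by (auto simp: mult_t_def scalar_prod_def atLeast0LessThan intro!: eq_matI)
qed

lemma cost_mult_t_le:
  assumes "dim_row A \<le> D" "dim_col A \<le> D" "dim_col B \<le> D" "1 \<le> D"
  shows "cost (mult_t A B) \<le> 10 * D ^ 3"
proof -
  have "cost (mult_t A B) \<le> (6 * D + 4) * D ^ 2"
    unfolding mult_t_def
  proof (rule cost_mat_t_le, goal_cases)
    case (1 i j)
    show ?case
      by (rule order.trans[OF fold_t_upt_cost[where c = 4]]) (use assms in auto)
  qed (use assms in auto)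
  also have "\<dots> \<le> (6 * D + 4 * D) * D ^ 2"
    using assms by (intro mult_right_mono) auto
  finally show ?thesis by (simp add: power3_eq_cube power2_eq_square algebra_simps)
qed

lemma result_flip_t:
  "result (flip_t A) = mat (dim_row A) (dim_col A)
     (\<lambda>(i, j). A $$ (dim_row A - Suc i, dim_col A - Suc j))"
  by (simp add: flip_t_def)

lemma cost_flip_t_le:
  "dim_row A \<le> D \<Longrightarrow> dim_col A \<le> D \<Longrightarrow> 1 \<le> D \<Longrightarrow> cost (flip_t A) \<le> 7 * D ^ 2"
  unfolding flip_t_def by (rule order.trans[OF cost_mat_t_le[where c = 3 and D = D]]) auto

section \<open>Matrix inversion\<close>

definition nonsingular :: "nat \<Rightarrow> 'a::field mat \<Rightarrow> bool" where
  "nonsingular n A \<longleftrightarrow> A \<in> carrier_mat n n \<and> det A \<noteq> 0"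

lemma nonsingular_mult: "nonsingular n A \<Longrightarrow> nonsingular n B \<Longrightarrow> nonsingular n (A * B)"
  by (auto simp: nonsingular_def det_mult)

lemma nonsingular_one: "nonsingular n (1\<^sub>m n)"
  by (simp add: nonsingular_def)

lemma nonsingularI:
  assumes "A \<in> carrier_mat n n" "B \<in> carrier_mat n n" "A * B = 1\<^sub>m n"
  shows "nonsingular n A"
  using assms det_mult[of A n B] by (auto simp: nonsingular_def)

text \<open>
  One Gauss-Jordan step with pivot position \<open>(i, j)\<close> of \<open>M\<close>, applied to \<open>X\<close>: swap the rows \<open>i\<close> and \<open>j\<close>, scale
  row \<open>j\<close> and clear column \<open>j\<close>. The row operations depend only on \<open>M\<close>, so the same step can be applied
  to the accompanying matrix.
\<close>
definition eliminate :: "nat \<Rightarrow> nat \<Rightarrow> nat \<Rightarrow> 'a::field mat \<Rightarrow> 'a mat \<Rightarrow> 'a mat" where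
  "eliminate n i j M X = mat n n (\<lambda>(r, c).
     if r = j then X $$ (i, c) / M $$ (i, j)
     else let r' = (if r = i then j else r) in
       X $$ (r', c) - M $$ (r', j) * (X $$ (i, c) / M $$ (i, j)))"

lemma eliminate_carrier [simp]:
  "eliminate n i j M X \<in> carrier_mat n n"
  "dim_row (eliminate n i j M X) = n" "dim_col (eliminate n i j M X) = n"
  by (simp_all add: eliminate_def)

lemma find_SomeD: "find p xs = Some x \<Longrightarrow> x \<in> set xs \<and> p x"
  by (induction xs) (auto split: if_splits)

lemma result_inverse_step:
  "result (inverse_step n j (M, B)) = (case find (\<lambda>i. M $$ (i, j) \<noteq> 0) [j..<n] of
     None \<Rightarrow> (M, B)
   | Some i \<Rightarrow> (eliminate n i j M M, eliminate n i j M B))"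
  by (auto simp: inverse_step_def eliminate_def Let_def split: option.split intro!: eq_matI)

lemma cost_inverse_step_le:
  assumes "n \<le> D" "1 \<le> D"
  shows "cost (inverse_step n j s) \<le> 35 * D ^ 2"
proof -
  obtain M B where s: "s = (M, B)" by fastforce
  have find: "cost (find_t (\<lambda>i. bind_timed (tick (M $$ (i, j))) (\<lambda>x. tick (x \<noteq> 0))) [j..<n]) \<le> 4 * D ^ 2"
  proof (rule order.trans[OF cost_find_t_le[where c = 2]])
    have "(2 + 1) * length [j..<n] + 1 \<le> 3 * D + D"
      using assms by simp
    also have "\<dots> \<le> 4 * D ^ 2"
      by (simp add: power2_eq_square)
    finally show "(2 + 1) * length [j..<n] + 1 \<le> 4 * D ^ 2" .
  qed simp
  have D2: "1 \<le> D ^ 2" using assms by simp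
  have mat: "cost (mat_t n n f) \<le> 12 * D ^ 2" if "\<And>r c. cost (f r c) \<le> 8" for f :: "nat \<Rightarrow> nat \<Rightarrow> 'a timed"
    using cost_mat_t_le[of n n f 8 D] that assms by simp
  show ?thesis
    unfolding s inverse_step_def prod.case cost_bind Let_def
    apply (split option.split)
    apply (intro conjI allI impI)
    subgoal using find by (simp add: s)
    subgoal for i
      unfolding cost_bind
      (* The summands are those of the program: search, pivot entry, the two new matrices, return. *)
      apply (rule order.trans[where b = "4 * D ^ 2 + (D ^ 2 + (12 * D ^ 2 + (12 * D ^ 2 + 0)))"])
      apply (intro add_mono find mat)
      using D2 by (auto)
    done
qed

text \<open>
  Row operations commute with multiplication from the right. Therefore \<open>B A = M\<close> is an invariant of the
  elimination, where \<open>B\<close> starts as the identity matrix and \<open>M\<close> as \<open>A\<close>.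
\<close>
lemma eliminate_mult:
  assumes "i < n" "j < n" "A \<in> carrier_mat n n" "B \<in> carrier_mat n n" "B * A = X"
  shows "eliminate n i j M B * A = eliminate n i j M X"
proof -
  have X: "X $$ (r, c) = (\<Sum>k = 0..<n. B $$ (r, k) * A $$ (k, c))" if "r < n" "c < n" for r c
    using assms(3,4) that unfolding assms(5)[symmetric] by (simp add: scalar_prod_def)
  have div: "(\<Sum>k = 0..<n. B $$ (i, k) / v * A $$ (k, c)) = X $$ (i, c) / v" if "c < n" for c v
    using X[of i c] that assms(1) by (simp add: sum_divide_distrib)
  show ?thesis
  proof (rule eq_matI)
    fix r c assume "r < dim_row (eliminate n i j M X)" "c < dim_col (eliminate n i j M X)"
    then have rc: "r < n" "c < n" by (simp_all add: eliminate_def)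
    define r' where "r' = (if r = i then j else r)"
    have "r' < n" using rc assms by (simp add: r'_def)
    have "(eliminate n i j M B * A) $$ (r, c) = (\<Sum>k = 0..<n. eliminate n i j M B $$ (r, k) * A $$ (k, c))"
      using rc assms(3) assms(4) by (simp add: scalar_prod_def)
    also have "\<dots> = eliminate n i j M X $$ (r, c)"
    proof (cases "r = j")
      case True
      then show ?thesis using rc div by (simp add: eliminate_def)
    next
      case False
      then have "(\<Sum>k = 0..<n. eliminate n i j M B $$ (r, k) * A $$ (k, c))
        = (\<Sum>k = 0..<n. B $$ (r', k) * A $$ (k, c)
            - M $$ (r', j) * (B $$ (i, k) / M $$ (i, j) * A $$ (k, c)))"
        using rc by (intro sum.cong) (auto simp: eliminate_def r'_def Let_def left_diff_distrib)
      also have "\<dots> = X $$ (r', c) - M $$ (r', j) * (X $$ (i, c) / M $$ (i, j))"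
        using div rc X \<open>r' < n\<close> by (simp only: sum_subtractf sum_distrib_left[symmetric])
      finally show ?thesis using False rc by (simp add: eliminate_def r'_def Let_def)
    qed
    finally show "(eliminate n i j M B * A) $$ (r, c) = eliminate n i j M X $$ (r, c)" .
  qed (use assms(3) in \<open>auto simp: eliminate_def\<close>)
qed

text \<open>
  Row operations are invertible, so they do not enlarge the kernel: the rows of the new product
  vanish only if all rows of the old one do.
\<close>
lemma eliminate_kernel:
  assumes "i < n" "j < n" "M $$ (i, j) \<noteq> 0" "M \<in> carrier_mat n n" "w \<in> carrier_vec n"
    and "eliminate n i j M M *\<^sub>v w = 0\<^sub>v n"
  shows "M *\<^sub>v w = 0\<^sub>v n"
proof -
  have Mw: "(M *\<^sub>v w) $ r = (\<Sum>k = 0..<n. M $$ (r, k) * w $ k)" if "r < n" for r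
    using assms that by (simp add: scalar_prod_def)
  have E: "(eliminate n i j M M *\<^sub>v w) $ r = (\<Sum>k = 0..<n. eliminate n i j M M $$ (r, k) * w $ k)"
    if "r < n" for r
    using that assms(5) by (simp add: scalar_prod_def)
  have "(eliminate n i j M M *\<^sub>v w) $ j = (M *\<^sub>v w) $ i / M $$ (i, j)"
    using assms(1,2) by (simp only: E[OF assms(2)] Mw[OF assms(1)] sum_divide_distrib)
      (intro sum.cong, auto simp: eliminate_def)
  then have i: "(M *\<^sub>v w) $ i = 0"
    using assms by simp
  have *: "(eliminate n i j M M *\<^sub>v w) $ r
      = (M *\<^sub>v w) $ r' - M $$ (r', j) * ((M *\<^sub>v w) $ i / M $$ (i, j))"
    if "r < n" "r \<noteq> j" and r': "r' = (if r = i then j else r)" for r r'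
  proof -
    have "r' < n" using assms that by auto
    have "(eliminate n i j M M *\<^sub>v w) $ r
        = (\<Sum>k = 0..<n. M $$ (r', k) * w $ k - M $$ (r', j) * (M $$ (i, k) * w $ k / M $$ (i, j)))"
      unfolding E[OF that(1)]
      using that by (intro sum.cong) (auto simp: eliminate_def r' Let_def left_diff_distrib)
    then show ?thesis
      using assms(1) \<open>r' < n\<close>
      by (simp only: Mw sum_subtractf sum_distrib_left[symmetric] sum_divide_distrib[symmetric])
  qed
  have j: "(M *\<^sub>v w) $ j = 0"
    using *[of i j] i assms by (cases "i = j") auto
  have "(M *\<^sub>v w) $ r = 0" if "r < n" for r
    using *[of r r] i j that assms by (cases "r = i"; cases "r = j") auto
  then show ?thesis
    using assms by (intro eq_vecI) auto
qed

text \<open>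
  If the first \<open>j\<close> columns are unit vectors and column \<open>j\<close> vanishes from row \<open>j\<close> on, then column \<open>j\<close> is a
  combination of the previous ones, which yields a nonzero vector in the kernel.
\<close>
lemma inverse_step_pivot_exists:
  assumes M: "M \<in> carrier_mat n n" and "j < n"
    and ker: "\<And>w. w \<in> carrier_vec n \<Longrightarrow> M *\<^sub>v w = 0\<^sub>v n \<Longrightarrow> w = 0\<^sub>v n"
    and cols: "\<And>r c. r < n \<Longrightarrow> c < j \<Longrightarrow> M $$ (r, c) = (if r = c then 1 else 0)"
  shows "\<exists>i. j \<le> i \<and> i < n \<and> M $$ (i, j) \<noteq> (0 :: 'a::field)"
proof (rule ccontr)
  assume "\<not> ?thesis"
  then have zero: "M $$ (i, j) = 0" if "j \<le> i" "i < n" for i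
    using that by auto
  \<comment> \<open>The unit vector \<open>j\<close> minus the combination of the first \<open>j\<close> unit vectors given by column \<open>j\<close>.\<close>
  define w where "w = vec n (\<lambda>c. if c < j then - M $$ (c, j) else if c = j then 1 else 0)"
  have "(M *\<^sub>v w) $ r = 0" if r: "r < n" for r
  proof -
    have "(M *\<^sub>v w) $ r = (\<Sum>c = 0..<n. M $$ (r, c) * (if c < j then - M $$ (c, j) else if c = j then 1 else 0))"
      using M r by (simp add: scalar_prod_def w_def)
    also have "\<dots> = (\<Sum>c = 0..<n. (if c = r \<and> r < j then - M $$ (r, j) else 0) + (if c = j then M $$ (r, j) else 0))"
      by (intro sum.cong) (auto simp: cols r)
    also have "\<dots> = (\<Sum>c = 0..<n. (if c = r then if r < j then - M $$ (r, j) else 0 else 0) + (if c = j then M $$ (r, j) else 0))"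
      by (intro sum.cong) auto
    also have "\<dots> = 0"
      using r \<open>j < n\<close> zero[of r] by (simp add: sum.distrib)
    finally show ?thesis .
  qed
  then have "M *\<^sub>v w = 0\<^sub>v n"
    using M by (intro eq_vecI) auto
  then have "w = 0\<^sub>v n"
    by (rule ker[rotated]) (simp add: w_def)
  then have "w $ j = 0" using \<open>j < n\<close> by simp
  then show False using \<open>j < n\<close> by (simp add: w_def)
qed

text \<open>
  The loop keeps \<open>B A = M\<close> and a trivial kernel of \<open>M\<close> while turning the columns of \<open>M\<close> into unit
  vectors one after the other; in the end \<open>M\<close> is the identity matrix.
\<close>
lemma inverse_t_left_inverse:
  assumes A: "nonsingular n (A :: 'a::field mat)"
  shows "result (inverse_t A) \<in> carrier_mat n n" "result (inverse_t A) * A = 1\<^sub>m n"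
proof -
  define P where "P = (\<lambda>j (M, B). M \<in> carrier_mat n n \<and> B \<in> carrier_mat n n \<and> B * A = M
    \<and> (\<forall>w \<in> carrier_vec n. M *\<^sub>v w = 0\<^sub>v n \<longrightarrow> w = 0\<^sub>v n)
    \<and> (\<forall>r < n. \<forall>c < j. M $$ (r, c) = (if r = c then 1 else 0)))"
  have [simp]: "dim_row A = n" and A': "A \<in> carrier_mat n n" "det A \<noteq> 0"
    using A by (auto simp: nonsingular_def)
  have "P n (result (fold_t (inverse_step n) [0..<n] (A, 1\<^sub>m n)))"
  proof (rule fold_t_upt(1)[where c = "35 * (n + 1) ^ 2"])
    show "P 0 (A, 1\<^sub>m n)"
      using A' det_0_iff_vec_prod_zero_field[OF A'(1)] unfolding P_def by auto
  next
    fix j s assume j: "j < n" and "P j s"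
    obtain M B where s: "s = (M, B)" by fastforce
    have P: "M \<in> carrier_mat n n" "B \<in> carrier_mat n n" "B * A = M"
      and kernel: "\<forall>w \<in> carrier_vec n. M *\<^sub>v w = 0\<^sub>v n \<longrightarrow> w = 0\<^sub>v n"
      and unit_columns: "\<forall>r < n. \<forall>c < j. M $$ (r, c) = (if r = c then 1 else 0)"
      using \<open>P j s\<close> unfolding P_def s prod.case by - (elim conjE, assumption)+
    have P4: "w = 0\<^sub>v n" if "w \<in> carrier_vec n" "M *\<^sub>v w = 0\<^sub>v n" for w
      by (rule kernel[rule_format, OF that])
    have P5: "M $$ (r, c) = (if r = c then 1 else 0)" if "r < n" "c < j" for r c
      by (rule unit_columns[rule_format, OF that])
    obtain i where find: "find (\<lambda>i. M $$ (i, j) \<noteq> 0) [j..<n] = Some i"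
    proof -
      obtain i where "j \<le> i \<and> i < n \<and> M $$ (i, j) \<noteq> 0"
        by (rule exE[OF inverse_step_pivot_exists[OF P(1) j P4 P5]])
      then have "find (\<lambda>i. M $$ (i, j) \<noteq> 0) [j..<n] \<noteq> None"
        by (auto simp: find_None_iff)
      then show ?thesis using that by blast
    qed
    from find_SomeD[OF this] have i: "j \<le> i" "i < n" "M $$ (i, j) \<noteq> 0"
      by auto
    have "eliminate n i j M M $$ (r, c) = (if r = c then 1 else 0)" if "r < n" "c < Suc j" for r c
      using that i j P5[of i c] P5[of j c] P5[of r c]
      by (cases "c = j") (auto simp: eliminate_def Let_def)
    moreover have "w = 0\<^sub>v n" if "w \<in> carrier_vec n" "eliminate n i j M M *\<^sub>v w = 0\<^sub>v n" for w
      by (rule P4[OF that(1) eliminate_kernel[OF i(2) j i(3) P(1) that]])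
    moreover note eliminate_mult[OF i(2) j A'(1) P(2,3)]
    ultimately show "P (Suc j) (result (inverse_step n j s))"
      unfolding s result_inverse_step find P_def by simp
  next
    fix j s show "cost (inverse_step n j s) \<le> 35 * (n + 1) ^ 2"
      by (rule cost_inverse_step_le) auto
  qed
  then obtain M B where MB: "result (fold_t (inverse_step n) [0..<n] (A, 1\<^sub>m n)) = (M, B)" "P n (M, B)"
    by (metis surj_pair)
  then have "M = 1\<^sub>m n" unfolding P_def by (intro eq_matI) auto
  moreover have "result (inverse_t A) = B"
    using MB(1) by (simp add: inverse_t_def)
  ultimately show "result (inverse_t A) \<in> carrier_mat n n" "result (inverse_t A) * A = 1\<^sub>m n"
    using MB(2) unfolding P_def by auto
qed

lemma inverse_t_right_inverse:
  assumes "nonsingular n A" shows "A * result (inverse_t A) = 1\<^sub>m n"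
  using mat_mult_left_right_inverse[OF _ _ inverse_t_left_inverse(2)[OF assms]]
    inverse_t_left_inverse(1)[OF assms] assms by (simp add: nonsingular_def)

lemma nonsingular_imp_invertible_mat:
  assumes "nonsingular n A" shows "invertible_mat A"
  using inverse_t_left_inverse[OF assms] inverse_t_right_inverse[OF assms] assms
  unfolding invertible_mat_def inverts_mat_def nonsingular_def
  by (intro conjI exI[of _ "result (inverse_t A)"]) auto

lemma cost_inverse_t_le:
  assumes "dim_row A \<le> D" "1 \<le> D"
  shows "cost (inverse_t A) \<le> 42 * D ^ 3"
proof -
  have pow: "1 \<le> D ^ 3" "D ^ 2 \<le> D ^ 3" "D \<le> D ^ 3" "D ^ 2 * D = D ^ 3"
    using assms self_le_power[of D 3] by (auto intro: power_increasing simp: eval_nat_numeral)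
  have "cost (fold_t (inverse_step (dim_row A)) [0..<dim_row A] s) \<le> (35 * D ^ 2 + 1) * dim_row A + 1" for s
    by (rule fold_t_upt_cost) (rule cost_inverse_step_le[OF assms])
  also have "(35 * D ^ 2 + 1) * dim_row A + 1 \<le> (35 * D ^ 2 + 1) * D + 1"
    using assms by (intro add_mono mult_mono) auto
  also have "\<dots> \<le> 37 * D ^ 3"
    using pow by (simp add: algebra_simps)
  finally have "cost (fold_t (inverse_step (dim_row A)) [0..<dim_row A] s) \<le> 37 * D ^ 3" for s .
  moreover have "cost (id_t (dim_row A) :: 'a mat timed) \<le> 5 * D ^ 3"
    using cost_id_t_le[of "dim_row A" D, where 'a = 'a] assms pow by simp
  ultimately have "cost (id_t (dim_row A) :: 'a mat timed)
      + cost (fold_t (inverse_step (dim_row A)) [0..<dim_row A] (A, 1\<^sub>m (dim_row A)))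
    \<le> 5 * D ^ 3 + 37 * D ^ 3"
    by (intro add_mono)
  then show ?thesis
    by (simp add: inverse_t_def split: prod.split)
qed

text \<open>
  The order is a parameter, so that facts about lower and upper triangular matrices can be proved at once.
\<close>
definition triangular :: "(nat \<Rightarrow> nat \<Rightarrow> bool) \<Rightarrow> nat \<Rightarrow> 'a::field mat \<Rightarrow> bool" where
  "triangular R n T \<longleftrightarrow> T \<in> carrier_mat n n \<and> (\<forall>i < n. T $$ (i, i) \<noteq> 0)
     \<and> (\<forall>i < n. \<forall>j < n. R i j \<longrightarrow> T $$ (i, j) = 0)"

abbreviation "lower \<equiv> triangular (<)"
abbreviation "upper \<equiv> triangular (>)"

lemma triangular_transpose: "triangular R n T \<Longrightarrow> triangular (\<lambda>i j. R j i) n T\<^sup>T"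
  by (auto simp: triangular_def)

lemma lower_nonsingular:
  assumes "lower n T" shows "nonsingular n T"
proof -
  have "det T = prod_list (diag_mat T)"
    using assms by (intro det_lower_triangular[where n = n]) (auto simp: triangular_def)
  moreover have "0 \<notin> set (diag_mat T)"
    using assms by (auto simp: triangular_def diag_mat_def)
  ultimately show ?thesis
    using assms by (simp add: nonsingular_def triangular_def prod_list_zero_iff)
qed

lemma upper_nonsingular:
  assumes "upper n T" shows "nonsingular n T"
  using lower_nonsingular[OF triangular_transpose[OF assms]] assms
  by (auto simp: nonsingular_def triangular_def det_transpose)

text \<open>
  Row \<open>i\<close> of \<open>T B = 1\<close> expresses \<open>T $$ (i, i) * B $$ (i, j)\<close> through the rows of \<open>B\<close> above row \<open>i\<close>. By
  induction on \<open>i\<close>, these have no entry in a column \<open>j \<ge> i\<close>.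
\<close>
lemma lower_inverse:
  assumes T: "lower n T" and B: "B \<in> carrier_mat n n" and inv: "T * B = 1\<^sub>m n"
  shows "lower n B"
proof -
  have carrier: "T \<in> carrier_mat n n" using T by (simp add: triangular_def)
  have TB: "(\<Sum>k = 0..<n. T $$ (i, k) * B $$ (k, j)) = (if i = j then 1 else 0)"
    if "i < n" "j < n" for i j
  proof -
    have "(T * B) $$ (i, j) = (\<Sum>k = 0..<n. T $$ (i, k) * B $$ (k, j))"
      using that carrier B by (simp add: scalar_prod_def)
    then show ?thesis using that by (simp add: inv)
  qed
  have sum: "(\<Sum>k = 0..<n. T $$ (i, k) * B $$ (k, j)) = T $$ (i, i) * B $$ (i, j)"
    if "i < n" "\<And>k. k < i \<Longrightarrow> B $$ (k, j) = 0" for i j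
  proof -
    have "(\<Sum>k = 0..<n. T $$ (i, k) * B $$ (k, j)) = (\<Sum>k = 0..<n. if k = i then T $$ (i, i) * B $$ (i, j) else 0)"
      using T that by (intro sum.cong) (auto simp: triangular_def not_less nat_neq_iff)
    then show ?thesis using that by simp
  qed
  have zero: "i < j \<longrightarrow> j < n \<longrightarrow> B $$ (i, j) = 0" for i j
  proof (induction i rule: less_induct)
    case (less i)
    then show ?case
      using sum[of i j] TB[of i j] T by (auto simp: triangular_def)
  qed
  have "B $$ (i, i) \<noteq> 0" if "i < n" for i
    using sum[of i i] TB[of i i] zero that by auto
  with zero B show ?thesis by (auto simp: triangular_def)
qed

lemma lower_inverse_t:
  assumes "lower n T" shows "lower n (result (inverse_t T))"
  using lower_inverse[OF assms] inverse_t_left_inverse(1) inverse_t_right_inverse lower_nonsingular assms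
  by blast

lemma upper_inverse_t:
  assumes "upper n T" shows "upper n (result (inverse_t T))"
proof -
  let ?B = "result (inverse_t T)"
  have B: "?B \<in> carrier_mat n n" "?B * T = 1\<^sub>m n"
    using inverse_t_left_inverse[OF upper_nonsingular[OF assms]] by auto
  have "T\<^sup>T * ?B\<^sup>T = (?B * T)\<^sup>T"
    using B assms by (intro transpose_mult[symmetric]) (auto simp: triangular_def)
  then have "lower n ?B\<^sup>T"
    using lower_inverse[OF triangular_transpose[OF assms]] B by simp
  from triangular_transpose[OF this] show ?thesis by simp
qed

section \<open>Partial injections and their matrices\<close>

definition matching :: "nat \<Rightarrow> nat \<Rightarrow> matching \<Rightarrow> bool" where
  "matching n m f \<longleftrightarrow> length f = n \<and> (\<forall>i < n. \<forall>j. f ! i = Some j \<longrightarrow> j < m)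
     \<and> (\<forall>i < n. \<forall>i' < n. \<forall>j. f ! i = Some j \<longrightarrow> f ! i' = Some j \<longrightarrow> i = i')"

lemma matching_less: "matching n m f \<Longrightarrow> i < n \<Longrightarrow> f ! i = Some j \<Longrightarrow> j < m"
  by (auto simp: matching_def)

lemma matching_inj:
  "matching n m f \<Longrightarrow> i < n \<Longrightarrow> i' < n \<Longrightarrow> f ! i = Some j \<Longrightarrow> f ! i' = Some j \<Longrightarrow> i = i'"
  by (auto simp: matching_def)

lemma matching_length: "matching n m f \<Longrightarrow> length f = n"
  by (simp add: matching_def)

definition matching_mat :: "nat \<Rightarrow> nat \<Rightarrow> matching \<Rightarrow> 'a::field mat" where
  "matching_mat n m f = mat n m (\<lambda>(i, j). if f ! i = Some j then 1 else 0)"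

lemma matching_mat_carrier [simp]:
  "matching_mat n m f \<in> carrier_mat n m"
  "dim_row (matching_mat n m f) = n" "dim_col (matching_mat n m f) = m"
  by (simp_all add: matching_mat_def)

lemma matching_mat_index [simp]:
  "i < n \<Longrightarrow> j < m \<Longrightarrow> matching_mat n m f $$ (i, j) = (if f ! i = Some j then 1 else 0)"
  by (simp add: matching_mat_def)

lemma matching_mat_mult:
  assumes "matching n m f" "X \<in> carrier_mat m k" "i < n" "c < k"
  shows "(matching_mat n m f * X) $$ (i, c) = (case f ! i of None \<Rightarrow> 0 | Some j \<Rightarrow> X $$ (j, c))"
proof -
  have "(matching_mat n m f * X) $$ (i, c) = (\<Sum>j = 0..<m. (if f ! i = Some j then 1 else 0) * X $$ (j, c))"
    using assms by (simp add: scalar_prod_def)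
  also have "\<dots> = (\<Sum>j = 0..<m. if f ! i = Some j then X $$ (j, c) else 0)"
    by (intro sum.cong) auto
  also have "\<dots> = (case f ! i of None \<Rightarrow> 0 | Some j \<Rightarrow> X $$ (j, c))"
    using assms by (auto simp: matching_def split: option.split)
  finally show ?thesis .
qed

lemma mult_matching_mat:
  assumes "matching n m f" "X \<in> carrier_mat k n" "r < k" "j < m"
  shows "f ! i = Some j \<Longrightarrow> i < n \<Longrightarrow> (X * matching_mat n m f) $$ (r, j) = X $$ (r, i)"
    and "(\<And>i. i < n \<Longrightarrow> f ! i \<noteq> Some j) \<Longrightarrow> (X * matching_mat n m f) $$ (r, j) = 0"
proof -
  have *: "(X * matching_mat n m f) $$ (r, j) = (\<Sum>i = 0..<n. X $$ (r, i) * (if f ! i = Some j then 1 else 0))"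
    using assms by (simp add: scalar_prod_def)
  show "(X * matching_mat n m f) $$ (r, j) = 0" if "\<And>i. i < n \<Longrightarrow> f ! i \<noteq> Some j"
    unfolding * using that by (intro sum.neutral) auto
  show "(X * matching_mat n m f) $$ (r, j) = X $$ (r, i)" if i: "f ! i = Some j" "i < n"
  proof -
    have "(\<Sum>i = 0..<n. X $$ (r, i) * (if f ! i = Some j then 1 else 0))
        = (\<Sum>i' = 0..<n. if i' = i then X $$ (r, i) else 0)"
      using i assms(1) unfolding matching_def by (intro sum.cong) auto
    then show ?thesis unfolding * using i by simp
  qed
qed

text \<open>
  After \<open>k\<close> rounds, the array is the converse of the restriction of \<open>f\<close> to indices below \<open>k\<close>.
\<close>
lemma converse_t_correct:
  assumes f: "matching n m f"
  defines "g \<equiv> result (converse_t m f)"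
  shows "\<And>i j. i < n \<Longrightarrow> j < m \<Longrightarrow> g ! j = Some i \<longleftrightarrow> f ! i = Some j"
    and "matching m n g"
    and "(matching_mat m n g :: 'a::field mat) = (matching_mat n m f)\<^sup>T"
    and "cost (converse_t m f) \<le> m + 3 * n + 2"
proof -
  define step where "step = (\<lambda>i g. bind_timed (tick (f ! i))
    (\<lambda>x. case x of None \<Rightarrow> return g | Some j \<Rightarrow> tick (g[j := Some i])))"
  define P where "P = (\<lambda>k g. length g = m \<and> (\<forall>i. \<forall>j < m. g ! j = Some i \<longleftrightarrow> i < k \<and> f ! i = Some j))"
  have len: "length f = n" using f by (simp add: matching_def)
  have g: "g = result (fold_t step [0..<n] (replicate m None))"
    by (simp add: g_def converse_t_def len step_def map_replicate_const)
  have init: "P 0 (replicate m None)" by (simp add: P_def)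
  have step: "P (Suc k) (result (step k g))" if "k < n" "P k g" for k g
    using that f by (auto simp: P_def step_def matching_def nth_list_update less_Suc_eq split: option.split)
  have cost: "cost (step k g) \<le> 2" for k g
    by (auto simp: step_def split: option.split)
  have Pg: "P n g"
    unfolding g by (rule fold_t_upt(1)[OF init step cost])
  then show iff: "g ! j = Some i \<longleftrightarrow> f ! i = Some j" if "i < n" "j < m" for i j
    using that by (simp add: P_def)
  show m: "matching m n g"
    using Pg by (auto simp: P_def matching_def)
  show "(matching_mat m n g :: 'a mat) = (matching_mat n m f)\<^sup>T"
    using iff by (intro eq_matI) auto
  have "cost (array_t m (\<lambda>j. return (None :: nat option))) \<le> (0 + 1) * m + 1"
    by (rule cost_array_t_le) simp
  moreover have "cost (fold_t step [0..<n] g0) \<le> (2 + 1) * n + 1" for g0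
    by (rule fold_t_upt_cost[OF cost])
  ultimately show "cost (converse_t m f) \<le> m + 3 * n + 2"
    unfolding converse_t_def cost_bind len step_def[symmetric]
    by (rule order.trans[OF add_mono]) simp
qed

lemma converse_t_converse_t:
  assumes f: "matching n m f"
  shows "result (converse_t n (result (converse_t m f))) = f"
proof -
  define g h where "g = result (converse_t m f)" and "h = result (converse_t n g)"
  have g: "matching m n g" and h: "matching n m h"
    unfolding h_def g_def using converse_t_correct(2) f by blast+
  have eq: "h ! i = Some j \<longleftrightarrow> f ! i = Some j" if "i < n" for i j
    using converse_t_correct(1)[OF f that, of j, folded g_def] converse_t_correct(1)[OF g _ that, of j, folded h_def]
      matching_less[OF f that] matching_less[OF h that] by blast
  have "h = f"
  proof (rule nth_equalityI)
    show "length h = length f" using matching_length[OF f] matching_length[OF h] by simp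
    show "h ! i = f ! i" if "i < length h" for i
      using eq[of i] that matching_length[OF h] by (cases "f ! i"; cases "h ! i") auto
  qed
  then show ?thesis by (simp add: h_def g_def)
qed

section \<open>The factorizations of a single edge\<close>

text \<open>
  Gaussian elimination without swaps at the pivot position \<open>(i, j)\<close>: a matrix of rank one is split off from \<open>M\<close>.
\<close>
definition lqu_update :: "nat \<Rightarrow> nat \<Rightarrow> 'a::field mat \<times> 'a mat \<times> 'a mat \<times> matching \<Rightarrow>
    'a mat \<times> 'a mat \<times> 'a mat \<times> matching" where
  "lqu_update i j = (\<lambda>(M, L, U, q).
    (mat (dim_row M) (dim_col M) (\<lambda>(r, c). M $$ (r, c) - M $$ (r, j) / M $$ (i, j) * M $$ (i, c)),
     mat (dim_row M) (dim_row M) (\<lambda>(r, c). if c = i then M $$ (r, j) / M $$ (i, j) else L $$ (r, c)),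
     mat (dim_col M) (dim_col M) (\<lambda>(r, c). if r = j then M $$ (i, c) else U $$ (r, c)),
     q[i := Some j]))"

lemma result_lqu_step:
  "result (lqu_step by_row k (M, L, U, q)) =
    (if by_row
     then case find (\<lambda>j. M $$ (k, j) \<noteq> 0) [0..<dim_col M] of
         None \<Rightarrow> (M, L, U, q) | Some j \<Rightarrow> lqu_update k j (M, L, U, q)
     else case find (\<lambda>i. M $$ (i, k) \<noteq> 0) [0..<dim_row M] of
         None \<Rightarrow> (M, L, U, q) | Some i \<Rightarrow> lqu_update i k (M, L, U, q))"
  by (auto simp: lqu_step_def lqu_update_def Let_def split: option.split intro!: eq_matI)

lemma cost_lqu_step_le:
  assumes "dim_row M \<le> D" "dim_col M \<le> D" "1 \<le> D"
  shows "cost (lqu_step by_row k (M, L, U, q)) \<le> 30 * D ^ 2"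
proof -
  have D: "1 \<le> D ^ 2" "D \<le> D ^ 2"
    using assms(3) self_le_power[of D 2] by auto
  have find: "cost (find_t p [0..<d]) \<le> 4 * D ^ 2" if "\<And>i. cost (p i) \<le> 2" "d \<le> D" for p d
  proof -
    have "cost (find_t p [0..<d]) \<le> 3 * d + 1"
      using cost_find_t_le[of "[0..<d]" p 2] that by simp
    then show ?thesis using that D by linarith
  qed
  have mat: "cost (mat_t nr nc f) \<le> (c + 4) * D ^ 2"
    if "\<And>r c'. cost (f r c') \<le> c" "nr \<le> D" "nc \<le> D" for f :: "nat \<Rightarrow> nat \<Rightarrow> 'a timed" and nr nc c
    using that assms by (intro cost_mat_t_le) auto
  define pivot where "pivot = (if by_row
       then bind_timed (find_t (\<lambda>j. bind_timed (tick (M $$ (k, j))) (\<lambda>x. tick (x \<noteq> 0))) [0..<dim_col M])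
         (\<lambda>c. return (case c of None \<Rightarrow> None | Some j \<Rightarrow> Some (k, j)))
       else bind_timed (find_t (\<lambda>i. bind_timed (tick (M $$ (i, k))) (\<lambda>x. tick (x \<noteq> 0))) [0..<dim_row M])
         (\<lambda>c. return (case c of None \<Rightarrow> None | Some i \<Rightarrow> Some (i, k))))"
  have pivot: "cost pivot \<le> 4 * D ^ 2"
    using assms by (auto simp: pivot_def intro!: find)
  show ?thesis
    unfolding lqu_step_def prod.case Let_def pivot_def[symmetric] cost_bind[of pivot]
    apply (split option.split)
    apply (intro conjI allI impI)
    subgoal using pivot by simp
    subgoal for ij
      apply (cases ij)
      unfolding cost_bind prod.case
      (* The summands are those of the program: search, pivot entry, the three new matrices, the array cell, return. *)
      apply (rule order.trans[where b = "4 * D ^ 2 + (D ^ 2 + ((3 + 4) * D ^ 2 + ((2 + 4) * D ^ 2 + ((6 + 4) * D ^ 2 + (D ^ 2 + 0)))))"])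
       apply (simp only: prod.case cost_bind)
       apply (intro add_mono pivot mat)
      using D assms by auto
    done
qed

text \<open>
  The matrix \<open>A\<close> is the sum of \<open>L Q U\<close>, written out for the partial injection \<open>q\<close>, and the remainder \<open>M\<close>.
  Rows and columns used by \<open>q\<close> have been cleared in \<open>M\<close> and hence are never used again.
\<close>
definition lqu_invariant :: "'a::field mat \<Rightarrow> 'a mat \<times> 'a mat \<times> 'a mat \<times> matching \<Rightarrow> bool" where
  "lqu_invariant A = (\<lambda>(M, L, U, q). let nr = dim_row A; nc = dim_col A in
     M \<in> carrier_mat nr nc \<and> lower nr L \<and> upper nc U \<and> matching nr nc q \<and>
     (\<forall>r < nr. \<forall>c < nc. A $$ (r, c) =
        (\<Sum>i < nr. L $$ (r, i) * (case q ! i of None \<Rightarrow> 0 | Some j \<Rightarrow> U $$ (j, c))) + M $$ (r, c)) \<and>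
     (\<forall>i < nr. \<forall>j < nc. q ! i = Some j \<longrightarrow>
        (\<forall>c < nc. M $$ (i, c) = 0) \<and> (\<forall>r < nr. M $$ (r, j) = 0)))"

text \<open>
  The pivot has to be the first entry both in its row and in its column: then column \<open>i\<close> of the new \<open>L\<close> starts on
  the diagonal, and so does row \<open>j\<close> of the new \<open>U\<close>. As row \<open>i\<close> and column \<open>j\<close> were unused so far, changing them
  affects no other term of the sum.
\<close>
lemma lqu_update_invariant:
  assumes inv: "lqu_invariant A (M, L, U, q)"
    and ij: "i < dim_row A" "j < dim_col A" "M $$ (i, j) \<noteq> 0"
    and left: "\<And>c. c < j \<Longrightarrow> M $$ (i, c) = 0" and above: "\<And>r. r < i \<Longrightarrow> M $$ (r, j) = 0"
  shows "lqu_invariant A (lqu_update i j (M, L, U, q))"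
proof -
  define nr nc where "nr = dim_row A" and "nc = dim_col A"
  have M: "M \<in> carrier_mat nr nc" and L: "lower nr L" and U: "upper nc U" and q: "matching nr nc q"
    and A: "\<And>r c. r < nr \<Longrightarrow> c < nc \<Longrightarrow> A $$ (r, c) =
        (\<Sum>i < nr. L $$ (r, i) * (case q ! i of None \<Rightarrow> 0 | Some j \<Rightarrow> U $$ (j, c))) + M $$ (r, c)"
    and row: "\<And>i j c. i < nr \<Longrightarrow> q ! i = Some j \<Longrightarrow> c < nc \<Longrightarrow> M $$ (i, c) = 0"
    and col: "\<And>i j r. i < nr \<Longrightarrow> q ! i = Some j \<Longrightarrow> r < nr \<Longrightarrow> M $$ (r, j) = 0"
    using inv by (auto simp: lqu_invariant_def Let_def nr_def nc_def matching_def)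
  have i: "i < nr" and j: "j < nc" using ij by (simp_all add: nr_def nc_def)
  have dims [simp]: "dim_row M = nr" "dim_col M = nc" "dim_row A = nr" "dim_col A = nc" "length q = nr"
    using M q by (simp_all add: nr_def nc_def matching_def)
  have qi: "q ! i = None"
    using row[OF i _ j] ij(3) by (cases "q ! i") auto
  have qj: "q ! i' \<noteq> Some j" if "i' < nr" for i'
    using col[OF that _ i] ij(3) by auto
  have range: "j' < nc" if "i' < nr" "q ! i' = Some j'" for i' j'
    using q that by (auto simp: matching_def)
  let ?M = "mat nr nc (\<lambda>(r, c). M $$ (r, c) - M $$ (r, j) / M $$ (i, j) * M $$ (i, c))"
  let ?L = "mat nr nr (\<lambda>(r, c). if c = i then M $$ (r, j) / M $$ (i, j) else L $$ (r, c))"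
  let ?U = "mat nc nc (\<lambda>(r, c). if r = j then M $$ (i, c) else U $$ (r, c))"
  have "A $$ (r, c) = (\<Sum>i' < nr. ?L $$ (r, i') * (case q[i := Some j] ! i' of None \<Rightarrow> 0 | Some j \<Rightarrow> ?U $$ (j, c)))
      + ?M $$ (r, c)" if rc: "r < nr" "c < nc" for r c
  proof -
    have "(\<Sum>i' < nr. ?L $$ (r, i') * (case q[i := Some j] ! i' of None \<Rightarrow> 0 | Some j \<Rightarrow> ?U $$ (j, c)))
      = (\<Sum>i' < nr. L $$ (r, i') * (case q ! i' of None \<Rightarrow> 0 | Some j \<Rightarrow> U $$ (j, c))
          + (if i' = i then M $$ (r, j) / M $$ (i, j) * M $$ (i, c) else 0))"
      using rc i j qi qj range
      by (intro sum.cong) (auto simp: nth_list_update split: option.split)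
    then show ?thesis
      using rc i A[OF rc] by (simp add: sum.distrib)
  qed
  moreover have "lower nr ?L"
    using L i ij(3) above by (auto simp: triangular_def)
  moreover have "upper nc ?U"
    using U j ij(3) left by (auto simp: triangular_def)
  moreover have "matching nr nc (q[i := Some j])"
    using q i j qj by (auto simp: matching_def nth_list_update)
  moreover have "?M $$ (i', c) = 0" if "i' < nr" "q[i := Some j] ! i' = Some j'" "c < nc" for i' j' c
    using that row[of i'] j ij(3) by (cases "i' = i") auto
  moreover have "?M $$ (r, j') = 0" if "i' < nr" "j' < nc" "q[i := Some j] ! i' = Some j'" "r < nr" for i' j' r
    using that col[of i' j'] i ij(3) by (cases "i' = i") auto
  ultimately show ?thesis
    unfolding lqu_invariant_def lqu_update_def prod.case Let_def dims by (intro conjI) auto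
qed

lemma find_upt_SomeD:
  assumes "find p [0..<n] = Some i"
  shows "i < n" "p i" "\<And>k. k < i \<Longrightarrow> \<not> p k"
  using assms by (auto simp: find_Some_iff)

text \<open>
  The lines, rows or columns, that a search in this direction has passed.
\<close>
definition cleared :: "bool \<Rightarrow> nat \<Rightarrow> 'a::field mat \<Rightarrow> bool" where
  "cleared by_row k M \<longleftrightarrow> (\<forall>r < dim_row M. \<forall>c < dim_col M.
     (if by_row then r else c) < k \<longrightarrow> M $$ (r, c) = 0)"

lemma cleared_lqu_update:
  assumes "cleared by_row k M" "i < dim_row M" "j < dim_col M" "M $$ (i, j) \<noteq> 0"
    and "k = (if by_row then i else j)"
  shows "cleared by_row (Suc k) (fst (lqu_update i j (M, L, U, q)))"
  using assms unfolding cleared_def lqu_update_def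
  by (cases by_row) (auto simp: less_Suc_eq)

text \<open>
  Of the two conditions on the pivot, one holds because the search takes the first
  entry of its line, and the other because all previous lines have been cleared.
\<close>
lemma lqu_step_invariant:
  assumes inv: "lqu_invariant A s" and cleared: "cleared by_row k (fst s)"
    and k: "k < (if by_row then dim_row A else dim_col A)"
  shows "lqu_invariant A (result (lqu_step by_row k s))
    \<and> cleared by_row (Suc k) (fst (result (lqu_step by_row k s)))"
proof -
  obtain M L U q where s: "s = (M, L, U, q)" by (metis prod_cases4)
  have dims: "dim_row M = dim_row A" "dim_col M = dim_col A"
    using inv by (auto simp: lqu_invariant_def Let_def s)
  have zero: "M $$ (r, c) = 0" if "r < dim_row A" "c < dim_col A" "(if by_row then r else c) < k" for r c
    using cleared that by (simp add: cleared_def s dims)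
  have pivot: ?thesis
    if res: "result (lqu_step by_row k s) = lqu_update i j (M, L, U, q)"
      and ij: "i < dim_row A" "j < dim_col A" "M $$ (i, j) \<noteq> 0" "k = (if by_row then i else j)"
        "\<And>c. c < j \<Longrightarrow> M $$ (i, c) = 0" "\<And>r. r < i \<Longrightarrow> M $$ (r, j) = 0" for i j
    unfolding res using lqu_update_invariant[OF inv[unfolded s] ij(1-3) ij(5,6)]
      cleared_lqu_update[OF _ _ _ ij(3,4)] cleared ij(1,2) by (simp add: dims s)
  have none: ?thesis
    if res: "result (lqu_step by_row k s) = (M, L, U, q)"
      and "\<And>r c. r < dim_row A \<Longrightarrow> c < dim_col A \<Longrightarrow> (if by_row then r else c) = k \<Longrightarrow> M $$ (r, c) = 0"
    using that(2) inv zero unfolding res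
    by (auto simp: s cleared_def dims less_Suc_eq split: if_splits)
  show ?thesis
  proof (cases by_row)
    case True
    show ?thesis
    proof (cases "find (\<lambda>j. M $$ (k, j) \<noteq> 0) [0..<dim_col M]")
      case None
      then have "M $$ (k, c) = 0" if "c < dim_col A" for c
        using that by (simp add: find_None_iff dims)
      with None show ?thesis
        using True by (intro none) (auto simp: s result_lqu_step)
    next
      case (Some j)
      from find_upt_SomeD[OF this] Some show ?thesis
        using True k zero by (intro pivot[of k j]) (auto simp: s result_lqu_step dims)
    qed
  next
    case False
    show ?thesis
    proof (cases "find (\<lambda>i. M $$ (i, k) \<noteq> 0) [0..<dim_row M]")
      case None
      then have "M $$ (r, k) = 0" if "r < dim_row A" for r
        using that by (simp add: find_None_iff dims)
      with None show ?thesis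
        using False by (intro none) (auto simp: s result_lqu_step)
    next
      case (Some i)
      from find_upt_SomeD[OF this] Some show ?thesis
        using False k zero by (intro pivot[of i k]) (auto simp: s result_lqu_step dims)
    qed
  qed
qed

lemma lqu_t_correct:
  fixes A :: "'a::field mat"
  assumes A: "A \<in> carrier_mat nr nc" and res: "result (lqu_t by_row A) = (L, q, U)"
    and D: "nr \<le> D" "nc \<le> D" "1 \<le> D"
  shows "lower nr L" "upper nc U" "matching nr nc q" "A = L * matching_mat nr nc q * U"
    and "cost (lqu_t by_row A) \<le> 45 * D ^ 3"
proof -
  define N where "N = (if by_row then nr else nc)"
  define P where "P = (\<lambda>k s. lqu_invariant A s \<and> cleared by_row k (fst s))"
  define s0 where "s0 = (A, 1\<^sub>m nr :: 'a mat, 1\<^sub>m nc :: 'a mat, replicate nr (None :: nat option))"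
  define run where "run = fold_t (lqu_step by_row) [0..<N] s0"
  have dims [simp]: "dim_row A = nr" "dim_col A = nc" using A by auto
  have init: "P 0 s0"
    by (auto simp: P_def s0_def lqu_invariant_def cleared_def triangular_def matching_def Let_def
        intro!: sum.neutral)
  have step: "P (Suc k) (result (lqu_step by_row k s))" if "k < N" "P k s" for k s
    using lqu_step_invariant[of A s by_row k] that by (auto simp: P_def N_def split: if_splits)
  have step_cost: "cost (lqu_step by_row k s) \<le> 30 * D ^ 2" if "k < N" "P k s" for k s
  proof -
    obtain M L U q where "s = (M, L, U, q)" by (metis prod_cases4)
    with that D show ?thesis
      by (auto simp: P_def lqu_invariant_def Let_def intro!: cost_lqu_step_le)
  qed
  have run: "P N (result run)"
    unfolding run_def by (rule fold_t_upt(1)[where P = P, OF init step step_cost])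
  have run_cost: "cost run \<le> (30 * D ^ 2 + 1) * N + 1"
    unfolding run_def by (rule fold_t_upt(2)[where P = P, OF init step step_cost])
  have lqu: "lqu_t by_row A = bind_timed (id_t nr) (\<lambda>L. bind_timed (id_t nc) (\<lambda>U.
    bind_timed (array_t nr (\<lambda>i. return None)) (\<lambda>q.
    bind_timed (fold_t (lqu_step by_row) [0..<N] (A, L, U, q))
      (\<lambda>(M, L', U', q'). return (L', q', U')))))"
    by (simp add: lqu_t_def N_def cong: if_cong)
  obtain M where M: "result run = (M, L, U, q)"
    using res by (auto simp: lqu run_def s0_def map_replicate_const split: prod.splits)
  have zero: "M $$ (r, c) = 0" if "r < nr" "c < nc" for r c
    using run that by (auto simp: P_def M cleared_def N_def lqu_invariant_def Let_def split: if_splits)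
  show L: "lower nr L" and U: "upper nc U" and q: "matching nr nc q"
    using run by (auto simp: P_def M lqu_invariant_def Let_def)
  have carrier: "L \<in> carrier_mat nr nr" "U \<in> carrier_mat nc nc"
    using L U by (auto simp: triangular_def)
  show "A = L * matching_mat nr nc q * U"
  proof (rule eq_matI)
    fix r c assume "r < dim_row (L * matching_mat nr nc q * U)" "c < dim_col (L * matching_mat nr nc q * U)"
    then have rc: "r < nr" "c < nc" using carrier by auto
    have "(L * matching_mat nr nc q * U) $$ (r, c) = (L * (matching_mat nr nc q * U)) $$ (r, c)"
      using assoc_mult_mat[OF carrier(1) matching_mat_carrier(1) carrier(2)] by simp
    also have "\<dots> = (\<Sum>i = 0..<nr. L $$ (r, i) * (matching_mat nr nc q * U) $$ (i, c))"
      using carrier rc by (simp add: scalar_prod_def)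
    also have "\<dots> = (\<Sum>i < nr. L $$ (r, i) * (case q ! i of None \<Rightarrow> 0 | Some j \<Rightarrow> U $$ (j, c)))"
      using matching_mat_mult[OF q carrier(2) _ rc(2)]
      by (intro sum.cong) (auto simp: atLeast0LessThan)
    also have "\<dots> = A $$ (r, c)"
      using run rc zero[OF rc] by (simp add: P_def M lqu_invariant_def Let_def)
    finally show "A $$ (r, c) = (L * matching_mat nr nc q * U) $$ (r, c)" ..
  qed (use carrier in auto)
  have D': "1 \<le> D ^ 3" "D ^ 2 \<le> D ^ 3" "D \<le> D ^ 3" "D ^ 2 * D = D ^ 3"
    using D self_le_power[of D 3] by (auto intro: power_increasing simp: eval_nat_numeral)
  have "cost (id_t nr :: 'a mat timed) \<le> 5 * D ^ 2" "cost (id_t nc :: 'a mat timed) \<le> 5 * D ^ 2"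
    using D by (auto intro: cost_id_t_le)
  moreover have "cost (array_t nr (\<lambda>i. return (None :: nat option))) \<le> (0 + 1) * nr + 1"
    by (rule cost_array_t_le) simp
  moreover have "(30 * D ^ 2 + 1) * N + 1 \<le> (30 * D ^ 2 + 1) * D + 1"
    using D by (intro add_mono mult_mono) (auto simp: N_def)
  then have "cost run \<le> 30 * D ^ 3 + D + 1"
    using run_cost D' by (simp add: algebra_simps)
  moreover have "cost (lqu_t by_row A) = cost (id_t nr :: 'a mat timed) + cost (id_t nc :: 'a mat timed)
      + cost (array_t nr (\<lambda>i. return (None :: nat option))) + cost run"
    by (simp add: lqu run_def s0_def map_replicate_const split: prod.split)
  ultimately show "cost (lqu_t by_row A) \<le> 45 * D ^ 3"
    using D'(1-3) D by simp
qed

definition edge_mat :: "direction \<Rightarrow> nat \<Rightarrow> nat \<Rightarrow> matching \<Rightarrow> 'a::field mat" where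
  "edge_mat e n m f = (case e of ToLeft \<Rightarrow> matching_mat n m f | ToRight \<Rightarrow> (matching_mat n m f)\<^sup>T)"

definition edge_carrier :: "direction \<Rightarrow> nat \<Rightarrow> nat \<Rightarrow> 'a::field mat set" where
  "edge_carrier e n m = (case e of ToLeft \<Rightarrow> carrier_mat n m | ToRight \<Rightarrow> carrier_mat m n)"

lemma edge_mat_carrier [simp]: "edge_mat e n m f \<in> edge_carrier e n m"
  by (simp add: edge_mat_def edge_carrier_def split: direction.split)

definition intertwines :: "direction \<Rightarrow> 'a::field mat \<Rightarrow> 'a mat \<Rightarrow> 'a mat \<Rightarrow> 'a mat \<Rightarrow> bool" where
  "intertwines e A G H B \<longleftrightarrow> (case e of ToLeft \<Rightarrow> A * H = G * B | ToRight \<Rightarrow> A * G = H * B)"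

text \<open>
  Conjugation with anti-diagonal permutation matrices. It is multiplicative and exchanges lower and
  upper triangular matrices, so it reduces the factorization \<open>UQL\<close> to \<open>LQU\<close>.
\<close>
definition flip :: "'a mat \<Rightarrow> 'a mat" where
  "flip A = mat (dim_row A) (dim_col A) (\<lambda>(i, j). A $$ (dim_row A - Suc i, dim_col A - Suc j))"

lemma flip_carrier [simp]: "A \<in> carrier_mat n m \<Longrightarrow> flip A \<in> carrier_mat n m"
  by (auto simp: flip_def)

lemma flip_flip [simp]: "flip (flip A) = A"
  by (intro eq_matI) (auto simp: flip_def)

lemma flip_mult:
  assumes "A \<in> carrier_mat n m" "B \<in> carrier_mat m k"
  shows "flip (A * B) = flip A * flip B"
proof (rule eq_matI)
  fix i j assume "i < dim_row (flip A * flip B)" "j < dim_col (flip A * flip B)"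
  then have ij: "i < n" "j < k" using assms by (simp_all add: flip_def)
  have dims: "dim_row A = n" "dim_col A = m" "dim_row B = m" "dim_col B = k" using assms by auto
  have "(\<Sum>l = 0..<m. A $$ (n - Suc i, l) * B $$ (l, k - Suc j))
      = (\<Sum>l = 0..<m. A $$ (n - Suc i, m - Suc l) * B $$ (m - Suc l, k - Suc j))"
    by (rule sum.reindex_bij_witness[where i = "\<lambda>l. m - Suc l" and j = "\<lambda>l. m - Suc l"]) auto
  then show "flip (A * B) $$ (i, j) = (flip A * flip B) $$ (i, j)"
    using ij by (simp add: flip_def scalar_prod_def dims)
qed (use assms in \<open>auto simp: flip_def\<close>)

lemma triangular_flip:
  "lower n T \<Longrightarrow> upper n (flip T)" "upper n T \<Longrightarrow> lower n (flip T)"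
  by (auto simp: triangular_def flip_def)

lemma flip_transpose: "flip A\<^sup>T = (flip A)\<^sup>T"
  by (intro eq_matI) (auto simp: flip_def)

lemma mult_mult_inverse:
  fixes L :: "'a::semiring_1 mat"
  assumes "L \<in> carrier_mat n n" "N \<in> carrier_mat n m" "U \<in> carrier_mat m m"
    "V \<in> carrier_mat m m" "U * V = 1\<^sub>m m"
  shows "L * N * U * V = L * N"
proof -
  have LN: "L * N \<in> carrier_mat n m" using assms by simp
  have "L * N * U * V = L * N * (U * V)" by (rule assoc_mult_mat[OF LN assms(3,4)])
  then show ?thesis unfolding assms(5) right_mult_one_mat[OF LN] .
qed

lemma factor_t_ToLeft_correct:
  fixes A :: "'a::field mat"
  assumes A: "A \<in> carrier_mat n m" and res: "result (factor_t fm ToLeft A) = (G, H, f)"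
    and D: "n \<le> D" "m \<le> D" "1 \<le> D"
  shows "lower n G" "upper m H" "matching n m f" "A * H = G * matching_mat n m f"
    and "cost (factor_t fm ToLeft A) \<le> 130 * D ^ 3"
proof -
  obtain L q U where LqU: "result (lqu_t (fm = Rightward) A) = (L, q, U)" by (metis prod_cases3)
  note lqu = lqu_t_correct[OF A LqU D]
  have U: "nonsingular m U" "U \<in> carrier_mat m m"
    using upper_nonsingular[OF lqu(2)] by (auto simp: nonsingular_def)
  have [simp]: "G = L" "H = result (inverse_t U)" "f = q"
    using res LqU by (auto simp: factor_t_def)
  show "lower n G" "matching n m f" using lqu by simp_all
  show "upper m H" using lqu upper_inverse_t by simp
  show "A * H = G * matching_mat n m f"
    unfolding \<open>G = L\<close> \<open>H = result (inverse_t U)\<close> \<open>f = q\<close>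
    by (subst lqu(4), rule mult_mult_inverse[OF _ matching_mat_carrier(1) U(2)])
      (use lqu(1) inverse_t_left_inverse(1)[OF U(1)] inverse_t_right_inverse[OF U(1)] in
        \<open>auto simp: triangular_def\<close>)
  have "cost (inverse_t U) \<le> 42 * D ^ 3"
    using U D by (intro cost_inverse_t_le) auto
  then show "cost (factor_t fm ToLeft A) \<le> 130 * D ^ 3"
    using lqu(5) by (simp add: factor_t_def LqU)
qed

lemma factor_t_ToRight_correct:
  fixes A :: "'a::field mat"
  assumes A: "A \<in> carrier_mat m n" and res: "result (factor_t fm ToRight A) = (G, H, f)"
    and D: "n \<le> D" "m \<le> D" "1 \<le> D"
  shows "lower n G" "upper m H" "matching n m f" "A * G = H * (matching_mat n m f)\<^sup>T"
    and "cost (factor_t fm ToRight A) \<le> 130 * D ^ 3"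
proof -
  have dims: "dim_row A = m" "dim_col A = n" using A by auto
  have flip: "result (flip_t X) = flip X" for X :: "'a mat"
    by (simp add: result_flip_t flip_def)
  have A': "flip A \<in> carrier_mat m n" using A by simp
  obtain L q U where LqU: "result (lqu_t (fm = Leftward) (flip A)) = (L, q, U)" by (metis prod_cases3)
  note lqu = lqu_t_correct[OF A' LqU D(2,1,3)]
  have carrier: "L \<in> carrier_mat m m" "U \<in> carrier_mat n n" "dim_row L = m" "dim_col L = m"
     "dim_row U = n" "dim_col U = n"
    using lqu by (auto simp: triangular_def)
  have U: "lower n (flip U)" "flip U \<in> carrier_mat n n"
    using triangular_flip(2)[OF lqu(2)] carrier by auto
  define q' where "q' = result (converse_t n q)"
  have q': "matching n m q'" "(matching_mat n m q' :: 'a mat) = (matching_mat m n q)\<^sup>T"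
    using converse_t_correct(2,3)[OF lqu(3)] by (simp_all add: q'_def)
  have G: "G = result (inverse_t (flip U))" and H: "H = flip L"
    and f: "f = map (\<lambda>c. map_option (\<lambda>r. m - Suc r) (q' ! (n - Suc c))) [0..<n]"
    using res by (auto simp: factor_t_def LqU flip dims q'_def split: option.split)
  show "lower n G"
    unfolding G by (rule lower_inverse_t[OF U(1)])
  show "upper m H"
    unfolding H by (rule triangular_flip(1)[OF lqu(1)])
  have f_iff: "f ! c = Some r \<longleftrightarrow> r < m \<and> q' ! (n - Suc c) = Some (m - Suc r)" if "c < n" for c r
  proof -
    have "f ! c = map_option (\<lambda>r. m - Suc r) (q' ! (n - Suc c))"
      using that by (simp add: f)
    moreover have "r' < m" if "q' ! (n - Suc c) = Some r'" for r'
      by (rule matching_less[OF q'(1) _ that]) (use \<open>c < n\<close> in simp)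
    ultimately show ?thesis by (cases "q' ! (n - Suc c)") auto
  qed
  show "matching n m f"
    unfolding matching_def
  proof (intro conjI allI impI)
    show "length f = n" by (simp add: f)
    show "j < m" if "i < n" "f ! i = Some j" for i j using that f_iff by simp
    fix i i' j assume *: "i < n" "i' < n" "f ! i = Some j" "f ! i' = Some j"
    have "n - Suc i = n - Suc i'"
      by (rule matching_inj[OF q'(1), where j = "m - Suc j"]) (use * f_iff in auto)
    then show "i = i'" using * by linarith
  qed
  have "matching_mat n m f = flip (matching_mat n m q' :: 'a mat)"
    using f_iff by (intro eq_matI) (auto simp: flip_def)
  then have N: "flip (matching_mat m n q :: 'a mat) = (matching_mat n m f)\<^sup>T"
    by (simp add: q'(2) flip_transpose)
  have "A = flip (L * matching_mat m n q * U)"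
    unfolding lqu(4)[symmetric] by simp
  also have "\<dots> = flip L * flip (matching_mat m n q) * flip U"
    using carrier flip_mult[of "L * matching_mat m n q" m n U n] flip_mult[of L m m "matching_mat m n q" n]
    by simp
  finally have A_eq: "A = flip L * (matching_mat n m f)\<^sup>T * flip U"
    by (simp add: N)
  have "flip U * G = 1\<^sub>m n" "G \<in> carrier_mat n n"
    unfolding G using inverse_t_right_inverse[OF lower_nonsingular[OF U(1)]]
      inverse_t_left_inverse(1)[OF lower_nonsingular[OF U(1)]] by auto
  then show "A * G = H * (matching_mat n m f)\<^sup>T"
    unfolding H by (subst A_eq, intro mult_mult_inverse) (use carrier U in auto)
  have D': "D ^ 2 \<le> D ^ 3" "D \<le> D ^ 3" "1 \<le> D ^ 3"
    using D self_le_power[of D 3] by (auto intro: power_increasing)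
  have "cost (flip_t A) \<le> 7 * D ^ 2" "cost (flip_t L) \<le> 7 * D ^ 2" "cost (flip_t U) \<le> 7 * D ^ 2"
    using D by (auto intro!: cost_flip_t_le simp: dims carrier)
  moreover have "cost (inverse_t (flip U)) \<le> 42 * D ^ 3"
    using U D by (intro cost_inverse_t_le) auto
  moreover have "cost (converse_t n q) \<le> n + 3 * m + 2"
    by (rule converse_t_correct(4)[OF lqu(3)])
  moreover define a where "a = array_t n (\<lambda>c. bind_timed (tick (n - Suc c)) (\<lambda>c'. bind_timed (tick (q' ! c'))
      (\<lambda>x. case x of None \<Rightarrow> return None
          | Some r \<Rightarrow> bind_timed (tick (m - Suc r)) (\<lambda>r'. return (Some r')))))"
  have "cost a \<le> (3 + 1) * n + 1"
    unfolding a_def by (rule cost_array_t_le) (auto split: option.split)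
  moreover have "cost (factor_t fm ToRight A) = cost (flip_t A) + cost (lqu_t (fm = Leftward) (flip A))
      + cost (flip_t L) + cost (flip_t U) + cost (inverse_t (flip U)) + cost (converse_t n q) + cost a"
    by (simp add: factor_t_def flip LqU dims a_def q'_def)
  ultimately show "cost (factor_t fm ToRight A) \<le> 130 * D ^ 3"
    using lqu(5) D D' by simp
qed

lemma factor_t_correct:
  assumes "A \<in> edge_carrier e n m" and "result (factor_t fm e A) = (G, H, f)"
    and "n \<le> D" "m \<le> D" "1 \<le> D"
  shows "lower n G" "upper m H" "matching n m f" "intertwines e A G H (edge_mat e n m f)"
    and "cost (factor_t fm e A) \<le> 130 * D ^ 3"
  using factor_t_ToLeft_correct[of A n m fm G H f D] factor_t_ToRight_correct[of A m n fm G H f D] assms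
  by (cases e; simp add: edge_carrier_def intertwines_def edge_mat_def)+

section \<open>Passing triangular factors through a shaped edge\<close>

text \<open>
  The shapes, for an injection \<open>h\<close> read towards the vertex of dimension \<open>d\<close> at which it is put in order: \<open>h\<close>
  is increasing, and the indices that it misses come last if the edge is \<open>ToLeft\<close> and first if it is \<open>ToRight\<close>.
\<close>
definition aligned :: "direction \<Rightarrow> nat \<Rightarrow> matching \<Rightarrow> bool" where
  "aligned e d h \<longleftrightarrow>
     (\<forall>a < length h. \<forall>b < length h. \<forall>i j. a < b \<longrightarrow> h ! a = Some i \<longrightarrow> h ! b = Some j \<longrightarrow> i < j) \<and>
     (\<forall>a < length h. \<forall>i. h ! a = Some i \<longrightarrow>
        (\<forall>x < d. (\<forall>b < length h. h ! b \<noteq> Some x) \<longrightarrow> (case e of ToLeft \<Rightarrow> i < x | ToRight \<Rightarrow> x < i)))"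

text \<open>
  The matrix that \<open>T\<close> commutes to when it is passed through the edge with injection \<open>h\<close>; it agrees with the
  identity matrix outside the domain of \<open>h\<close>.
\<close>
definition reindex :: "nat \<Rightarrow> matching \<Rightarrow> 'a::field mat \<Rightarrow> 'a mat" where
  "reindex n h T = mat n n (\<lambda>(r, c). case h ! r of
     None \<Rightarrow> (if r = c then 1 else 0)
   | Some i \<Rightarrow> (case h ! c of None \<Rightarrow> (if r = c then 1 else 0) | Some j \<Rightarrow> T $$ (i, j)))"

lemma reindex_carrier [simp]:
  "reindex n h T \<in> carrier_mat n n" "dim_row (reindex n h T) = n" "dim_col (reindex n h T) = n"
  by (simp_all add: reindex_def)

lemma result_reindex_t [simp]: "result (reindex_t n h T) = reindex n h T"
  by (auto simp: reindex_t_def reindex_def split: option.split intro!: eq_matI)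

lemma cost_reindex_t_le: "n \<le> D \<Longrightarrow> 1 \<le> D \<Longrightarrow> cost (reindex_t n h T) \<le> 7 * D ^ 2"
  unfolding reindex_t_def
  by (rule order.trans[OF cost_mat_t_le[where c = 3 and D = D]]) (auto split: option.split)

lemma reindex_Some:
  "T \<in> carrier_mat n n \<Longrightarrow> reindex n (map Some [0..<n]) T = T"
  by (intro eq_matI) (auto simp: reindex_def)

lemma reindex_triangular:
  assumes h: "matching n m h" and T: "triangular R m T" and "irreflp R"
    and mono: "\<And>r c i j. r < n \<Longrightarrow> c < n \<Longrightarrow> R r c \<Longrightarrow> h ! r = Some i \<Longrightarrow> h ! c = Some j \<Longrightarrow> R i j"
  shows "triangular R n (reindex n h T)"
  unfolding triangular_def
proof (intro conjI allI impI)
  show "reindex n h T $$ (i, i) \<noteq> 0" if "i < n" for i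
    using T that matching_less[OF h that] by (auto simp: reindex_def triangular_def split: option.split)
  show "reindex n h T $$ (i, j) = 0" if "i < n" "j < n" "R i j" for i j
    using T that matching_less[OF h that(1)] matching_less[OF h that(2)] mono[OF that] \<open>irreflp R\<close>
    by (auto simp: reindex_def triangular_def irreflp_def split: option.split)
qed simp

lemma reindex_transpose: "reindex n h T\<^sup>T = (reindex n h T)\<^sup>T" if "matching n m h" "T \<in> carrier_mat m m"
  using matching_less[OF that(1)] that(2)
  by (intro eq_matI) (auto simp: reindex_def split: option.split)

text \<open>
  Both sides contain the same entries of \<open>T\<close> in the columns that \<open>h\<close> hits. In a column \<open>x\<close> that \<open>h\<close> misses,
  the right-hand side vanishes, while the left-hand side consists of entries \<open>T $$ (i, x)\<close> with \<open>i\<close> hit.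
\<close>
lemma matching_mat_commute:
  assumes h: "matching n m h" and T: "T \<in> carrier_mat m m"
    and zero: "\<And>a i x. a < n \<Longrightarrow> h ! a = Some i \<Longrightarrow> x < m \<Longrightarrow> (\<And>b. b < n \<Longrightarrow> h ! b \<noteq> Some x) \<Longrightarrow> T $$ (i, x) = 0"
  shows "matching_mat n m h * T = reindex n h T * matching_mat n m h"
proof (rule eq_matI)
  fix r c assume "r < dim_row (reindex n h T * matching_mat n m h)" "c < dim_col (reindex n h T * matching_mat n m h)"
  then have rc: "r < n" "c < m" by auto
  show "(matching_mat n m h * T) $$ (r, c) = (reindex n h T * matching_mat n m h) $$ (r, c)"
  proof (cases "\<exists>s < n. h ! s = Some c")
    case True
    then obtain s where s: "s < n" "h ! s = Some c" by blast
    have "(reindex n h T * matching_mat n m h) $$ (r, c) = reindex n h T $$ (r, s)"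
      by (rule mult_matching_mat(1)[OF h reindex_carrier(1) rc s(2,1)])
    then show ?thesis
      using s rc by (auto simp: matching_mat_mult[OF h T rc] reindex_def split: option.split)
  next
    case False
    then have "(reindex n h T * matching_mat n m h) $$ (r, c) = 0"
      by (intro mult_matching_mat(2)[OF h reindex_carrier(1) rc]) auto
    then show ?thesis
      using False zero[OF rc(1) _ rc(2)] by (auto simp: matching_mat_mult[OF h T rc] split: option.split)
  qed
qed (use T in auto)

lemma matching_mat_commute_transpose:
  assumes h: "matching n m h" and T: "T \<in> carrier_mat m m"
    and zero: "\<And>a i x. a < n \<Longrightarrow> h ! a = Some i \<Longrightarrow> x < m \<Longrightarrow> (\<And>b. b < n \<Longrightarrow> h ! b \<noteq> Some x) \<Longrightarrow> T $$ (x, i) = 0"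
  shows "T * (matching_mat n m h)\<^sup>T = (matching_mat n m h)\<^sup>T * reindex n h T"
proof -
  have "matching_mat n m h * T\<^sup>T = reindex n h T\<^sup>T * matching_mat n m h"
    using T zero matching_less[OF h] by (intro matching_mat_commute[OF h]) auto
  then have "(matching_mat n m h * T\<^sup>T)\<^sup>T = (reindex n h T\<^sup>T * matching_mat n m h)\<^sup>T"
    by simp
  moreover have "(matching_mat n m h * T\<^sup>T)\<^sup>T = T\<^sup>T\<^sup>T * (matching_mat n m h)\<^sup>T"
    by (rule transpose_mult) (use T in auto)
  moreover have "(reindex n h T\<^sup>T * matching_mat n m h)\<^sup>T = (matching_mat n m h)\<^sup>T * (reindex n h T\<^sup>T)\<^sup>T"
    by (rule transpose_mult) auto
  ultimately show ?thesis by (simp add: reindex_transpose[OF h T])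
qed

lemma aligned_less:
  "aligned e d h \<Longrightarrow> a < b \<Longrightarrow> b < length h \<Longrightarrow> h ! a = Some i \<Longrightarrow> h ! b = Some j \<Longrightarrow> i < j"
  unfolding aligned_def by (elim conjE allE[of _ a]) auto

lemma aligned_unmatched:
  assumes "aligned e d h" "a < length h" "h ! a = Some i" "x < d" "\<And>b. b < length h \<Longrightarrow> h ! b \<noteq> Some x"
  shows "case e of ToLeft \<Rightarrow> i < x | ToRight \<Rightarrow> x < i"
  by (rule assms(1)[unfolded aligned_def, THEN conjunct2, rule_format, OF assms(2-5)])

text \<open>
  If \<open>i\<close> is hit and \<open>x\<close> is missed, then \<open>i < x\<close> on a \<open>ToLeft\<close> edge and \<open>x < i\<close> on a \<open>ToRight\<close> edge. The entry of
  \<open>T\<close> at \<open>(i, x)\<close> or \<open>(x, i)\<close>, respectively, has to vanish and lies above the diagonal.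
\<close>
lemma pass_lower:
  assumes f: "matching n m f" and al: "aligned e m f" and T: "lower m T"
  shows "lower n (reindex n f T)"
    and "intertwines e (edge_mat e n m f) (reindex n f T) T (edge_mat e n m f)"
proof -
  have len: "length f = n" by (rule matching_length[OF f])
  have carrier: "T \<in> carrier_mat m m" using T by (simp add: triangular_def)
  show "lower n (reindex n f T)"
  proof (rule reindex_triangular[OF f T])
    show "i < j" if "r < n" "c < n" "r < c" "f ! r = Some i" "f ! c = Some j" for r c i j
      using aligned_less[OF al that(3) _ that(4,5)] that(2) len by simp
  qed (simp add: irreflp_def)
  note unmatched = aligned_unmatched[OF al, unfolded len]
  show "intertwines e (edge_mat e n m f) (reindex n f T) T (edge_mat e n m f)"
  proof (cases e)
    case ToLeft
    have "matching_mat n m f * T = reindex n f T * matching_mat n m f"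
    proof (rule matching_mat_commute[OF f carrier])
      fix a i x assume *: "a < n" "f ! a = Some i" "x < m" "\<And>b. b < n \<Longrightarrow> f ! b \<noteq> Some x"
      from unmatched[OF *] show "T $$ (i, x) = 0"
        using T ToLeft * matching_less[OF f] by (simp add: triangular_def)
    qed
    then show ?thesis using ToLeft by (simp add: intertwines_def edge_mat_def)
  next
    case ToRight
    have "T * (matching_mat n m f)\<^sup>T = (matching_mat n m f)\<^sup>T * reindex n f T"
    proof (rule matching_mat_commute_transpose[OF f carrier])
      fix a i x assume *: "a < n" "f ! a = Some i" "x < m" "\<And>b. b < n \<Longrightarrow> f ! b \<noteq> Some x"
      from unmatched[OF *] show "T $$ (x, i) = 0"
        using T ToRight * matching_less[OF f] by (simp add: triangular_def)
    qed
    then show ?thesis using ToRight by (simp add: intertwines_def edge_mat_def)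
  qed
qed

text \<open>
  The mirror image of the previous lemma: the edge is read from right to left, which transposes its
  matrix, so that the relevant entry of \<open>T\<close> now lies below the diagonal.
\<close>
lemma pass_upper:
  assumes f: "matching n m f" and al: "aligned e n (result (converse_t m f))" and T: "upper n T"
  defines "g \<equiv> result (converse_t m f)"
  shows "upper m (reindex m g T)"
    and "intertwines e (edge_mat e n m f) T (reindex m g T) (edge_mat e n m f)"
proof -
  have g: "matching m n g" and g_mat: "(matching_mat m n g :: 'a mat) = (matching_mat n m f)\<^sup>T"
    using converse_t_correct(2,3)[OF f] by (simp_all add: g_def)
  have f_mat: "(matching_mat n m f :: 'a mat) = (matching_mat m n g)\<^sup>T"
    by (simp add: g_mat)
  have al: "aligned e n g" using al by (simp add: g_def)
  have len: "length g = m" by (rule matching_length[OF g])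
  have carrier: "T \<in> carrier_mat n n" using T by (simp add: triangular_def)
  show "upper m (reindex m g T)"
  proof (rule reindex_triangular[OF g T])
    show "i > j" if "r < m" "c < m" "r > c" "g ! r = Some i" "g ! c = Some j" for r c i j
      using aligned_less[OF al that(3) _ that(5,4)] that(1) len by simp
  qed (simp add: irreflp_def)
  note unmatched = aligned_unmatched[OF al, unfolded len]
  show "intertwines e (edge_mat e n m f) T (reindex m g T) (edge_mat e n m f)"
  proof (cases e)
    case ToLeft
    have "T * (matching_mat m n g)\<^sup>T = (matching_mat m n g)\<^sup>T * reindex m g T"
    proof (rule matching_mat_commute_transpose[OF g carrier])
      fix a i x assume *: "a < m" "g ! a = Some i" "x < n" "\<And>b. b < m \<Longrightarrow> g ! b \<noteq> Some x"
      from unmatched[OF *] show "T $$ (x, i) = 0"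
        using T ToLeft * matching_less[OF g] by (simp add: triangular_def)
    qed
    then show ?thesis using ToLeft by (simp add: intertwines_def edge_mat_def f_mat)
  next
    case ToRight
    have "matching_mat m n g * T = reindex m g T * matching_mat m n g"
    proof (rule matching_mat_commute[OF g carrier])
      fix a i x assume *: "a < m" "g ! a = Some i" "x < n" "\<And>b. b < m \<Longrightarrow> g ! b \<noteq> Some x"
      from unmatched[OF *] show "T $$ (i, x) = 0"
        using T ToRight * matching_less[OF g] by (simp add: triangular_def)
    qed
    then show ?thesis using ToRight by (simp add: intertwines_def edge_mat_def g_mat)
  qed
qed

section \<open>Isomorphisms along a sequence of edges\<close>

lemma intertwines_mult:
  fixes A :: "'a::field mat"
  assumes "A \<in> edge_carrier e n m" "B \<in> edge_carrier e n m" "C \<in> edge_carrier e n m"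
    and "G \<in> carrier_mat n n" "G' \<in> carrier_mat n n" "H \<in> carrier_mat m m" "H' \<in> carrier_mat m m"
    and "intertwines e A G H B" "intertwines e B G' H' C"
  shows "intertwines e A (G * G') (H * H') C"
proof -
  have square: "A * (H * H') = (G * G') * C"
    if "A \<in> carrier_mat n m" "B \<in> carrier_mat n m" "C \<in> carrier_mat n m"
      "G \<in> carrier_mat n n" "G' \<in> carrier_mat n n" "H \<in> carrier_mat m m" "H' \<in> carrier_mat m m"
      "A * H = G * B" "B * H' = G' * C" for n m :: nat and A B C G G' H H' :: "'a mat"
  proof -
    have "A * (H * H') = A * H * H'" using that by (intro assoc_mult_mat[symmetric])
    also have "\<dots> = G * (B * H')" unfolding that(8) using that by (intro assoc_mult_mat)
    also have "\<dots> = (G * G') * C" unfolding that(9) using that by (intro assoc_mult_mat[symmetric])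
    finally show ?thesis .
  qed
  show ?thesis
    using assms square[of A n m B C G G' H H'] square[of A m n B C H H' G G']
    by (cases e) (simp_all add: edge_carrier_def intertwines_def del: assoc_mult_mat)
qed

text \<open>
  Isomorphism of the representations \<open>As\<close> and \<open>Bs\<close> on the edges from \<open>k\<close> on, with prescribed changes of basis
  \<open>X\<close> and \<open>Y\<close> at the two end vertices. Fixing these is what makes chains composable.
\<close>
fun chain :: "nat list \<Rightarrow> direction list \<Rightarrow> nat \<Rightarrow> 'a::field mat list \<Rightarrow> 'a mat list \<Rightarrow> 'a mat \<Rightarrow> 'a mat \<Rightarrow> bool" where
  "chain ds es k [] [] X Y \<longleftrightarrow> X = Y \<and> nonsingular (ds ! k) X"
| "chain ds es k (A # As) (B # Bs) X Y \<longleftrightarrow> nonsingular (ds ! k) X \<and>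
     A \<in> edge_carrier (es ! k) (ds ! k) (ds ! Suc k) \<and> B \<in> edge_carrier (es ! k) (ds ! k) (ds ! Suc k) \<and>
     (\<exists>Z. intertwines (es ! k) A X Z B \<and> chain ds es (Suc k) As Bs Z Y)"
| "chain ds es k _ _ X Y \<longleftrightarrow> False"

lemma chain_length: "chain ds es k As Bs X Y \<Longrightarrow> length As = length Bs"
  by (induction ds es k As Bs X Y rule: chain.induct) auto

lemma chain_left: "chain ds es k As Bs X Y \<Longrightarrow> nonsingular (ds ! k) X"
  by (cases "(ds, es, k, As, Bs, X, Y)" rule: chain.cases) auto

lemma chain_right: "chain ds es k As Bs X Y \<Longrightarrow> nonsingular (ds ! (k + length As)) Y"
  by (induction ds es k As Bs X Y rule: chain.induct) auto

lemma chain_append: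
  "chain ds es k As Bs X Z \<Longrightarrow> chain ds es (k + length As) As' Bs' Z Y
    \<Longrightarrow> chain ds es k (As @ As') (Bs @ Bs') X Y"
  by (induction ds es k As Bs X Z rule: chain.induct) auto

lemma chain_mult:
  "chain ds es k As Bs X Y \<Longrightarrow> chain ds es k Bs Cs T S \<Longrightarrow> chain ds es k As Cs (X * T) (Y * S)"
proof (induction As arbitrary: k Bs Cs X T)
  case Nil
  moreover from this have "Bs = []" using chain_length by fastforce
  moreover from calculation have "Cs = []" using chain_length by fastforce
  ultimately
  show ?case by (auto intro: nonsingular_mult)
next
  case (Cons A As)
  obtain B Bs' where Bs: "Bs = B # Bs'" using Cons.prems(1) by (cases Bs) auto
  obtain C Cs' where Cs: "Cs = C # Cs'" using Cons.prems(2) Bs by (cases Cs) auto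
  obtain Z where Z: "intertwines (es ! k) A X Z B" "chain ds es (Suc k) As Bs' Z Y"
    using Cons.prems(1) Bs by auto
  obtain W where W: "intertwines (es ! k) B T W C" "chain ds es (Suc k) Bs' Cs' W S"
    using Cons.prems(2) Bs Cs by auto
  have ns: "nonsingular (ds ! k) X" "nonsingular (ds ! k) T" "nonsingular (ds ! Suc k) Z" "nonsingular (ds ! Suc k) W"
    using chain_left Cons.prems Z(2) W(2) by blast+
  have "intertwines (es ! k) A (X * T) (Z * W) C"
    by (rule intertwines_mult[OF _ _ _ _ _ _ _ Z(1) W(1), where n = "ds ! k" and m = "ds ! Suc k"])
      (use ns Cons.prems Bs Cs in \<open>auto simp: nonsingular_def\<close>)
  then show ?case
    using Cons.IH[OF Z(2) W(2)] Cons.prems ns nonsingular_mult by (auto simp: Bs Cs)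
qed

fun edge_mats :: "nat list \<Rightarrow> direction list \<Rightarrow> nat \<Rightarrow> matching list \<Rightarrow> 'a::field mat list" where
  "edge_mats ds es k [] = []"
| "edge_mats ds es k (f # fs) = edge_mat (es ! k) (ds ! k) (ds ! Suc k) f # edge_mats ds es (Suc k) fs"

fun matchings :: "nat list \<Rightarrow> nat \<Rightarrow> matching list \<Rightarrow> bool" where
  "matchings ds k [] \<longleftrightarrow> True"
| "matchings ds k (f # fs) \<longleftrightarrow> matching (ds ! k) (ds ! Suc k) f \<and> matchings ds (Suc k) fs"

text \<open>
  Rightward form orders the basis at the right end of every edge, leftward form the basis at its left end.
\<close>
fun shaped :: "form \<Rightarrow> nat list \<Rightarrow> direction list \<Rightarrow> nat \<Rightarrow> matching list \<Rightarrow> bool" where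
  "shaped fm ds es k [] \<longleftrightarrow> True"
| "shaped fm ds es k (f # fs) \<longleftrightarrow>
     (case fm of Rightward \<Rightarrow> aligned (es ! k) (ds ! Suc k) f
       | Leftward \<Rightarrow> aligned (es ! k) (ds ! k) (result (converse_t (ds ! Suc k) f))) \<and>
     shaped fm ds es (Suc k) fs"

lemma length_edge_mats [simp]: "length (edge_mats ds es k fs) = length fs"
  by (induction fs arbitrary: k) auto

lemma edge_mats_append: "edge_mats ds es k (fs @ gs) = edge_mats ds es k fs @ edge_mats ds es (k + length fs) gs"
  by (induction fs arbitrary: k) auto

lemma matchings_append: "matchings ds k (fs @ gs) \<longleftrightarrow> matchings ds k fs \<and> matchings ds (k + length fs) gs"
  by (induction fs arbitrary: k) auto

lemma shaped_append: "shaped fm ds es k (fs @ gs) \<longleftrightarrow> shaped fm ds es k fs \<and> shaped fm ds es (k + length fs) gs"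
  by (induction fs arbitrary: k) auto

definition compose :: "matching \<Rightarrow> matching \<Rightarrow> matching" where
  "compose f h = map (\<lambda>x. case x of None \<Rightarrow> None | Some j \<Rightarrow> h ! j) f"

lemma matching_compose:
  assumes f: "matching n m f" and h: "matching m l h"
  shows "matching n l (compose f h)"
proof -
  have len: "length f = n" by (rule matching_length[OF f])
  have split: "\<exists>j. f ! i = Some j \<and> j < m \<and> h ! j = Some k" if "compose f h ! i = Some k" "i < n" for i k
    using that len matching_less[OF f] by (cases "f ! i") (auto simp: compose_def)
  show ?thesis unfolding matching_def
  proof (intro conjI allI impI)
    show "length (compose f h) = n" by (simp add: compose_def len)
    show "j < l" if "i < n" "compose f h ! i = Some j" for i j
      using split[OF that(2,1)] matching_less[OF h] by auto
    show "i = i'" if i: "i < n" "i' < n" "compose f h ! i = Some j" "compose f h ! i' = Some j" for i i' j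
    proof -
      obtain a b where a: "f ! i = Some a" "a < m" "h ! a = Some j" and b: "f ! i' = Some b" "b < m" "h ! b = Some j"
        using split[OF i(3,1)] split[OF i(4,2)] by blast
      have "a = b" using matching_inj[OF h a(2) b(2) a(3) b(3)] .
      then show ?thesis using matching_inj[OF f i(1,2) a(1)] b(1) by simp
    qed
  qed
qed

lemma reindex_reindex:
  assumes f: "matching n m f"
  shows "reindex n f (reindex m h T) = reindex n (compose f h) T"
proof (rule eq_matI)
  fix r c assume "r < dim_row (reindex n (compose f h) T)" "c < dim_col (reindex n (compose f h) T)"
  then have rc: "r < n" "c < n" by auto
  have "length f = n" by (rule matching_length[OF f])
  then have comp: "compose f h ! i = (case f ! i of None \<Rightarrow> None | Some j \<Rightarrow> h ! j)" if "i < n" for i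
    using that by (simp add: compose_def)
  show "reindex n f (reindex m h T) $$ (r, c) = reindex n (compose f h) T $$ (r, c)"
  proof (cases "f ! r = None \<or> f ! c = None")
    case True
    then show ?thesis using rc by (auto simp: reindex_def comp split: option.split)
  next
    case False
    then obtain i j where ij: "f ! r = Some i" "f ! c = Some j" by auto
    then have "i < m" "j < m" "i = j \<longleftrightarrow> r = c"
      using matching_less[OF f] matching_inj[OF f] rc by auto
    then show ?thesis using rc ij by (auto simp: reindex_def comp split: option.split)
  qed
qed auto

lemma cost_map_matching_le:
  "cost (map_t (\<lambda>x. case x of None \<Rightarrow> return None | Some j \<Rightarrow> tick (h ! j)) f) \<le> 2 * length f + 1"
  by (rule order.trans[OF cost_map_t_le[where c = 1]]) (auto split: option.split)

lemma result_map_matching: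
  "map (\<lambda>x. result (case x of None \<Rightarrow> return None | Some j \<Rightarrow> tick (h ! j))) f = compose f h"
  by (auto simp: compose_def split: option.split)

text \<open>
  Since \<open>h\<close> already accounts for the edges to the right of this list, \<open>reindex _ h T\<close> is what arrives at its right end.
  Passing it one edge further amounts to composing another injection in front of \<open>h\<close>. The inner changes of
  basis are never computed; they only appear in the chain.
\<close>
lemma compose_left_correct:
  assumes "matchings ds k fs" "shaped Rightward ds es k fs"
    and "matching (ds ! (k + length fs)) m h" "lower (ds ! (k + length fs)) (reindex (ds ! (k + length fs)) h T)"
    and D: "\<forall>i \<le> length fs. ds ! (k + i) \<le> D"
  shows "lower (ds ! k) (reindex (ds ! k) (result (compose_left fs h)) T) \<and>
    matching (ds ! k) m (result (compose_left fs h)) \<and>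
    chain ds es k (edge_mats ds es k fs) (edge_mats ds es k fs)
      (reindex (ds ! k) (result (compose_left fs h)) T) (reindex (ds ! (k + length fs)) h T) \<and>
    cost (compose_left fs h) \<le> (2 * D + 2) * length fs + 1"
  using assms
proof (induction fs arbitrary: k)
  case Nil
  then show ?case by (simp add: lower_nonsingular)
next
  case (Cons f fs)
  define h' where "h' = result (compose_left fs h)"
  have f: "matching (ds ! k) (ds ! Suc k) f" and al: "aligned (es ! k) (ds ! Suc k) f"
    using Cons.prems by auto
  have D: "\<forall>i \<le> length fs. ds ! (Suc k + i) \<le> D"
    using Cons.prems(5) by (metis add_Suc_shift length_Cons Suc_le_mono)
  have "ds ! k \<le> D" using Cons.prems(5)[rule_format, of 0] by simp
  then have len: "length f \<le> D" using matching_length[OF f] by simp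
  have IH: "lower (ds ! Suc k) (reindex (ds ! Suc k) h' T)" "matching (ds ! Suc k) m h'"
    "chain ds es (Suc k) (edge_mats ds es (Suc k) fs) (edge_mats ds es (Suc k) fs)
      (reindex (ds ! Suc k) h' T) (reindex (ds ! (Suc k + length fs)) h T)"
    "cost (compose_left fs h) \<le> (2 * D + 2) * length fs + 1"
    using Cons.IH[of "Suc k"] Cons.prems(1-4) D by (auto simp: h'_def)
  have res: "result (compose_left (f # fs) h) = compose f h'"
    by (simp add: h'_def[symmetric] result_map_matching)
  note pass = pass_lower[OF f al IH(1), unfolded reindex_reindex[OF f]]
  have "cost (compose_left (f # fs) h) \<le> (2 * D + 2) * length (f # fs) + 1"
    using IH(4) len cost_map_matching_le[of h' f] by (simp add: h'_def[symmetric] algebra_simps)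
  then show ?case
    unfolding res using pass IH matching_compose[OF f IH(2)] lower_nonsingular
    by (auto simp del: compose_left.simps)
qed

lemma compose_right_correct:
  assumes "matchings ds k fs" "shaped Leftward ds es k fs"
    and "matching (ds ! k) m h" "upper (ds ! k) (reindex (ds ! k) h T)"
    and D: "\<forall>i \<le> length fs. ds ! (k + i) \<le> D"
  defines "h' \<equiv> result (compose_right ds k fs h)"
  shows "matching (ds ! (k + length fs)) m h' \<and>
    chain ds es k (edge_mats ds es k fs) (edge_mats ds es k fs)
      (reindex (ds ! k) h T) (reindex (ds ! (k + length fs)) h' T) \<and>
    cost (compose_right ds k fs h) \<le> (6 * D + 5) * length fs + 1"
  using assms(1-5) unfolding h'_def
proof (induction fs arbitrary: k h)
  case Nil
  then show ?case by (simp add: upper_nonsingular)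
next
  case (Cons f fs)
  define g where "g = result (converse_t (ds ! Suc k) f)"
  have f: "matching (ds ! k) (ds ! Suc k) f" and al: "aligned (es ! k) (ds ! k) g"
    using Cons.prems by (auto simp: g_def)
  have g: "matching (ds ! Suc k) (ds ! k) g"
    unfolding g_def by (rule converse_t_correct(2)[OF f])
  have D: "\<forall>i \<le> length fs. ds ! (Suc k + i) \<le> D"
    using Cons.prems(5) by (metis add_Suc_shift length_Cons Suc_le_mono)
  have "ds ! k \<le> D" "ds ! Suc k \<le> D"
    using Cons.prems(5)[rule_format, of 0] Cons.prems(5)[rule_format, of 1] by simp_all
  moreover have "length g = ds ! Suc k" using matching_length[OF g] by simp
  ultimately have len: "cost (converse_t (ds ! Suc k) f) \<le> 4 * D + 2" "length g \<le> D"
    using converse_t_correct(4)[OF f] by simp_all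
  note pass = pass_upper[OF f al[unfolded g_def] Cons.prems(4), folded g_def, unfolded reindex_reindex[OF g]]
  have IH: "matching (ds ! (Suc k + length fs)) m (result (compose_right ds (Suc k) fs (compose g h)))"
    "chain ds es (Suc k) (edge_mats ds es (Suc k) fs) (edge_mats ds es (Suc k) fs)
      (reindex (ds ! Suc k) (compose g h) T)
      (reindex (ds ! (Suc k + length fs)) (result (compose_right ds (Suc k) fs (compose g h))) T)"
    "cost (compose_right ds (Suc k) fs (compose g h)) \<le> (6 * D + 5) * length fs + 1"
    using Cons.IH[OF _ _ matching_compose[OF g Cons.prems(3)] pass(1) D] Cons.prems(1,2) by auto
  have res: "result (compose_right ds k (f # fs) h) = result (compose_right ds (Suc k) fs (compose g h))"
    by (simp add: g_def[symmetric] result_map_matching)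
  have "cost (compose_right ds k (f # fs) h) \<le> (6 * D + 5) * length (f # fs) + 1"
    using IH(3) len cost_map_matching_le[of h g]
    by (simp add: g_def[symmetric] result_map_matching algebra_simps)
  then show ?case
    unfolding res using pass IH upper_nonsingular[OF Cons.prems(4)]
    by (auto simp del: compose_right.simps)
qed

section \<open>Passing permutations\<close>

text \<open>
  Position \<open>t\<close> holds the old index of the new basis vector \<open>t\<close>, so the permutation matrix, as a change of
  basis, is the transpose of the matrix of \<open>p\<close> read as an injection.
\<close>
definition permutation :: "nat \<Rightarrow> nat list \<Rightarrow> bool" where
  "permutation d p \<longleftrightarrow> length p = d \<and> distinct p \<and> set p = {..<d}"

definition perm_mat :: "nat \<Rightarrow> nat list \<Rightarrow> 'a::field mat" where
  "perm_mat d p = (matching_mat d d (map Some p))\<^sup>T"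

lemma permutation_less: "permutation d p \<Longrightarrow> t < d \<Longrightarrow> p ! t < d"
  by (metis lessThan_iff nth_mem permutation_def)

lemma permutation_inj: "permutation d p \<Longrightarrow> s < d \<Longrightarrow> t < d \<Longrightarrow> p ! s = p ! t \<longleftrightarrow> s = t"
  by (simp add: permutation_def nth_eq_iff_index_eq)

lemma permutation_matching: "permutation d p \<Longrightarrow> matching d d (map Some p)"
  using permutation_less permutation_inj by (auto simp: matching_def permutation_def)

lemma perm_mat_carrier [simp]:
  "perm_mat d p \<in> carrier_mat d d" "dim_row (perm_mat d p) = d" "dim_col (perm_mat d p) = d"
  by (simp_all add: perm_mat_def)

lemma perm_mat_inverse:
  assumes p: "permutation d p"
  shows "perm_mat d p * matching_mat d d (map Some p) = (1\<^sub>m d :: 'a::field mat)"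
    "nonsingular d (perm_mat d p :: 'a::field mat)"
proof -
  let ?N = "matching_mat d d (map Some p) :: 'a mat"
  have len: "length p = d" using p by (simp add: permutation_def)
  have "?N * perm_mat d p = 1\<^sub>m d"
  proof (rule eq_matI)
    fix i j assume "i < dim_row (1\<^sub>m d :: 'a mat)" "j < dim_col (1\<^sub>m d :: 'a mat)"
    then have ij: "i < d" "j < d" by auto
    then have "(?N * perm_mat d p) $$ (i, j) = perm_mat d p $$ (p ! i, j)"
      by (subst matching_mat_mult[OF permutation_matching[OF p] perm_mat_carrier(1)]) (auto simp: len)
    then show "(?N * perm_mat d p) $$ (i, j) = 1\<^sub>m d $$ (i, j)"
      using ij permutation_less[OF p] permutation_inj[OF p] by (simp add: perm_mat_def len)
  qed auto
  then show *: "perm_mat d p * ?N = 1\<^sub>m d"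
    by (rule mat_mult_left_right_inverse[rotated 2]) auto
  show "nonsingular d (perm_mat d p :: 'a mat)"
    by (rule nonsingularI[OF _ _ *]) auto
qed

lemma perm_mat_upt: "perm_mat d [0..<d] = 1\<^sub>m d"
  by (intro eq_matI) (auto simp: perm_mat_def)

lemma permutation_upt: "permutation d [0..<d]"
  by (auto simp: permutation_def)

lemma result_permute_columns_t:
  assumes p: "permutation d p" and A: "A \<in> carrier_mat n d"
  shows "result (permute_columns_t A p) = A * perm_mat d p"
proof (rule eq_matI)
  fix r c assume "r < dim_row (A * perm_mat d p)" "c < dim_col (A * perm_mat d p)"
  then have rc: "r < n" "c < d" using A by auto
  have len: "length p = d" using p by (simp add: permutation_def)
  have "(matching_mat d d (map Some p) * A\<^sup>T) $$ (c, r) = A $$ (r, p ! c)"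
    using rc A len permutation_less[OF p] by (subst matching_mat_mult[OF permutation_matching[OF p]]) auto
  moreover have "(matching_mat d d (map Some p) * A\<^sup>T)\<^sup>T = A * perm_mat d p"
    using A transpose_mult[of "matching_mat d d (map Some p)" d d "A\<^sup>T" n] by (simp add: perm_mat_def)
  then have "(A * perm_mat d p) $$ (r, c) = (matching_mat d d (map Some p) * A\<^sup>T)\<^sup>T $$ (r, c)"
    by simp
  ultimately show "result (permute_columns_t A p) $$ (r, c) = (A * perm_mat d p) $$ (r, c)"
    using rc A by (simp add: permute_columns_t_def)
qed (use A in \<open>auto simp: permute_columns_t_def\<close>)

lemma cost_permute_columns_t_le:
  "dim_row A \<le> D \<Longrightarrow> dim_col A \<le> D \<Longrightarrow> 1 \<le> D \<Longrightarrow> cost (permute_columns_t A p) \<le> 6 * D ^ 2"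
  unfolding permute_columns_t_def by (rule order.trans[OF cost_mat_t_le[where c = 2 and D = D]]) auto

lemma matching_mat_compose:
  assumes f: "matching n m f" and g: "matching m l g"
  shows "matching_mat n l (compose f g) = (matching_mat n m f * matching_mat m l g :: 'a::field mat)"
proof (rule eq_matI)
  fix i j assume "i < dim_row (matching_mat n m f * matching_mat m l g :: 'a mat)"
    "j < dim_col (matching_mat n m f * matching_mat m l g :: 'a mat)"
  then have ij: "i < n" "j < l" by auto
  have "length f = n" by (rule matching_length[OF f])
  then have "compose f g ! i = (case f ! i of None \<Rightarrow> None | Some j \<Rightarrow> g ! j)"
    using ij by (simp add: compose_def)
  then show "(matching_mat n l (compose f g) :: 'a mat) $$ (i, j) = (matching_mat n m f * matching_mat m l g) $$ (i, j)"
    using ij matching_less[OF f ij(1)]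
    by (subst matching_mat_mult[OF f matching_mat_carrier(1) ij]) (auto split: option.split)
qed auto

text \<open>
  The hypothesis is the identity between compositions of injections that \<open>align_t\<close> establishes. Moving
  the permutation matrices to the other side yields the squares for edges of both directions.
\<close>
lemma permute_matching_mat:
  fixes N N' :: "'a::field mat"
  assumes p: "permutation n p" and q: "permutation m q"
    and N: "N \<in> carrier_mat n m" "N' \<in> carrier_mat n m"
    and eq: "matching_mat n n (map Some p) * N = N' * matching_mat m m (map Some q)"
  shows "N * perm_mat m q = perm_mat n p * N'"
    and "N\<^sup>T * perm_mat n p = perm_mat m q * N'\<^sup>T"
proof -
  let ?P = "matching_mat n n (map Some p) :: 'a mat" and ?Q = "matching_mat m m (map Some q) :: 'a mat"
  have P: "perm_mat n p * ?P = 1\<^sub>m n" by (rule perm_mat_inverse(1)[OF p])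
  have Q: "?Q * perm_mat m q = 1\<^sub>m m"
    by (rule mat_mult_left_right_inverse[OF _ _ perm_mat_inverse(1)[OF q]]) auto
  have "N = perm_mat n p * ?P * N" using N by (simp add: P)
  also have "\<dots> = perm_mat n p * (?P * N)" by (rule assoc_mult_mat[where ?n\<^sub>2.0 = n and ?n\<^sub>3.0 = n]) (use N in auto)
  also have "\<dots> = perm_mat n p * (N' * ?Q)" by (simp add: eq)
  also have "\<dots> = perm_mat n p * N' * ?Q" by (rule assoc_mult_mat[symmetric]) (use N in auto)
  finally have "N * perm_mat m q = perm_mat n p * N' * ?Q * perm_mat m q" by simp
  also have "\<dots> = perm_mat n p * N'"
    by (rule mult_mult_inverse[OF _ _ _ _ Q]) (use N in auto)
  finally show "N * perm_mat m q = perm_mat n p * N'" .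
  have "(?P * N)\<^sup>T = N\<^sup>T * ?P\<^sup>T" by (rule transpose_mult) (use N in auto)
  moreover have "(N' * ?Q)\<^sup>T = ?Q\<^sup>T * N'\<^sup>T" by (rule transpose_mult) (use N in auto)
  ultimately show "N\<^sup>T * perm_mat n p = perm_mat m q * N'\<^sup>T"
    by (simp add: eq perm_mat_def)
qed

lemma inverse_permutation_fold:
  assumes p: "permutation d p" and len: "length pos0 = d"
    and f: "\<And>t pos. result (f t pos) = pos[p ! t := t]" "\<And>t pos. cost (f t pos) \<le> 2"
  shows "length (result (fold_t f [0..<d] pos0)) = d
    \<and> (\<forall>t < d. result (fold_t f [0..<d] pos0) ! (p ! t) = t)"
proof (rule fold_t_upt(1)[where P = "\<lambda>k pos. length pos = d \<and> (\<forall>t < k. pos ! (p ! t) = t)" and c = 2])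
  fix k pos assume "k < d" "length pos = d \<and> (\<forall>t < k. pos ! (p ! t) = t)"
  then show "length (result (f k pos)) = d \<and> (\<forall>t < Suc k. result (f k pos) ! (p ! t) = t)"
    using permutation_less[OF p] permutation_inj[OF p]
    by (auto simp: f(1) nth_list_update less_Suc_eq)
qed (use len f(2) in auto)

text \<open>
  The array \<open>pos\<close> inverts \<open>p\<close>, so the defined values of the new injection are, in order, the
  positions of \<open>hits\<close> in \<open>p\<close>: consecutive numbers, starting from 0 or ending with \<open>d - 1\<close>.
\<close>
lemma align_t_correct:
  assumes h: "matching n d h" and res: "result (align_t e d h) = (h', p)"
  shows "permutation d p" "matching n d h'" "aligned e d h'" "compose h' (map Some p) = h"
    and "cost (align_t e d h) \<le> 9 * n + 9 * d + 9"
proof -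
  have len: "length h = n" by (rule matching_length[OF h])
  define g where "g = result (converse_t d h)"
  define indices where "indices = filter (\<lambda>i. h ! i \<noteq> None) [0..<n]"
  define hits where "hits = map (\<lambda>i. the (h ! i)) indices"
  define rest where "rest = filter (\<lambda>j. g ! j = None) [0..<d]"
  have hits_eq: "map (\<lambda>x. the x) (filter (\<lambda>x. x \<noteq> None) h) = hits"
  proof -
    have "filter (\<lambda>x. x \<noteq> None) h = map ((!) h) indices"
      using filter_map[of "\<lambda>x. x \<noteq> None" "(!) h" "[0..<n]"] map_nth[of h]
      by (simp add: indices_def len comp_def)
    then show ?thesis by (simp add: hits_def)
  qed
  \<comment> \<open>The position in \<open>p\<close> at which \<open>hits\<close> starts.\<close>
  define offset where "offset = (case e of ToLeft \<Rightarrow> 0 | ToRight \<Rightarrow> length rest)"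
  define p0 where "p0 = (case e of ToLeft \<Rightarrow> hits @ rest | ToRight \<Rightarrow> rest @ hits)"
  have append: "result (case e of ToLeft \<Rightarrow> append_t hits rest | ToRight \<Rightarrow> append_t rest hits) = p0"
    by (simp add: p0_def split: direction.split)
  define step where "step = (\<lambda>t (pos :: nat list). bind_timed (tick (p0 ! t)) (\<lambda>j. tick (pos[j := t])))"
  define pos where "pos = result (fold_t step [0..<d] (map (\<lambda>j. 0) [0..<d]))"
  define relabel where "relabel = (\<lambda>x. case x of None \<Rightarrow> return None
      | Some j \<Rightarrow> bind_timed (tick (pos ! j)) (\<lambda>t. return (Some t)))"
  \<comment> \<open>Folding the intermediate results keeps the unfolded program readable, for its result and its cost alike.\<close>
  note unfold_align = align_t_def cost_bind g_def[symmetric] result_filter_t result_map_t result_tick hits_eq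
      result_bind rest_def[symmetric] append step_def[symmetric] result_array_t result_return pos_def[symmetric]
      relabel_def[symmetric]
  have relabel: "result (relabel x) = map_option ((!) pos) x" for x
    by (cases x) (auto simp: relabel_def)
  have "(h', p) = (map (\<lambda>x. result (relabel x)) h, p0)"
    unfolding res[symmetric] unfold_align ..
  then have h'_eq: "h' = map (map_option ((!) pos)) h" and p0: "p0 = p"
    by (simp_all add: relabel)
  have p_eq: "p = (case e of ToLeft \<Rightarrow> hits @ rest | ToRight \<Rightarrow> rest @ hits)"
    by (simp add: p0[symmetric] p0_def)
  have g: "matching d n g" by (simp add: g_def converse_t_correct(2)[OF h])
  have g_iff: "g ! j = None \<longleftrightarrow> (\<forall>i < n. h ! i \<noteq> Some j)" if "j < d" for j
    using converse_t_correct(1)[OF h _ that, folded g_def] matching_less[OF g that]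
    by (cases "g ! j") auto
  have "inj_on (\<lambda>i. the (h ! i)) (set indices)"
    using matching_inj[OF h] by (intro inj_onI) (auto simp: indices_def)
  then have "distinct hits" by (simp add: hits_def distinct_map) (simp add: indices_def)
  moreover have "distinct rest" by (simp add: rest_def)
  moreover have hits_set: "set hits = {j. \<exists>i < n. h ! i = Some j}"
    by (force simp: hits_def indices_def)
  moreover have rest_set: "set rest = {j. j < d \<and> (\<forall>i < n. h ! i \<noteq> Some j)}"
    using g_iff by (auto simp: rest_def)
  ultimately have "distinct p" "set p = {..<d}"
    using matching_less[OF h] by (auto simp: p_eq split: direction.splits)
  then show p: "permutation d p"
    using distinct_card[of p] by (simp add: permutation_def)
  have lengths: "length hits + length rest = d"
    using p by (auto simp: permutation_def p_eq split: direction.splits)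
  have p_nth: "p ! (offset + t) = hits ! t" if "t < length hits" for t
    using that by (auto simp: p_eq offset_def nth_append split: direction.split)
  have offset: "offset + length hits \<le> d"
    using lengths by (auto simp: offset_def split: direction.split)
  have pos: "pos ! (p ! t) = t" if "t < d" for t
    using inverse_permutation_fold[OF p, of "map (\<lambda>j. 0) [0..<d]" step] that
    by (simp add: step_def pos_def p0)
  have len': "length h' = n" by (simp add: h'_eq len)
  have hit: "\<exists>s < length hits. i = indices ! s \<and> t = offset + s \<and> h ! i = Some (p ! t)"
    if i: "i < n" "h' ! i = Some t" for i t
  proof -
    obtain j where j: "h ! i = Some j" "t = pos ! j"
      using i by (auto simp: h'_eq len)
    then have "i \<in> set indices" using i by (simp add: indices_def)
    then obtain s where s: "s < length indices" "i = indices ! s" by (metis in_set_conv_nth)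
    then have s': "s < length hits" by (simp add: hits_def)
    have "j = hits ! s" using s j by (simp add: hits_def)
    then have "j = p ! (offset + s)" using p_nth[OF s'] by simp
    moreover have "offset + s < d" using offset s' by simp
    ultimately show ?thesis using j s s' pos[of "offset + s"] by auto
  qed
  show "compose h' (map Some p) = h"
  proof (rule nth_equalityI)
    fix i assume "i < length (compose h' (map Some p))"
    then have i: "i < n" by (simp add: compose_def len')
    show "compose h' (map Some p) ! i = h ! i"
    proof (cases "h' ! i")
      case None
      then show ?thesis using i by (simp add: compose_def len' h'_eq len)
    next
      case (Some t)
      then obtain s where "s < length hits" "t = offset + s" "h ! i = Some (p ! t)"
        using hit[OF i] by blast
      moreover have "length p = d" using p by (simp add: permutation_def)
      ultimately show ?thesis using i Some offset by (simp add: compose_def len')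
    qed
  qed (simp add: compose_def len len')
  show "matching n d h'"
    unfolding matching_def
  proof (intro conjI allI impI)
    show "length h' = n" by (rule len')
    show "j < d" if "i < n" "h' ! i = Some j" for i j
      using hit[OF that] offset by auto
    show "i = i'" if "i < n" "i' < n" "h' ! i = Some j" "h' ! i' = Some j" for i i' j
      using hit[OF that(1,3)] hit[OF that(2,4)] matching_inj[OF h that(1,2)] by auto
  qed
  have "sorted_wrt (<) indices" by (simp add: indices_def sorted_wrt_filter)
  then have indices_mono: "indices ! s < indices ! t" if "s < t" "t < length hits" for s t
    using that by (simp add: sorted_wrt_iff_nth_less hits_def)
  have "i < j" if ab: "a < n" "b < n" "a < b" "h' ! a = Some i" "h' ! b = Some j" for a b i j
  proof -
    \<comment> \<open>Positions in \<open>indices\<close> are ordered like the indices themselves, and the new value is the position up to the offset.\<close>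
    obtain s t where st: "s < length hits" "a = indices ! s" "i = offset + s"
      "t < length hits" "b = indices ! t" "j = offset + t"
      using hit[OF ab(1,4)] hit[OF ab(2,5)] by blast
    then have "\<not> t < s" "t \<noteq> s" using ab(3) indices_mono[of t s] by auto
    then show ?thesis using st by simp
  qed
  moreover have "case e of ToLeft \<Rightarrow> i < x | ToRight \<Rightarrow> x < i"
    if a: "a < n" "h' ! a = Some i" and x: "x < d" "\<forall>b < n. h' ! b \<noteq> Some x" for a i x
  proof -
    obtain s where s: "s < length hits" "i = offset + s" using hit[OF a] by blast
    have "\<not> (offset \<le> x \<and> x < offset + length hits)"
    proof
      assume *: "offset \<le> x \<and> x < offset + length hits"
      then have "x - offset < length hits" by linarith
      then have "p ! x \<in> set hits"
        using p_nth[of "x - offset"] nth_mem[of "x - offset" hits] * by simp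
      then obtain b where b: "b < n" "h ! b = Some (p ! x)" using hits_set by auto
      then have "h' ! b = Some x" using pos[OF x(1)] by (simp add: h'_eq len)
      then show False using x b by blast
    qed
    then show ?thesis
      using s x lengths by (cases e) (auto simp: offset_def)
  qed
  ultimately show "aligned e d h'"
    unfolding aligned_def len' by blast
  have c1: "cost (converse_t d h) \<le> d + 3 * n + 2" by (rule converse_t_correct(4)[OF h])
  have c2: "cost (filter_t (\<lambda>x. tick (x \<noteq> None)) h) \<le> 2 * n + 1"
    by (rule order.trans[OF cost_filter_t_le[where c = 1]]) (auto simp: len)
  have "length (filter (\<lambda>x. x \<noteq> None) h) \<le> n" using length_filter_le[of _ h] len by simp
  then have c3: "cost (map_t (\<lambda>x. tick (the x)) (filter (\<lambda>x. x \<noteq> None) h)) \<le> 2 * n + 1"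
    by (intro order.trans[OF cost_map_t_le[where c = 1]]) auto
  have c4: "cost (filter_t (\<lambda>j. bind_timed (tick (g ! j)) (\<lambda>x. tick (x = None))) [0..<d]) \<le> 3 * d + 1"
    by (rule order.trans[OF cost_filter_t_le[where c = 2]]) auto
  have c5: "cost (case e of ToLeft \<Rightarrow> append_t hits rest | ToRight \<Rightarrow> append_t rest hits) \<le> d + 1"
    using lengths by (cases e) auto
  have c6: "cost (array_t d (\<lambda>j. return (0 :: nat))) \<le> d + 1"
    by (rule order.trans[OF cost_array_t_le[where c = 0]]) auto
  have c7: "cost (fold_t step [0..<d] (map (\<lambda>j. 0) [0..<d])) \<le> 3 * d + 1"
    by (rule order.trans[OF fold_t_upt_cost[where c = 2]]) (auto simp: step_def)
  have c8: "cost (map_t relabel h) \<le> 2 * n + 1"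
    by (rule order.trans[OF cost_map_t_le[where c = 1]]) (auto simp: len relabel_def split: option.split)
  have "cost (align_t e d h) = cost (converse_t d h) + (cost (filter_t (\<lambda>x. tick (x \<noteq> None)) h)
    + (cost (map_t (\<lambda>x. tick (the x)) (filter (\<lambda>x. x \<noteq> None) h))
    + (cost (filter_t (\<lambda>j. bind_timed (tick (g ! j)) (\<lambda>x. tick (x = None))) [0..<d])
    + (cost (case e of ToLeft \<Rightarrow> append_t hits rest | ToRight \<Rightarrow> append_t rest hits)
    + (cost (array_t d (\<lambda>j. return (0 :: nat))) + (cost (fold_t step [0..<d] (map (\<lambda>j. 0) [0..<d]))
    + cost (map_t relabel h)))))))"
    unfolding unfold_align by simp
  then show "cost (align_t e d h) \<le> 9 * n + 9 * d + 9"
    using c1 c2 c3 c4 c5 c6 c7 c8 by linarith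
qed

text \<open>
  First \<open>p\<close> and then \<open>f\<close> is the same as first the aligned injection and then \<open>q\<close>.
\<close>
lemma permuted_edge:
  assumes f: "matching n m f" and p: "permutation n p" and res: "result (align_t e m (map ((!) f) p)) = (f', q)"
  shows "matching n m (map ((!) f) p)"
    and "matching_mat n n (map Some p) * matching_mat n m f
      = matching_mat n m f' * (matching_mat m m (map Some q) :: 'a::field mat)"
proof -
  have "map ((!) f) p = compose (map Some p) f" by (simp add: compose_def)
  then show h: "matching n m (map ((!) f) p)"
    using matching_compose[OF permutation_matching[OF p] f] by simp
  note align = align_t_correct(1-4)[OF h res]
  show "matching_mat n n (map Some p) * matching_mat n m f
      = matching_mat n m f' * (matching_mat m m (map Some q) :: 'a mat)"
    using matching_mat_compose[OF permutation_matching[OF p] f, where 'a = 'a]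
      matching_mat_compose[OF align(2) permutation_matching[OF align(1)], where 'a = 'a] align(4)
      \<open>map ((!) f) p = compose (map Some p) f\<close> by simp
qed

lemma sweep_right_correct:
  assumes "matchings ds k fs" "permutation (ds ! k) p" "result (sweep_right ds es k p fs) = (gs, q)"
    and D: "\<forall>i \<le> length fs. ds ! (k + i) \<le> D"
  shows "length gs = length fs \<and> matchings ds k gs \<and> shaped Rightward ds es k gs
    \<and> permutation (ds ! (k + length fs)) q
    \<and> chain ds es k (edge_mats ds es k fs) (edge_mats ds es k gs)
        (perm_mat (ds ! k) p) (perm_mat (ds ! (k + length fs)) q :: 'a::field mat)
    \<and> cost (sweep_right ds es k p fs) \<le> (20 * D + 15) * length fs + 1"
  using assms
proof (induction fs arbitrary: k p gs)
  case Nil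
  then show ?case by (auto intro: perm_mat_inverse)
next
  case (Cons f fs)
  let ?n = "ds ! k" and ?m = "ds ! Suc k" and ?h = "map ((!) f) p"
  have f: "matching ?n ?m f" using Cons.prems by simp
  have p: "permutation ?n p" by (rule Cons.prems(2))
  obtain f' p' where align: "result (align_t (es ! k) ?m ?h) = (f', p')" by fastforce
  obtain gs' q' where sweep: "result (sweep_right ds es (Suc k) p' fs) = (gs', q')" by fastforce
  have [simp]: "gs = f' # gs'" "q' = q"
    using Cons.prems(3) by (simp_all add: align sweep)
  note edge = permuted_edge[OF f p align]
  note aligned = align_t_correct[OF edge(1) align]
  have D: "\<forall>i \<le> length fs. ds ! (Suc k + i) \<le> D"
    using Cons.prems(4) by (metis add_Suc_shift length_Cons Suc_le_mono)
  have dims: "?n \<le> D" "?m \<le> D"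
    using Cons.prems(4)[rule_format, of 0] Cons.prems(4)[rule_format, of 1] by simp_all
  have IH: "length gs' = length fs" "matchings ds (Suc k) gs'" "shaped Rightward ds es (Suc k) gs'"
    "permutation (ds ! (Suc k + length fs)) q"
    "chain ds es (Suc k) (edge_mats ds es (Suc k) fs) (edge_mats ds es (Suc k) gs')
        (perm_mat ?m p') (perm_mat (ds ! (Suc k + length fs)) q :: 'a mat)"
    "cost (sweep_right ds es (Suc k) p' fs) \<le> (20 * D + 15) * length fs + 1"
    using Cons.IH[OF _ aligned(1) sweep[unfolded \<open>q' = q\<close>] D] Cons.prems(1) by auto
  have "intertwines (es ! k) (edge_mat (es ! k) ?n ?m f) (perm_mat ?n p) (perm_mat ?m p' :: 'a mat)
      (edge_mat (es ! k) ?n ?m f')"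
    using permute_matching_mat[OF p aligned(1) _ _ edge(2)[where 'a = 'a]]
    by (simp add: intertwines_def edge_mat_def split: direction.split)
  moreover have "cost (map_t (\<lambda>i. tick (f ! i)) p) \<le> 2 * D + 1"
    using p dims by (intro order.trans[OF cost_map_t_le[where c = 1]]) (auto simp: permutation_def)
  then have "cost (sweep_right ds es k p (f # fs)) \<le> (20 * D + 15) * length (f # fs) + 1"
    using aligned(5) dims IH(6) by (simp add: align sweep algebra_simps)
  ultimately show ?case
    using IH aligned perm_mat_inverse(2)[OF p] by (auto simp del: sweep_right.simps)
qed

text \<open>
  Each edge is read from right to left by passing to the converse injection, aligned, and converted back;
  reading the result from right to left again returns the aligned injection.
\<close>
lemma sweep_left_correct:
  assumes "matchings ds k fs" "permutation (ds ! (k + length fs)) p" "result (sweep_left ds es k p fs) = (gs, q)"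
    and D: "\<forall>i \<le> length fs. ds ! (k + i) \<le> D"
  shows "length gs = length fs \<and> matchings ds k gs \<and> shaped Leftward ds es k gs
    \<and> permutation (ds ! k) q
    \<and> chain ds es k (edge_mats ds es k fs) (edge_mats ds es k gs)
        (perm_mat (ds ! k) q) (perm_mat (ds ! (k + length fs)) p :: 'a::field mat)
    \<and> cost (sweep_left ds es k p fs) \<le> (30 * D + 20) * length fs + 1"
  using assms
proof (induction fs arbitrary: k gs q)
  case Nil
  then show ?case by (auto intro: perm_mat_inverse)
next
  case (Cons f fs)
  let ?n = "ds ! k" and ?m = "ds ! Suc k"
  obtain gs' p' where sweep: "result (sweep_left ds es (Suc k) p fs) = (gs', p')" by fastforce
  define g where "g = result (converse_t ?m f)"
  let ?h = "map ((!) g) p'"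
  have f: "matching ?n ?m f" using Cons.prems by simp
  have g: "matching ?m ?n g" and g_mat: "(matching_mat ?m ?n g :: 'a mat) = (matching_mat ?n ?m f)\<^sup>T"
    using converse_t_correct(2,3)[OF f] by (simp_all add: g_def)
  have D: "\<forall>i \<le> length fs. ds ! (Suc k + i) \<le> D"
    using Cons.prems(4) by (metis add_Suc_shift length_Cons Suc_le_mono)
  have dims: "?n \<le> D" "?m \<le> D"
    using Cons.prems(4)[rule_format, of 0] Cons.prems(4)[rule_format, of 1] by simp_all
  have IH: "length gs' = length fs" "matchings ds (Suc k) gs'" "shaped Leftward ds es (Suc k) gs'"
    "permutation ?m p'"
    "chain ds es (Suc k) (edge_mats ds es (Suc k) fs) (edge_mats ds es (Suc k) gs')
        (perm_mat ?m p') (perm_mat (ds ! (Suc k + length fs)) p :: 'a mat)"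
    "cost (sweep_left ds es (Suc k) p fs) \<le> (30 * D + 20) * length fs + 1"
    using Cons.IH[OF _ _ sweep D] Cons.prems(1,2) by auto
  obtain h' p'' where align: "result (align_t (es ! k) ?n ?h) = (h', p'')" by fastforce
  define f' where "f' = result (converse_t ?n h')"
  have [simp]: "gs = f' # gs'" "q = p''"
    using Cons.prems(3) by (simp_all add: align sweep g_def[symmetric] f'_def)
  note edge = permuted_edge[OF g IH(4) align]
  note aligned = align_t_correct[OF edge(1) align]
  have f': "matching ?n ?m f'" and f'_mat: "(matching_mat ?n ?m f' :: 'a mat) = (matching_mat ?m ?n h')\<^sup>T"
    using converse_t_correct(2,3)[OF aligned(2)] by (simp_all add: f'_def)
  have "result (converse_t ?m f') = h'"
    unfolding f'_def by (rule converse_t_converse_t[OF aligned(2)])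
  moreover have "intertwines (es ! k) (edge_mat (es ! k) ?n ?m f) (perm_mat ?n p'') (perm_mat ?m p' :: 'a mat)
      (edge_mat (es ! k) ?n ?m f')"
    using permute_matching_mat[OF IH(4) aligned(1) _ _ edge(2)[where 'a = 'a]]
    by (simp add: intertwines_def edge_mat_def g_mat f'_mat split: direction.split)
  moreover have "cost (map_t (\<lambda>i. tick (g ! i)) p') \<le> 2 * D + 1"
    using IH(4) dims by (intro order.trans[OF cost_map_t_le[where c = 1]]) (auto simp: permutation_def)
  then have "cost (sweep_left ds es k p (f # fs)) \<le> (30 * D + 20) * length (f # fs) + 1"
    using aligned(5) dims IH(6) converse_t_correct(4)[OF f] converse_t_correct(4)[OF aligned(2)]
    by (simp add: align sweep g_def[symmetric] algebra_simps)
  ultimately show ?case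
    using IH aligned f' perm_mat_inverse(2)[OF aligned(1)] by (auto simp del: sweep_left.simps)
qed

section \<open>The recursion\<close>

lemma quiver_rep_edge:
  "quiver_rep ds es As \<Longrightarrow> i < length es \<Longrightarrow> As ! i \<in> edge_carrier (es ! i) (ds ! i) (ds ! Suc i)"
  by (auto simp: quiver_rep_def edge_carrier_def)

text \<open>
  Both parts have size at most \<open>n / 2\<close>, so their logarithms are smaller by 1 than that of \<open>n\<close>; they
  contain \<open>n - 1\<close> edges altogether, which saves at least \<open>n / 2\<close>. The summand \<open>1 / 2\<close> is for \<open>n = 1\<close>, where nothing is saved.
\<close>
lemma divide_log_bound:
  assumes "1 \<le> n"
  defines "h \<equiv> n div 2" and "r \<equiv> n - Suc (n div 2)"
  shows "real h * log 2 (real h) + real r * log 2 (real r) + real n / 2 \<le> 1 / 2 + real n * log 2 (real n)"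
proof (cases "n = 1")
  case False
  then have n: "2 \<le> n" using assms by simp
  have half: "real k * log 2 (real k) \<le> real k * (log 2 (real n) - 1)" if "2 * k \<le> n" for k
  proof (cases "k = 0")
    case False
    have "log 2 (real k) \<le> log 2 (real n / 2)" using that False by (intro log_mono) auto
    also have "\<dots> = log 2 (real n) - 1" using n by (simp add: log_divide)
    finally show ?thesis by (intro mult_left_mono) auto
  qed simp
  have hr: "real h + real r = real n - 1" using n by (simp add: h_def r_def)
  have "log 2 (real n) \<ge> 1" using n by (simp add: le_log_iff)
  have "real h * log 2 (real h) + real r * log 2 (real r) \<le> (real h + real r) * (log 2 (real n) - 1)"
  proof -
    have "2 * h \<le> n" "2 * r \<le> n" by (simp_all add: h_def r_def)
    from add_mono[OF half[OF this(1)] half[OF this(2)]] show ?thesis by (simp add: distrib_right)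
  qed
  also have "\<dots> = real n * log 2 (real n) - log 2 (real n) - real n + 1"
    unfolding hr by (simp add: algebra_simps)
  finally show ?thesis using n \<open>log 2 (real n) \<ge> 1\<close> by linarith
qed (simp add: h_def r_def)

text \<open>
  The number \<open>2 n + 1\<close> of nodes of the recursion tree occurs as a factor because the leaves, for \<open>n = 0\<close>, also cost
  up to \<open>O(d\<^sup>2)\<close>.
\<close>
definition time_bound :: "nat \<Rightarrow> nat \<Rightarrow> real" where
  "time_bound D n = 600 * (real D ^ 3 * (2 * real n + 1) + real D * (real n * log 2 (real n)))"

lemma time_bound_divide:
  assumes "1 \<le> n" "1 \<le> D"
  shows "time_bound D (n div 2) + time_bound D (n - Suc (n div 2)) + 300 * (real D ^ 3 + real D * real n)
    \<le> time_bound D n"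
proof -
  define h r where "h = n div 2" and "r = n - Suc (n div 2)"
  have hr: "real h + real r = real n - 1" using assms by (simp add: h_def r_def)
  have "real D * (real h * log 2 (real h) + real r * log 2 (real r) + real n / 2)
      \<le> real D * (1 / 2 + real n * log 2 (real n))"
    using divide_log_bound[OF assms(1)] by (intro mult_left_mono) (simp_all add: h_def r_def)
  moreover define c where "c = real D ^ 3"
  have "real D \<le> c"
    using assms(2) self_le_power[of "real D" 3] by (simp add: c_def)
  moreover have "c * (2 * real h + 1) + c * (2 * real r + 1) = c * (2 * real n)"
    using hr by (simp add: algebra_simps flip: distrib_left)
  ultimately show ?thesis
    unfolding time_bound_def r_def[symmetric] unfolding h_def[symmetric] c_def[symmetric] by (simp add: algebra_simps)
qed

text \<open>
  The specification of the recursion: the pivot matrices have the requested shapes and are isomorphic to the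
  given edges through changes of basis that equal the leftover factors at the ends.
\<close>
definition solved ::
  "nat list \<Rightarrow> direction list \<Rightarrow> 'a::field mat list \<Rightarrow> form \<Rightarrow> nat \<Rightarrow> nat \<Rightarrow> matching list \<times> 'a mat \<times> 'a mat \<Rightarrow> bool" where
  "solved ds es As fm a n = (\<lambda>(fs, X, Y). length fs = n \<and> matchings ds a fs \<and> shaped fm ds es a fs
     \<and> chain ds es a (take n (drop a As)) (edge_mats ds es a fs) X Y)"

lemma move_left:
  assumes e: "chain ds es k As (edge_mats ds es k fs) X Y" "matchings ds k fs" "shaped Rightward ds es k fs"
    and T: "lower (ds ! (k + length fs)) T"
    and D: "\<forall>i \<le> length fs. ds ! (k + i) \<le> D"
  defines "h \<equiv> result (compose_left fs (map Some [0..<ds ! (k + length fs)]))"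
  shows "chain ds es k As (edge_mats ds es k fs) (X * reindex (ds ! k) h T) (Y * T)"
    and "cost (compose_left fs (map Some [0..<ds ! (k + length fs)])) \<le> (2 * D + 2) * length fs + 1"
proof -
  let ?m = "ds ! (k + length fs)"
  have "matching ?m ?m (map Some [0..<?m])" by (rule permutation_matching[OF permutation_upt])
  moreover have "reindex ?m (map Some [0..<?m]) T = T"
    using T by (intro reindex_Some) (simp add: triangular_def)
  ultimately have "chain ds es k (edge_mats ds es k fs) (edge_mats ds es k fs) (reindex (ds ! k) h T) T"
    and cost: "cost (compose_left fs (map Some [0..<?m])) \<le> (2 * D + 2) * length fs + 1"
    using compose_left_correct[OF e(2,3) _ _ D, of ?m "map Some [0..<?m]" T] T by (simp_all add: h_def)
  from chain_mult[OF e(1) this(1)]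
  show "chain ds es k As (edge_mats ds es k fs) (X * reindex (ds ! k) h T) (Y * T)" .
  show "cost (compose_left fs (map Some [0..<?m])) \<le> (2 * D + 2) * length fs + 1" by (rule cost)
qed

lemma move_right:
  assumes e: "chain ds es k As (edge_mats ds es k fs) X Y" "matchings ds k fs" "shaped Leftward ds es k fs"
    and T: "upper (ds ! k) T"
    and D: "\<forall>i \<le> length fs. ds ! (k + i) \<le> D"
  defines "h \<equiv> result (compose_right ds k fs (map Some [0..<ds ! k]))"
  shows "chain ds es k As (edge_mats ds es k fs) (X * T) (Y * reindex (ds ! (k + length fs)) h T)"
    and "cost (compose_right ds k fs (map Some [0..<ds ! k])) \<le> (6 * D + 5) * length fs + 1"
proof -
  let ?m = "ds ! k"
  have "matching ?m ?m (map Some [0..<?m])" by (rule permutation_matching[OF permutation_upt])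
  moreover have "reindex ?m (map Some [0..<?m]) T = T"
    using T by (intro reindex_Some) (simp add: triangular_def)
  ultimately have "chain ds es k (edge_mats ds es k fs) (edge_mats ds es k fs) T (reindex (ds ! (k + length fs)) h T)"
    and cost: "cost (compose_right ds k fs (map Some [0..<?m])) \<le> (6 * D + 5) * length fs + 1"
    using compose_right_correct[OF e(2,3) _ _ D, of ?m "map Some [0..<?m]" T] T by (simp_all add: h_def)
  from chain_mult[OF e(1) this(1)]
  show "chain ds es k As (edge_mats ds es k fs) (X * T) (Y * reindex (ds ! (k + length fs)) h T)" .
  show "cost (compose_right ds k fs (map Some [0..<?m])) \<le> (6 * D + 5) * length fs + 1" by (rule cost)
qed

text \<open>
  Passing the leftover factors \<open>Y\<close> and \<open>X\<close> of the two halves to the middle edge.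
\<close>
definition pass_t :: "direction \<Rightarrow> 'a::field mat \<Rightarrow> 'a mat \<Rightarrow> 'a mat \<Rightarrow> 'a mat timed" where
  "pass_t e A Y X = (case e of
     ToLeft \<Rightarrow> bind_timed (inverse_t Y) (\<lambda>Z. bind_timed (mult_t Z A) (\<lambda>B. mult_t B X))
   | ToRight \<Rightarrow> bind_timed (inverse_t X) (\<lambda>Z. bind_timed (mult_t Z A) (\<lambda>B. mult_t B Y)))"

lemma mult_inverse_mult:
  fixes A :: "'a::field mat"
  assumes Y: "nonsingular n Y" and X: "X \<in> carrier_mat m m" and A: "A \<in> carrier_mat n m"
    and D: "n \<le> D" "m \<le> D" "1 \<le> D"
  defines "run \<equiv> bind_timed (inverse_t Y) (\<lambda>Z. bind_timed (mult_t Z A) (\<lambda>B. mult_t B X))"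
  shows "result run \<in> carrier_mat n m" "A * X = Y * result run" "cost run \<le> 62 * D ^ 3"
proof -
  let ?Z = "result (inverse_t Y)"
  have Y': "Y \<in> carrier_mat n n" "dim_row Y = n" "dim_col Y = n" using Y by (auto simp: nonsingular_def)
  have Z: "?Z \<in> carrier_mat n n" by (rule inverse_t_left_inverse(1)[OF Y])
  have ZA: "result (mult_t ?Z A) = ?Z * A" using Z A by (intro result_mult_t) auto
  have run: "result run = ?Z * A * X"
    using Z A X by (simp add: run_def ZA result_mult_t)
  then show "result run \<in> carrier_mat n m" using Z A X by simp
  have "Y * (?Z * A * X) = Y * (?Z * (A * X))"
    using Z A X by simp
  also have "\<dots> = Y * ?Z * (A * X)"
    by (rule assoc_mult_mat[symmetric, where ?n\<^sub>1.0 = n and ?n\<^sub>2.0 = n and ?n\<^sub>3.0 = n and ?n\<^sub>4.0 = m]) (use Y' Z A X in auto)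
  also have "\<dots> = A * X"
    using A X by (simp add: inverse_t_right_inverse[OF Y])
  finally show "A * X = Y * result run" by (simp add: run)
  have "cost (inverse_t Y) \<le> 42 * D ^ 3" using Y' D by (intro cost_inverse_t_le) auto
  moreover have "cost (mult_t ?Z A) \<le> 10 * D ^ 3" using Z A D by (intro cost_mult_t_le) auto
  moreover have "cost (mult_t (?Z * A) X) \<le> 10 * D ^ 3" using Z A X D by (intro cost_mult_t_le) auto
  ultimately show "cost run \<le> 62 * D ^ 3" by (simp add: run_def ZA)
qed

lemma pass_t_correct:
  assumes A: "A \<in> edge_carrier e n m" and Y: "nonsingular n Y" and X: "nonsingular m X"
    and D: "n \<le> D" "m \<le> D" "1 \<le> D"
  shows "result (pass_t e A Y X) \<in> edge_carrier e n m" "intertwines e A Y X (result (pass_t e A Y X))"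
    "cost (pass_t e A Y X) \<le> 62 * D ^ 3"
  using mult_inverse_mult[of n Y X m A D] mult_inverse_mult[of m X Y n A D] assms
  by (cases e; simp add: pass_t_def edge_carrier_def intertwines_def nonsingular_def)+

lemma dense_eq_edge_mats: 
  assumes "length fs = length es" shows "dense ds es fs = edge_mats ds es 0 fs"
proof -
  have nth: "edge_mats ds es k fs ! i = edge_mat (es ! (k + i)) (ds ! (k + i)) (ds ! Suc (k + i)) (fs ! i)"
    if "i < length fs" for i k and fs :: "matching list"
    using that by (induction fs arbitrary: k i) (auto simp: nth_Cons split: nat.split)
  show ?thesis
    using assms by (intro nth_equalityI)
      (auto simp: dense_def nth edge_mat_def matching_mat_def split: direction.split intro!: eq_matI)
qed

lemma pivot_edge_mat:
  assumes f: "matching n m f" shows "pivot_mat (edge_mat e n m f)"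
  using matching_inj[OF f] by (cases e) (auto simp: pivot_mat_def edge_mat_def split: if_splits)

lemma pivot_edge_mats:
  "matchings ds k fs \<Longrightarrow> B \<in> set (edge_mats ds es k fs) \<Longrightarrow> pivot_mat B"
  by (induction fs arbitrary: k) (auto simp: pivot_edge_mat)

text \<open>
  Collecting the hidden inner changes of basis turns a chain into an isomorphism of representations.
\<close>
lemma chain_family:
  "chain ds es k As Bs X Y \<Longrightarrow> \<exists>g. g k = X \<and> (\<forall>i \<le> length As. nonsingular (ds ! (k + i)) (g (k + i))) \<and>
    (\<forall>i < length As. intertwines (es ! (k + i)) (As ! i) (g (k + i)) (g (Suc (k + i))) (Bs ! i)
      \<and> Bs ! i \<in> edge_carrier (es ! (k + i)) (ds ! (k + i)) (ds ! Suc (k + i)))"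
proof (induction ds es k As Bs X Y rule: chain.induct)
  case (1 ds es k X Y)
  then show ?case by (intro exI[of _ "\<lambda>_. X"]) auto
next
  case (2 ds es k A As B Bs X Y)
  obtain Z where Z: "intertwines (es ! k) A X Z B" "chain ds es (Suc k) As Bs Z Y"
    and B: "B \<in> edge_carrier (es ! k) (ds ! k) (ds ! Suc k)" and X: "nonsingular (ds ! k) X"
    using 2 by auto
  obtain g where g: "g (Suc k) = Z" "\<And>i. i \<le> length As \<Longrightarrow> nonsingular (ds ! (Suc k + i)) (g (Suc k + i))"
    "\<And>i. i < length As \<Longrightarrow> intertwines (es ! (Suc k + i)) (As ! i) (g (Suc k + i)) (g (Suc (Suc k + i))) (Bs ! i)
      \<and> Bs ! i \<in> edge_carrier (es ! (Suc k + i)) (ds ! (Suc k + i)) (ds ! Suc (Suc k + i))"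
    using 2(1)[OF Z(2)] by blast
  define g' where "g' = g(k := X)"
  have "nonsingular (ds ! (k + i)) (g' (k + i))" if "i \<le> length (A # As)" for i
    using that g(2) X by (cases i) (auto simp: g'_def)
  moreover have "intertwines (es ! (k + i)) ((A # As) ! i) (g' (k + i)) (g' (Suc (k + i))) ((B # Bs) ! i)
      \<and> (B # Bs) ! i \<in> edge_carrier (es ! (k + i)) (ds ! (k + i)) (ds ! Suc (k + i))"
    if "i < length (A # As)" for i
    using that g(1) g(3) Z(1) B by (cases i) (auto simp: g'_def)
  ultimately show ?case by (intro exI[of _ g']) (auto simp: g'_def)
qed auto

lemma solved_barcode_form:
  fixes As :: "'a::field mat list"
  assumes rep: "quiver_rep ds es As" and "solved ds es As fm 0 (length es) (fs, X, Y)"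
  shows "barcode_form ds es As (dense ds es fs)"
proof -
  have lens: "length ds = Suc (length es)" "length As = length es" using rep by (auto simp: quiver_rep_def)
  define Bs :: "'a mat list" where "Bs = edge_mats ds es 0 fs"
  have s: "length fs = length es" "matchings ds 0 fs" "chain ds es 0 As Bs X Y"
    using assms by (auto simp: solved_def lens Bs_def)
  obtain g where g: "\<And>i. i \<le> length es \<Longrightarrow> nonsingular (ds ! i) (g i)"
    "\<And>i. i < length es \<Longrightarrow> intertwines (es ! i) (As ! i) (g i) (g (Suc i)) (Bs ! i)"
    "\<And>i. i < length es \<Longrightarrow> Bs ! i \<in> edge_carrier (es ! i) (ds ! i) (ds ! Suc i)"
    using chain_family[OF s(3)] by (auto simp: lens)
  have "quiver_rep ds es Bs"
    using g(3) lens s(1) by (auto simp: quiver_rep_def edge_carrier_def Bs_def)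
  moreover have "rep_iso ds es As Bs"
    unfolding rep_iso_def
  proof (intro exI[of _ g] conjI allI impI)
    fix i assume "i < length ds"
    then have "nonsingular (ds ! i) (g i)" using g(1) lens by simp
    then show "g i \<in> carrier_mat (ds ! i) (ds ! i)" "invertible_mat (g i)"
      by (auto simp: nonsingular_def intro: nonsingular_imp_invertible_mat[of "ds ! i"])
  next
    fix i assume "i < length es"
    from g(2)[OF this] show "case es ! i of ToLeft \<Rightarrow> As ! i * g (Suc i) = g i * Bs ! i
        | ToRight \<Rightarrow> As ! i * g i = g (Suc i) * Bs ! i"
      by (simp add: intertwines_def)
  qed
  ultimately show ?thesis
    using pivot_edge_mats[OF s(2)] by (auto simp: barcode_form_def dense_eq_edge_mats[OF s(1)] Bs_def)
qed

text \<open>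
  Let \<open>X\<^sub>1, Y\<^sub>1\<close> and \<open>X\<^sub>2, Y\<^sub>2\<close> be the leftover factors of the halves and \<open>G, H\<close> the triangular factors of the
  middle edge. After \<open>G\<close> and \<open>H\<close> have been passed outwards, three chains meet in \<open>Y\<^sub>1 G\<close> and \<open>X\<^sub>2 H\<close> at the ends
  of the middle edge. Passing the permutation starts with the identity at the vertex next to the half that has
  the requested form already, so that half is kept as it is.
\<close>
lemma solve_step:
  fixes As :: "'a::field mat list"
  assumes rep: "quiver_rep ds es As" and bound: "\<forall>i \<le> length es. ds ! i \<le> D" and D: "1 \<le> D"
    and n: "n \<noteq> 0" and an: "a + n \<le> length es"
    and res1: "result (solve ds es As Rightward a (n div 2)) = (fs1, X1, Y1)"
    and s1: "solved ds es As Rightward a (n div 2) (fs1, X1, Y1)"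
    and res2: "result (solve ds es As Leftward (Suc (a + n div 2)) (n - Suc (n div 2))) = (fs2, X2, Y2)"
    and s2: "solved ds es As Leftward (Suc (a + n div 2)) (n - Suc (n div 2)) (fs2, X2, Y2)"
  shows "solved ds es As fm a n (result (solve ds es As fm a n)) \<and>
    cost (solve ds es As fm a n) \<le> cost (solve ds es As Rightward a (n div 2))
      + cost (solve ds es As Leftward (Suc (a + n div 2)) (n - Suc (n div 2))) + 300 * (D ^ 3 + D * n)"
proof -
  define l r m where "l = n div 2" and "r = n - Suc l" and "m = a + l"
  note folds = r_def[symmetric] m_def[symmetric] l_def[symmetric]
  have m: "m < length es" "m = a + l" "a + n = Suc (m + r)" "n = Suc (l + r)"
    using n an by (auto simp: m_def l_def r_def)
  define A e where "A = As ! m" and "e = es ! m"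
  let ?dm = "ds ! m" and ?dm' = "ds ! Suc m"
  have As: "length As = length es" using rep by (simp add: quiver_rep_def)
  have slice: "take n (drop a As) = take l (drop a As) @ A # take r (drop (Suc m) As)"
  proof -
    have "drop (a + l) As = A # drop (Suc m) As"
      using m As by (simp add: A_def Cons_nth_drop_Suc)
    then show ?thesis
      unfolding m(4) using take_add[of l "Suc r" "drop a As"] by (simp add: add.commute)
  qed
  have le: "ds ! i \<le> D" if "i \<le> length es" for i using bound that by blast
  have f1: "length fs1 = l" "matchings ds a fs1" "shaped Rightward ds es a fs1"
      "chain ds es a (take l (drop a As)) (edge_mats ds es a fs1) X1 Y1"
    and f2: "length fs2 = r" "matchings ds (Suc m) fs2" "shaped Leftward ds es (Suc m) fs2"
      "chain ds es (Suc m) (take r (drop (Suc m) As)) (edge_mats ds es (Suc m) fs2) X2 Y2"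
    using s1 s2 by (simp_all add: solved_def folds)
  have len1: "length (take l (drop a As)) = l" and len2: "length (take r (drop (Suc m) As)) = r"
    using m As an by auto
  have ns: "nonsingular (ds ! a) X1" "nonsingular ?dm Y1" "nonsingular ?dm' X2" "nonsingular (ds ! (a + n)) Y2"
    using chain_left[OF f1(4)] chain_right[OF f1(4), unfolded len1]
      chain_left[OF f2(4)] chain_right[OF f2(4), unfolded len2]
    by (simp_all add: m(2) m(3)[unfolded m(2)])
  then have carrier: "X1 \<in> carrier_mat (ds ! a) (ds ! a)" "Y1 \<in> carrier_mat ?dm ?dm"
    "X2 \<in> carrier_mat ?dm' ?dm'" "Y2 \<in> carrier_mat (ds ! (a + n)) (ds ! (a + n))"
    by (simp_all add: nonsingular_def)
  have A: "A \<in> edge_carrier e ?dm ?dm'"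
    using quiver_rep_edge[OF rep m(1)] by (simp add: A_def e_def)
  have dm: "?dm \<le> D" "?dm' \<le> D" "ds ! a \<le> D" "ds ! (a + n) \<le> D" using m an by (auto intro: le)
  define A' where "A' = result (pass_t e A Y1 X2)"
  note pass = pass_t_correct[OF A ns(2,3) dm(1,2) D, folded A'_def]
  obtain G H f where factor: "result (factor_t fm e A') = (G, H, f)" by (metis prod_cases3)
  note GHf = factor_t_correct[OF pass(1) factor dm(1,2) D]
  have GH: "nonsingular ?dm G" "nonsingular ?dm' H" using GHf by (auto intro: lower_nonsingular upper_nonsingular)
  define h1 G' X where "h1 = result (compose_left fs1 (map Some [0..<?dm]))"
    and "G' = reindex (ds ! a) h1 G" and "X = X1 * G'"
  define h2 H' Y where "h2 = result (compose_right ds (Suc m) fs2 (map Some [0..<?dm']))"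
    and "H' = reindex (ds ! (a + n)) h2 H" and "Y = Y2 * H'"
  have left: "chain ds es a (take l (drop a As)) (edge_mats ds es a fs1) X (Y1 * G)"
    and left_cost: "cost (compose_left fs1 (map Some [0..<?dm])) \<le> (2 * D + 2) * l + 1"
    using move_left[OF f1(4,2,3), of G D] GHf(1) le m by (auto simp: f1(1) X_def G'_def h1_def)
  have end_eq: "Suc m + r = a + n" using m(3) by simp
  have "\<forall>i \<le> length fs2. ds ! (Suc m + i) \<le> D" using le m(3) an by (simp add: f2(1))
  from move_right[OF f2(4,2,3) GHf(2) this]
  have right: "chain ds es (Suc m) (take r (drop (Suc m) As)) (edge_mats ds es (Suc m) fs2) (X2 * H) Y"
    and right_cost: "cost (compose_right ds (Suc m) fs2 (map Some [0..<?dm'])) \<le> (6 * D + 5) * r + 1"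
    unfolding f2(1) end_eq Y_def H'_def h2_def .
  have edge: "intertwines e A (Y1 * G) (X2 * H) (edge_mat e ?dm ?dm' f)"
    by (rule intertwines_mult[OF A pass(1) edge_mat_carrier _ _ _ _ pass(2) GHf(4)])
      (use carrier GH in \<open>auto simp: nonsingular_def\<close>)
  \<comment> \<open>The middle edge joined to the right half, for sweeping right, and (below) to the left half, for sweeping left.\<close>
  have middle: "chain ds es m (A # take r (drop (Suc m) As)) (edge_mats ds es m (f # fs2)) (Y1 * G) Y"
    using edge right A nonsingular_mult[OF ns(2) GH(1)] by (auto simp: e_def)
  have "chain ds es a (take l (drop a As) @ [A]) (edge_mats ds es a (fs1 @ [f])) X (X2 * H)"
    unfolding edge_mats_append f1(1) m(2)[symmetric]
    by (rule chain_append[OF left, unfolded len1 m(2)[symmetric]])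
      (use edge A nonsingular_mult[OF ns(2) GH(1)] nonsingular_mult[OF ns(3) GH(2)] in
        \<open>auto simp: e_def\<close>)
  note left' = this
  have ns': "X \<in> carrier_mat (ds ! a) (ds ! a)" "Y \<in> carrier_mat (ds ! (a + n)) (ds ! (a + n))"
    using chain_left[OF left] chain_right[OF right, unfolded len2] by (simp_all add: m(3) nonsingular_def)
  have mult: "result (mult_t X1 G') = X" "result (mult_t Y2 H') = Y"
    using carrier by (auto simp: X_def Y_def G'_def H'_def intro!: result_mult_t)
  have dims: "dim_col X1 = ds ! a" "dim_col Y2 = ds ! (a + n)" using carrier by auto
  define finish where "finish = (case fm of
      Rightward \<Rightarrow> bind_timed (array_t ?dm return) (\<lambda>p. bind_timed (sweep_right ds es m p (f # fs2)) (\<lambda>(fs3, p').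
        bind_timed (append_t fs1 fs3) (\<lambda>fs. bind_timed (permute_columns_t Y p') (\<lambda>Y'. return (fs, X, Y')))))
    | Leftward \<Rightarrow> bind_timed (array_t ?dm' return) (\<lambda>p. bind_timed (append_t fs1 [f]) (\<lambda>fs3.
        bind_timed (sweep_left ds es a p fs3) (\<lambda>(fs4, p').
        bind_timed (append_t fs4 fs2) (\<lambda>fs. bind_timed (permute_columns_t X p') (\<lambda>X'. return (fs, X', Y)))))))"
  have result_array_id: "result (array_t k return) = [0..<k]" for k by simp
  have fsM: "matchings ds m (f # fs2)" "matchings ds a (fs1 @ [f])"
    using f1(1,2) f2(2) GHf(3) m(2) by (simp_all add: matchings_append)
  have array_cost: "cost (array_t k return) \<le> k + 1" for k
    by (rule order.trans[OF cost_array_t_le[where c = 0]]) auto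
  have finish: "solved ds es As fm a n (result finish) \<and> cost finish \<le> (60 * D + 60) * n + 6 * D ^ 2"
  proof (cases fm)
    case Rightward
    obtain fs3 p where res: "result (sweep_right ds es m [0..<?dm] (f # fs2)) = (fs3, p)" by fastforce
    have "\<forall>i \<le> length (f # fs2). ds ! (m + i) \<le> D" using le m(3) an by (simp add: f2(1))
    from sweep_right_correct[OF fsM(1) permutation_upt res this, where 'a = 'a]
    have sweep: "length fs3 = Suc r" "matchings ds m fs3" "shaped Rightward ds es m fs3"
      "permutation (ds ! (a + n)) p"
      "chain ds es m (edge_mats ds es m (f # fs2)) (edge_mats ds es m fs3) (1\<^sub>m ?dm) (perm_mat (ds ! (a + n)) p :: 'a mat)"
      "cost (sweep_right ds es m [0..<?dm] (f # fs2)) \<le> (20 * D + 15) * Suc r + 1"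
      by (simp_all add: f2(1) m(3) perm_mat_upt)
    have YG: "Y1 * G \<in> carrier_mat ?dm ?dm" using carrier GH by (simp add: nonsingular_def)
    from chain_mult[OF middle sweep(5)]
    have "chain ds es m (A # take r (drop (Suc m) As)) (edge_mats ds es m fs3) (Y1 * G) (Y * perm_mat (ds ! (a + n)) p)"
      by (simp only: right_mult_one_mat[OF YG])
    then have "chain ds es a (take n (drop a As)) (edge_mats ds es a (fs1 @ fs3)) X (Y * perm_mat (ds ! (a + n)) p)"
      unfolding slice edge_mats_append f1(1) m(2)[symmetric]
      by (rule chain_append[OF left, unfolded len1 m(2)[symmetric]])
    then have "solved ds es As fm a n (fs1 @ fs3, X, Y * perm_mat (ds ! (a + n)) p)"
      using f1 sweep(1-3) m(2,4) Rightward by (simp add: solved_def matchings_append shaped_append)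
    moreover have "result finish = (fs1 @ fs3, X, Y * perm_mat (ds ! (a + n)) p)"
      unfolding finish_def Rightward form.case result_bind result_array_id res prod.case result_append_t
        result_permute_columns_t[OF sweep(4) ns'(2)] result_return ..
    moreover have "cost (permute_columns_t Y p) \<le> 6 * D ^ 2"
      using ns' dm D by (intro cost_permute_columns_t_le) auto
    moreover have "cost finish = cost (array_t ?dm return) + (cost (sweep_right ds es m [0..<?dm] (f # fs2))
        + (cost (append_t fs1 fs3) + cost (permute_columns_t Y p)))"
      unfolding finish_def Rightward form.case cost_bind result_array_id res prod.case result_append_t
        by simp
    ultimately show ?thesis
      using array_cost[of ?dm] sweep(6) dm(1) D by (simp add: f1(1) m(4) algebra_simps)
  next
    case Leftward
    obtain fs4 p where res: "result (sweep_left ds es a [0..<?dm'] (fs1 @ [f])) = (fs4, p)" by fastforce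
    have "\<forall>i \<le> length (fs1 @ [f]). ds ! (a + i) \<le> D" using le m an by (simp add: f1(1))
    moreover have "permutation (ds ! (a + length (fs1 @ [f]))) [0..<?dm']"
      using permutation_upt by (simp add: f1(1) m(2))
    ultimately have sweep: "length fs4 = Suc l" "matchings ds a fs4" "shaped Leftward ds es a fs4"
      "permutation (ds ! a) p"
      "chain ds es a (edge_mats ds es a (fs1 @ [f])) (edge_mats ds es a fs4) (perm_mat (ds ! a) p :: 'a mat) (1\<^sub>m ?dm')"
      "cost (sweep_left ds es a [0..<?dm'] (fs1 @ [f])) \<le> (30 * D + 20) * Suc l + 1"
      using sweep_left_correct[OF fsM(2) _ res, where 'a = 'a] by (simp_all add: f1(1) m(2) perm_mat_upt)
    have XH: "X2 * H \<in> carrier_mat ?dm' ?dm'" using carrier GH by (simp add: nonsingular_def)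
    from chain_mult[OF left' sweep(5)]
    have "chain ds es a (take l (drop a As) @ [A]) (edge_mats ds es a fs4) (X * perm_mat (ds ! a) p) (X2 * H)"
      by (simp only: right_mult_one_mat[OF XH])
    moreover have "a + length (take l (drop a As) @ [A]) = Suc m"
      using len1 m(2) by simp
    ultimately have "chain ds es a ((take l (drop a As) @ [A]) @ take r (drop (Suc m) As))
        (edge_mats ds es a (fs4 @ fs2)) (X * perm_mat (ds ! a) p) Y"
      using right unfolding edge_mats_append sweep(1) m(2) by (intro chain_append) simp_all
    then have "chain ds es a (take n (drop a As)) (edge_mats ds es a (fs4 @ fs2)) (X * perm_mat (ds ! a) p) Y"
      by (simp add: slice)
    then have "solved ds es As fm a n (fs4 @ fs2, X * perm_mat (ds ! a) p, Y)"
      using f2 sweep(1-3) m(2,4) Leftward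
      by (simp add: solved_def matchings_append shaped_append)
    moreover have "result finish = (fs4 @ fs2, X * perm_mat (ds ! a) p, Y)"
      unfolding finish_def Leftward form.case result_bind result_array_id result_append_t res prod.case
        result_permute_columns_t[OF sweep(4) ns'(1)] result_return ..
    moreover have "cost (permute_columns_t X p) \<le> 6 * D ^ 2"
      using ns' dm D by (intro cost_permute_columns_t_le) auto
    moreover have "cost finish = cost (array_t ?dm' return) + (cost (append_t fs1 [f])
        + (cost (sweep_left ds es a [0..<?dm'] (fs1 @ [f]))
        + (cost (append_t fs4 fs2) + cost (permute_columns_t X p))))"
      unfolding finish_def Leftward form.case cost_bind result_array_id res prod.case result_append_t
        by simp
    ultimately show ?thesis
      using array_cost[of ?dm'] sweep(1,6) dm(2) D by (simp add: f1(1) m(4) algebra_simps)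
  qed
  note unfold_solve = solve.simps[of ds es As fm a n] if_not_P[OF n] cost_bind result_bind result_tick cost_tick
    folds res1[unfolded folds] res2[unfolded folds] prod.case e_def[symmetric] A_def[symmetric]
    pass_t_def[symmetric] A'_def[symmetric] factor result_array_t h1_def[symmetric] h2_def[symmetric]
    result_reindex_t dims G'_def[symmetric] H'_def[symmetric] mult finish_def[symmetric] result_return
  have result: "result (solve ds es As fm a n) = result finish"
    unfolding unfold_solve ..
  have "cost (solve ds es As fm a n) = cost (solve ds es As Rightward a l) + cost (solve ds es As Leftward (Suc m) r)
      + 6 + cost (pass_t e A Y1 X2) + cost (factor_t fm e A')
      + cost (array_t ?dm (\<lambda>i. return (Some i))) + cost (compose_left fs1 (map Some [0..<?dm]))
      + cost (reindex_t (ds ! a) h1 G) + cost (mult_t X1 G')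
      + cost (array_t ?dm' (\<lambda>i. return (Some i))) + cost (compose_right ds (Suc m) fs2 (map Some [0..<?dm']))
      + cost (reindex_t (ds ! (a + n)) h2 H) + cost (mult_t Y2 H') + cost finish"
    unfolding unfold_solve by simp
  moreover have "cost (array_t ?dm (\<lambda>i. return (Some i))) \<le> (0 + 1) * ?dm + 1"
    "cost (array_t ?dm' (\<lambda>i. return (Some i))) \<le> (0 + 1) * ?dm' + 1"
    by (rule cost_array_t_le, simp)+
  moreover have "cost (reindex_t (ds ! a) h1 G) \<le> 7 * D ^ 2" "cost (reindex_t (ds ! (a + n)) h2 H) \<le> 7 * D ^ 2"
    using dm D by (auto intro: cost_reindex_t_le)
  moreover have "cost (mult_t X1 G') \<le> 10 * D ^ 3" "cost (mult_t Y2 H') \<le> 10 * D ^ 3"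
    using dm D carrier by (auto intro!: cost_mult_t_le simp: G'_def H'_def)
  moreover have "D ^ 2 \<le> D ^ 3" "D \<le> D ^ 3" "1 \<le> D ^ 3"
    using D self_le_power[of D 3] by (auto intro: power_increasing)
  moreover have "(2 * D + 2) * l + (6 * D + 5) * r + (60 * D + 60) * n \<le> 140 * (D * n)"
  proof -
    have *: "(2 * D + 2) * l \<le> (4 * D) * n" "(6 * D + 5) * r \<le> (11 * D) * n" "(60 * D + 60) * n \<le> (120 * D) * n"
      using D m(4) by (intro mult_le_mono; simp)+
    show ?thesis using add_mono[OF add_mono[OF *(1,2)] *(3)] by (rule order.trans) simp
  qed
  ultimately have "cost (solve ds es As fm a n)
    \<le> cost (solve ds es As Rightward a l) + cost (solve ds es As Leftward (Suc m) r) + 300 * (D ^ 3 + D * n)"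
    using pass(3) GHf(5) left_cost right_cost finish dm by simp
  then show ?thesis
    using finish by (simp add: result folds)
qed

lemma solve_correct:
  fixes As :: "'a::field mat list"
  assumes rep: "quiver_rep ds es As" and bound: "\<forall>i \<le> length es. ds ! i \<le> D" and D: "1 \<le> D"
  shows "a + n \<le> length es \<Longrightarrow> solved ds es As fm a n (result (solve ds es As fm a n)) \<and>
    real (cost (solve ds es As fm a n)) \<le> time_bound D n"
proof (induction n arbitrary: a fm rule: less_induct)
  case (less n)
  show ?case
  proof (cases "n = 0")
    case True
    have "ds ! a \<le> D" using bound less.prems by simp
    then have "cost (id_t (ds ! a) :: 'a mat timed) \<le> 5 * D ^ 2" using D by (intro cost_id_t_le)
    moreover have "D ^ 2 \<le> D ^ 3" "1 \<le> D ^ 3" using D by (auto intro: power_increasing)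
    ultimately have "cost (id_t (ds ! a) :: 'a mat timed) + 1 \<le> 600 * D ^ 3" by linarith
    then have "real (cost (id_t (ds ! a) :: 'a mat timed) + 1) \<le> real (600 * D ^ 3)"
      by (rule of_nat_mono)
    then show ?thesis
      unfolding \<open>n = 0\<close>
      by (simp add: solve.simps[of ds es As fm a 0] solved_def nonsingular_one time_bound_def)
  next
    case False
    obtain fs1 X1 Y1 where res1: "result (solve ds es As Rightward a (n div 2)) = (fs1, X1, Y1)"
      by (metis prod_cases3)
    obtain fs2 X2 Y2 where res2:
      "result (solve ds es As Leftward (Suc (a + n div 2)) (n - Suc (n div 2))) = (fs2, X2, Y2)"
      by (metis prod_cases3)
    have IH1: "solved ds es As Rightward a (n div 2) (fs1, X1, Y1)"
        "real (cost (solve ds es As Rightward a (n div 2))) \<le> time_bound D (n div 2)"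
      using less.IH[of "n div 2" a Rightward] less.prems False by (simp_all add: res1)
    have IH2: "solved ds es As Leftward (Suc (a + n div 2)) (n - Suc (n div 2)) (fs2, X2, Y2)"
        "real (cost (solve ds es As Leftward (Suc (a + n div 2)) (n - Suc (n div 2))))
          \<le> time_bound D (n - Suc (n div 2))"
      using less.IH[of "n - Suc (n div 2)" "Suc (a + n div 2)" Leftward] less.prems False
      by (simp_all add: res2)
    note step = solve_step[OF rep bound D False less.prems res1 IH1(1) res2 IH2(1), of fm]
    have "real (cost (solve ds es As fm a n))
      \<le> real (cost (solve ds es As Rightward a (n div 2))
        + cost (solve ds es As Leftward (Suc (a + n div 2)) (n - Suc (n div 2))) + 300 * (D ^ 3 + D * n))"
      using step by (intro of_nat_mono) simp
    also have "\<dots> \<le> time_bound D (n div 2) + time_bound D (n - Suc (n div 2)) + 300 * (real D ^ 3 + real D * real n)"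
      using IH1(2) IH2(2) by simp
    also have "\<dots> \<le> time_bound D n"
      using False D by (intro time_bound_divide) auto
    finally show ?thesis using step by simp
  qed
qed

theorem proposition15:
  shows "\<exists>C::real. \<forall>(ds :: nat list) (es :: direction list) (As :: 'a::field mat list) (fm :: form).
    quiver_rep ds es As \<longrightarrow>
      (let run = divide_and_conquer fm ds es As; n = length es; d = Max (set ds) in
        barcode_form ds es As (dense ds es (result run)) \<and>
        (n \<ge> 1 \<and> d \<ge> 2 \<longrightarrow>
          real (cost run) \<le>
            C * (real d ^ 3 * real n + (real d * log 2 (real d)) * (real n * log 2 (real n)))))"
proof (intro exI[of _ 1800] allI impI)
  fix ds :: "nat list" and es :: "direction list" and As :: "'a mat list" and fm :: form
  assume rep: "quiver_rep ds es As"
  define n d where "n = length es" and "d = Max (set ds)"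
  obtain fs X Y where res: "result (solve ds es As fm 0 n) = (fs, X, Y)" by (metis prod_cases3)
  have len: "length ds = Suc n" using rep by (simp add: quiver_rep_def n_def)
  have d: "\<forall>i \<le> length es. ds ! i \<le> d"
    using len by (auto simp: d_def n_def less_Suc_eq_le)
  have "solved ds es As fm 0 n (fs, X, Y)"
    \<comment> \<open>The maximum covers the case that all spaces have dimension 0.\<close>
    using solve_correct[OF rep, of "max 1 d" 0 n fm] d res by (auto simp: n_def le_max_iff_disj)
  then have barcode: "barcode_form ds es As (dense ds es (result (divide_and_conquer fm ds es As)))"
    using solved_barcode_form[OF rep] by (simp add: divide_and_conquer_def res n_def[symmetric])
  have "real (cost (divide_and_conquer fm ds es As))
      \<le> 1800 * (real d ^ 3 * real n + (real d * log 2 (real d)) * (real n * log 2 (real n)))"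
    if nd: "1 \<le> n" "2 \<le> d"
  proof -
    have "real (cost (divide_and_conquer fm ds es As)) \<le> time_bound d n"
      using solve_correct[OF rep d, of 0 n fm] nd by (simp add: divide_and_conquer_def res n_def[symmetric])
    \<comment> \<open>Here \<open>2 n + 1 \<le> 3 n\<close> and \<open>1 \<le> log d\<close> enter; the factor 3 is why the constant is \<open>3 * 600\<close>.\<close>
    also have "\<dots> \<le> 600 * (real d ^ 3 * (3 * real n) + (real d * log 2 (real d)) * (real n * log 2 (real n)))"
      unfolding time_bound_def
    proof (intro mult_left_mono add_mono mult_right_mono)
      have "1 \<le> log 2 (real d)" using nd by (simp add: le_log_iff)
      then show "real d \<le> real d * log 2 (real d)" using mult_left_mono[of 1 "log 2 (real d)" "real d"] by simp
      show "0 \<le> real n * log 2 (real n)" using nd by simp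
    qed (use nd in auto)
    also have "\<dots> \<le> 1800 * (real d ^ 3 * real n + (real d * log 2 (real d)) * (real n * log 2 (real n)))"
      using nd by (simp add: algebra_simps)
    finally show ?thesis .
  qed
  with barcode show "let run = divide_and_conquer fm ds es As; n = length es; d = Max (set ds) in
        barcode_form ds es As (dense ds es (result run)) \<and>
        (n \<ge> 1 \<and> d \<ge> 2 \<longrightarrow>
          real (cost run) \<le>
            1800 * (real d ^ 3 * real n + (real d * log 2 (real d)) * (real n * log 2 (real n))))"
    by (simp add: Let_def n_def d_def)
qed

end
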